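(* Let $(M,\alpha)$ be a $3$-dimensional $b^m$-contact manifold ($m\geq1$) with critical hypersurface $Z$, and assume that $Z$ is closed (and non-empty). Then there exist infinitely many periodic Reeb orbits of $\alpha$ on $Z$.
   Context: Let $M$ be a manifold with a hypersurface $Z=z^{-1}(0)$, where $z:M\to\mathbb{R}$ is a global defining function ($dz\neq0$ along $Z$). A $b^m$-vector field is a smooth vector field $v$ with $v(z)\in z^mC^\infty(M)$. These are the sections of a vector bundle ${}^{b^m}TM$, locally spanned by $z^m\partial_z$ and the coordinate fields along $Z$. A $b^m$-form of degree $k$ is a section of $\Lambda^k({}^{b^m}TM)^*$; it can be written $\frac{dz}{z^m}\wedge\eta+\beta$ with $\eta,\beta$ smooth forms. The exterior derivative is the extension of the usual one on $M\setminus Z$. On $M^{2n+1}$, a $b^m$-contact form is a $b^m$-form $\alpha$ of degree 1 with $\alpha\wedge(d\alpha)^n\neq0$ everywhere as a section of $\Lambda^{2n+1}({}^{b^m}TM)^*$; $(M,\alpha)$ is then a $b^m$-contact manifold and $Z$ its critical hypersurface (critical set). The Reeb vector field $R_\alpha$ is the unique $b^m$-vector field with $\iota_{R_\alpha}d\alpha=0$, $\alpha(R_\alpha)=1$. Viewed as a smooth vector field it is tangent to $Z$ and may vanish at points of $Z$. Closed means compact without boundary. A periodic Reeb orbit is a non-constant periodic orbit of $R_\alpha$. *)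

theory Defs
  imports "HOL-Analysis.Analysis"
begin

primrec C_k_on :: "nat \<Rightarrow> 'b::euclidean_space set \<Rightarrow> ('b \<Rightarrow> 'c::real_normed_vector) \<Rightarrow> bool" where
  "C_k_on 0 S f \<longleftrightarrow> continuous_on S f"
| "C_k_on (Suc k) S f \<longleftrightarrow>
     (\<forall>x\<in>S. f differentiable (at x)) \<and>
     (\<forall>v. C_k_on k S (\<lambda>x. frechet_derivative f (at x) v))"

text \<open>Only used for open \<open>S\<close>.\<close>

definition smooth_on :: "'b::euclidean_space set \<Rightarrow> ('b \<Rightarrow> 'c::real_normed_vector) \<Rightarrow> bool" where
  "smooth_on S f \<longleftrightarrow> (\<forall>k. C_k_on k S f)"

text \<open>
  The manifold is the whole type \<open>'a\<close>; being Hausdorff and second countable is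
  expressed by the sort of \<open>'a\<close>. An atlas need not be maximal.
\<close>

definition smooth_atlas ::
  "('a::{t2_space,second_countable_topology} set \<times> ('a \<Rightarrow> 'b::euclidean_space)) set \<Rightarrow> bool" where
  "smooth_atlas A \<longleftrightarrow>
     (\<Union>(U, \<phi>)\<in>A. U) = UNIV \<and>
     (\<forall>(U, \<phi>)\<in>A. open U \<and> open (\<phi> ` U) \<and> homeomorphism U (\<phi> ` U) \<phi> (inv_into U \<phi>)) \<and>
     (\<forall>(U, \<phi>)\<in>A. \<forall>(V, \<psi>)\<in>A. smooth_on (\<phi> ` (U \<inter> V)) (\<psi> \<circ> inv_into U \<phi>))"

definition smooth_funs :: "('a set \<times> ('a \<Rightarrow> 'b::euclidean_space)) set \<Rightarrow> ('a \<Rightarrow> real) set" where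
  "smooth_funs A = {f. \<forall>(U, \<phi>)\<in>A. smooth_on (\<phi> ` U) (f \<circ> inv_into U \<phi>)}"

type_synonym 'a vfield = "('a \<Rightarrow> real) \<Rightarrow> 'a \<Rightarrow> real"

text \<open>
  Smooth vector fields are the derivations of the algebra of smooth functions.
  They are extensional (\<open>undefined\<close> on non-smooth arguments), so that equality of
  vector fields is equality in HOL.
\<close>

definition vector_fields :: "('a set \<times> ('a \<Rightarrow> 'b::euclidean_space)) set \<Rightarrow> 'a vfield set" where
  "vector_fields A = {X \<in> smooth_funs A \<rightarrow>\<^sub>E smooth_funs A.
     (\<forall>c. \<forall>f\<in>smooth_funs A. \<forall>g\<in>smooth_funs A.
        X (\<lambda>p. c * f p + g p) = (\<lambda>p. c * X f p + X g p)) \<and>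
     (\<forall>f\<in>smooth_funs A. \<forall>g\<in>smooth_funs A.
        X (\<lambda>p. f p * g p) = (\<lambda>p. f p * X g p + g p * X f p))}"

definition lie_bracket ::
  "('a set \<times> ('a \<Rightarrow> 'b::euclidean_space)) set \<Rightarrow> 'a vfield \<Rightarrow> 'a vfield \<Rightarrow> 'a vfield" where
  "lie_bracket A X Y = (\<lambda>f\<in>smooth_funs A. \<lambda>p. X (Y f) p - Y (X f) p)"

text \<open>The condition \<open>X z p \<noteq> 0\<close> for some \<open>X\<close> says that \<open>dz\<close> does not vanish at \<open>p\<close>.\<close>

definition defining_function ::
  "('a set \<times> ('a \<Rightarrow> 'b::euclidean_space)) set \<Rightarrow> ('a \<Rightarrow> real) \<Rightarrow> bool" where
  "defining_function A z \<longleftrightarrow> z \<in> smooth_funs A \<and>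
     (\<forall>p. z p = 0 \<longrightarrow> (\<exists>X\<in>vector_fields A. X z p \<noteq> 0))"

definition critical_set :: "('a \<Rightarrow> real) \<Rightarrow> 'a set" where
  "critical_set z = {p. z p = 0}"

definition bm_vector_fields ::
  "('a set \<times> ('a \<Rightarrow> 'b::euclidean_space)) set \<Rightarrow> ('a \<Rightarrow> real) \<Rightarrow> nat \<Rightarrow> 'a vfield set" where
  "bm_vector_fields A z m =
     {X \<in> vector_fields A. \<exists>g\<in>smooth_funs A. X z = (\<lambda>p. z p ^ m * g p)}"

type_synonym 'a bm_form1 = "'a vfield \<Rightarrow> 'a \<Rightarrow> real"
type_synonym 'a bm_form2 = "'a vfield \<Rightarrow> 'a vfield \<Rightarrow> 'a \<Rightarrow> real"
type_synonym 'a bm_form3 = "'a vfield \<Rightarrow> 'a vfield \<Rightarrow> 'a vfield \<Rightarrow> 'a \<Rightarrow> real"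

text \<open>
  The sections of the \<open>b\<^sup>m\<close>-tangent bundle are the \<open>b\<^sup>m\<close>-vector fields. A section of the
  \<open>k\<close>-th exterior power of its dual is identified with the alternating map, multilinear
  over the smooth functions, that it induces on \<open>k\<close>-tuples of \<open>b\<^sup>m\<close>-vector fields.
\<close>

definition bm_one_forms ::
  "('a set \<times> ('a \<Rightarrow> 'b::euclidean_space)) set \<Rightarrow> ('a \<Rightarrow> real) \<Rightarrow> nat \<Rightarrow> 'a bm_form1 set" where
  "bm_one_forms A z m = {\<alpha> \<in> bm_vector_fields A z m \<rightarrow>\<^sub>E smooth_funs A.
     \<forall>f\<in>smooth_funs A. \<forall>X\<in>bm_vector_fields A z m. \<forall>Y\<in>bm_vector_fields A z m.
       \<alpha> (\<lambda>h\<in>smooth_funs A. \<lambda>p. f p * X h p + Y h p) = (\<lambda>p. f p * \<alpha> X p + \<alpha> Y p)}"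

text \<open>
  The invariant formula for the exterior derivative. The \<open>b\<^sup>m\<close>-vector fields are closed
  under the Lie bracket, so it makes sense for them. Off the critical set it is the usual
  exterior derivative, and the values on the critical set are the continuous extension.
\<close>

definition ext_deriv ::
  "('a set \<times> ('a \<Rightarrow> 'b::euclidean_space)) set \<Rightarrow> 'a bm_form1 \<Rightarrow> 'a bm_form2" where
  "ext_deriv A \<alpha> X Y = (\<lambda>p. X (\<alpha> Y) p - Y (\<alpha> X) p - \<alpha> (lie_bracket A X Y) p)"

definition wedge12 :: "'a bm_form1 \<Rightarrow> 'a bm_form2 \<Rightarrow> 'a bm_form3" where
  "wedge12 \<alpha> \<omega> X Y W = (\<lambda>p. \<alpha> X p * \<omega> Y W p + \<alpha> Y p * \<omega> W X p + \<alpha> W p * \<omega> X Y p)"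

text \<open>
  A section of the third exterior power is nonzero at \<open>p\<close> iff its value at \<open>p\<close> on some
  triple of \<open>b\<^sup>m\<close>-vector fields is nonzero.
\<close>

definition bm_contact_form ::
  "('a set \<times> ('a \<Rightarrow> real^3)) set \<Rightarrow> ('a \<Rightarrow> real) \<Rightarrow> nat \<Rightarrow> 'a bm_form1 \<Rightarrow> bool" where
  "bm_contact_form A z m \<alpha> \<longleftrightarrow> \<alpha> \<in> bm_one_forms A z m \<and>
     (\<forall>p. \<exists>X\<in>bm_vector_fields A z m. \<exists>Y\<in>bm_vector_fields A z m. \<exists>W\<in>bm_vector_fields A z m.
        wedge12 \<alpha> (ext_deriv A \<alpha>) X Y W p \<noteq> 0)"

definition reeb_field ::
  "('a set \<times> ('a \<Rightarrow> 'b::euclidean_space)) set \<Rightarrow> ('a \<Rightarrow> real) \<Rightarrow> nat \<Rightarrow> 'a bm_form1 \<Rightarrow> 'a vfield" where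
  "reeb_field A z m \<alpha> = (THE R. R \<in> bm_vector_fields A z m \<and>
     (\<forall>Y\<in>bm_vector_fields A z m. ext_deriv A \<alpha> R Y = (\<lambda>p. 0)) \<and>
     \<alpha> R = (\<lambda>p. 1))"

definition integral_curve ::
  "('a set \<times> ('a \<Rightarrow> 'b::euclidean_space)) set \<Rightarrow> 'a vfield \<Rightarrow> (real \<Rightarrow> 'a) \<Rightarrow> bool" where
  "integral_curve A X \<gamma> \<longleftrightarrow>
     (\<forall>f\<in>smooth_funs A. \<forall>t. ((\<lambda>s. f (\<gamma> s)) has_real_derivative X f (\<gamma> t)) (at t))"

text \<open>
  Orbits are point sets, so reparametrised or multiply covered orbits count once.
\<close>

definition periodic_orbits ::
  "('a set \<times> ('a \<Rightarrow> 'b::euclidean_space)) set \<Rightarrow> 'a vfield \<Rightarrow> 'a set set" where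
  "periodic_orbits A X = {range \<gamma> | \<gamma>. integral_curve A X \<gamma> \<and>
     (\<exists>T>0. \<forall>t. \<gamma> (t + T) = \<gamma> t) \<and> (\<exists>s t. \<gamma> s \<noteq> \<gamma> t)}"

end

theory Submission
  imports Defs
begin

text \<open>
  Near the critical surface \<open>Z\<close> write $\alpha = u\,dz/z^m + \beta$. Along \<open>Z\<close> the contact
  condition says that $u\,d\beta + \beta \wedge du$, restricted to \<open>Z\<close>, is an area form, and
  the two Reeb equations give $i_R (u\,d\beta + \beta \wedge du) = du$. So the restriction
  of \<open>R\<close> to \<open>Z\<close> is the Hamiltonian field of the function \<open>u\<close> (\<open>Reeb_on_Z\<close>): \<open>u\<close> is constant
  along the orbits on \<open>Z\<close>, and \<open>R\<close> vanishes exactly at the critical points of \<open>u\<close> restricted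
  to \<open>Z\<close> (the set \<open>Crit\<close>).

  Some point of \<open>Z\<close> is not critical (\<open>noncritical_point_exists\<close>). Otherwise $du = 0$ along
  \<open>Z\<close>, the area form is $u\,d\beta$, and therefore the exact form $d\beta$ has no zero on
  the closed surface \<open>Z\<close>. This contradicts Stokes' theorem, which is proved here in the form
  needed: in a single patch (\<open>local_stokes\<close>), with a partition of unity and the change of
  variables between patches (\<open>J_transfer\<close>).

  Near such a point \<open>u\<close> takes all values of an interval on \<open>Z\<close>. By Sard's theorem on the
  surface (\<open>sard\<close>) almost all of them are regular values. A regular level of \<open>u\<close> on \<open>Z\<close> is
  compact and contains no zero of \<open>R\<close>; near each of its points it is a single flow segment
  of unit speed (\<open>regular_flow_box\<close>). A flow line in it must return to one of finitely many
  such segments, hence closes up (\<open>periodic_curve\<close>, \<open>regular_level_orbit\<close>). Orbits on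
  different levels are different, so there are infinitely many (\<open>infinitely_many_orbits\<close>).

  Vector fields are derivations of the algebra of smooth functions. Smooth cut-off functions
  make derivations local, and Hadamard's lemma gives them components in coordinates. Neither
  tangent vectors nor the bundle of $b^m$-tangent vectors appear; evaluation at a point is a
  tensorial functional on the $b^m$-fields (\<open>tens\<close>). The Reeb field is defined point by
  point with Cramer's rule (\<open>reeb_value\<close>). The rule gives the same value for every triple of
  fields that may be used in it, so smoothness is a local matter and nothing has to be
  glued.
\<close>

section \<open>Smooth functions on Euclidean space\<close>

subsection \<open>Rules of differentiation\<close>

lemma C_k_on_subset: "C_k_on k S f \<Longrightarrow> T \<subseteq> S \<Longrightarrow> C_k_on k T f"
proof (induction k arbitrary: f)
  case 0 then show ?case by (auto intro: continuous_on_subset)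
next
  case (Suc k) then show ?case by (simp add: subset_eq)
qed

lemma C_k_on_cong:
  assumes "open S" "\<And>x. x \<in> S \<Longrightarrow> f x = g x" "C_k_on k S f"
  shows "C_k_on k S g"
  using assms(2,3)
proof (induction k arbitrary: f g)
  case 0 then show ?case using continuous_on_cong by force
next
  case (Suc k)
  have d: "(g has_derivative frechet_derivative f (at x)) (at x)" if "x \<in> S" for x
    using has_derivative_transform_within_open[OF _ assms(1) that] Suc.prems that
      frechet_derivative_works by (metis C_k_on.simps(2))
  then have e: "frechet_derivative f (at x) = frechet_derivative g (at x)" if "x \<in> S" for x
    using frechet_derivative_at that by blast
  have "C_k_on k S (\<lambda>x. frechet_derivative g (at x) v)" for v
    by (rule Suc.IH[of "\<lambda>x. frechet_derivative f (at x) v"]) (use e Suc.prems in auto)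
  then show ?case using d by (auto simp: differentiable_def)
qed

lemma C_k_on_SucI:
  assumes "open S" "\<And>x. x \<in> S \<Longrightarrow> (f has_derivative D x) (at x)"
    "\<And>v. C_k_on k S (\<lambda>x. D x v)"
  shows "C_k_on (Suc k) S f"
proof -
  have "C_k_on k S (\<lambda>x. frechet_derivative f (at x) v)" for v
    by (rule C_k_on_cong[OF assms(1) _ assms(3)[of v]])
       (use assms(2) frechet_derivative_at in metis)
  then show ?thesis using assms(2) by (auto simp: differentiable_def)
qed

lemma C_k_on_SucD:
  assumes "C_k_on (Suc k) S f" "x \<in> S"
  shows "(f has_derivative frechet_derivative f (at x)) (at x)"
  using assms frechet_derivative_works by auto

lemma C_k_on_pred: "C_k_on (Suc k) S f \<Longrightarrow> C_k_on k S f"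
proof (induction k arbitrary: f)
  case 0 then show ?case
    by (auto intro!: continuous_at_imp_continuous_on differentiable_imp_continuous_within)
next
  case (Suc k) then show ?case by (metis C_k_on.simps(2))
qed

lemma C_k_on_local:
  assumes "\<And>x. x \<in> S \<Longrightarrow> \<exists>T. open T \<and> x \<in> T \<and> C_k_on k T f"
  shows "C_k_on k S f"
  using assms
proof (induction k arbitrary: f)
  case 0
  then show ?case
    by (auto intro!: continuous_at_imp_continuous_on)
       (metis continuous_on_eq_continuous_at)
next
  case (Suc k)
  have "C_k_on k S (\<lambda>x. frechet_derivative f (at x) v)" for v
    by (rule Suc.IH) (use Suc.prems in fastforce)
  then show ?case using Suc.prems by fastforce
qed

lemma C_k_on_const: "open S \<Longrightarrow> C_k_on k S (\<lambda>x. c)"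
proof (induction k arbitrary: c)
  case (Suc k) show ?case
    by (rule C_k_on_SucI[OF Suc.prems, where D="\<lambda>x v. 0"]) (use Suc in auto)
qed simp

lemma C_k_on_add:
  fixes f g :: "_ \<Rightarrow> real"
  assumes "open S" shows "C_k_on k S f \<Longrightarrow> C_k_on k S g \<Longrightarrow> C_k_on k S (\<lambda>x. f x + g x)"
proof (induction k arbitrary: f g)
  case 0 then show ?case by (auto intro: continuous_intros)
next
  case (Suc k) show ?case
    by (rule C_k_on_SucI[OF assms has_derivative_add[OF C_k_on_SucD[OF Suc.prems(1)] C_k_on_SucD[OF Suc.prems(2)]]])
      (use Suc in auto)
qed

lemma C_k_on_mult:
  fixes f g :: "_ \<Rightarrow> real"
  assumes "open S" shows "C_k_on k S f \<Longrightarrow> C_k_on k S g \<Longrightarrow> C_k_on k S (\<lambda>x. f x * g x)"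
proof (induction k arbitrary: f g)
  case 0 then show ?case by (auto intro: continuous_intros)
next
  case (Suc k) show ?case
  proof (rule C_k_on_SucI[OF assms has_derivative_mult[OF C_k_on_SucD[OF Suc.prems(1)] C_k_on_SucD[OF Suc.prems(2)]]])
    fix v
    have "C_k_on k S f" "C_k_on k S g" using Suc.prems C_k_on_pred by blast+
    moreover have "C_k_on k S (\<lambda>x. frechet_derivative f (at x) v)" "C_k_on k S (\<lambda>x. frechet_derivative g (at x) v)"
      using Suc.prems by simp_all
    ultimately show "C_k_on k S (\<lambda>x. f x * frechet_derivative g (at x) v + frechet_derivative f (at x) v * g x)"
      by (intro C_k_on_add[OF assms] Suc.IH)
  qed
qed

lemma C_k_on_linear:
  assumes "open S" "bounded_linear L" shows "C_k_on k S f \<Longrightarrow> C_k_on k S (\<lambda>x. L (f x))"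
proof (induction k arbitrary: f)
  case 0 then show ?case using assms by (auto intro: bounded_linear.continuous_on)
next
  case (Suc k) show ?case
    by (rule C_k_on_SucI[OF assms(1) bounded_linear.has_derivative[OF assms(2) C_k_on_SucD[OF Suc.prems]]])
      (use Suc in auto)
qed

lemma C_k_on_sum:
  fixes f :: "_ \<Rightarrow> _ \<Rightarrow> real"
  assumes "open S" "finite I" "\<And>i. i \<in> I \<Longrightarrow> C_k_on k S (f i)"
  shows "C_k_on k S (\<lambda>x. \<Sum>i\<in>I. f i x)"
  using assms(2,3) by (induction I) (auto intro: C_k_on_add C_k_on_const assms(1))

lemma C_k_on_ident: "open S \<Longrightarrow> C_k_on k S (\<lambda>x. x)"
  by (cases k) (auto intro!: C_k_on_SucI[where D="\<lambda>x v. v"] C_k_on_const simp: continuous_on_id)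

text \<open>
  The chain rule is expanded along a basis, $D(f \circ g)(v) = \sum_i (D_i f \circ
  g)\,(Dg(v))_i$. This turns the derivative into sums and products of real functions of
  lower order, to which the induction hypothesis applies; it is needed for all \<open>f\<close> because
  it is used for $D_i f$.
\<close>

lemma C_k_on_compose:
  fixes f :: "'b::euclidean_space \<Rightarrow> real"
  assumes "open S" "open T" "g ` S \<subseteq> T"
  shows "C_k_on k T f \<Longrightarrow> C_k_on k S g \<Longrightarrow> C_k_on k S (\<lambda>x. f (g x))"
proof (induction k arbitrary: f)
  case 0 then show ?case using continuous_on_compose2 assms(3) by fastforce
next
  case (Suc k)
  let ?D = "\<lambda>i y. frechet_derivative f (at y) i" and ?E = "\<lambda>v x. frechet_derivative g (at x) v"
  have lin: "linear (frechet_derivative f (at y))" if "y \<in> T" for y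
    using C_k_on_SucD[OF Suc.prems(1) that] has_derivative_linear by blast
  have gT: "g x \<in> T" if "x \<in> S" for x using assms(3) that by auto
  show ?case
  proof (rule C_k_on_SucI[OF assms(1), where D="\<lambda>x v. \<Sum>i\<in>Basis. ?D i (g x) * (?E v x \<bullet> i)"])
    fix x assume x: "x \<in> S"
    have "((\<lambda>x. f (g x)) has_derivative (\<lambda>v. frechet_derivative f (at (g x)) (?E v x))) (at x)"
      using has_derivative_compose[OF C_k_on_SucD[OF Suc.prems(2) x] C_k_on_SucD[OF Suc.prems(1) gT[OF x]]] .
    moreover have "frechet_derivative f (at (g x)) (?E v x) = (\<Sum>i\<in>Basis. ?D i (g x) * (?E v x \<bullet> i))" for v
      by (subst euclidean_representation[symmetric, of "?E v x"])
         (simp only: linear_sum[OF lin[OF gT[OF x]]] linear_scale[OF lin[OF gT[OF x]]], simp add: mult.commute)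
    ultimately show "((\<lambda>x. f (g x)) has_derivative (\<lambda>v. \<Sum>i\<in>Basis. ?D i (g x) * (?E v x \<bullet> i))) (at x)"
      by simp
  next
    fix v
    show "C_k_on k S (\<lambda>x. \<Sum>i\<in>Basis. ?D i (g x) * (?E v x \<bullet> i))"
      using Suc C_k_on_pred
      by (intro C_k_on_sum C_k_on_mult assms Suc.IH C_k_on_linear[OF _ bounded_linear_inner_left]) auto
  qed
qed

lemma C_k_on_inverse: "C_k_on k (-{0}) (inverse :: real \<Rightarrow> real)"
proof (induction k)
  case 0 then show ?case by (auto intro!: continuous_intros)
next
  case (Suc k)
  have o: "open (-{0::real})" by auto
  show ?case
  proof (rule C_k_on_SucI[OF o, where D="\<lambda>x v. (- v) * (inverse x * inverse x)"])
    show "(inverse has_derivative (\<lambda>v. (- v) * (inverse x * inverse x))) (at x)" if "x \<in> - {0}" for x :: real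
      using that by (auto intro!: derivative_eq_intros simp: fun_eq_iff)
    show "C_k_on k (- {0}) (\<lambda>x. (- v) * (inverse x * inverse x))" for v :: real
      by (rule C_k_on_mult[OF o C_k_on_const[OF o] C_k_on_mult[OF o Suc Suc]])
  qed
qed

lemma smooth_on_SucD:
  assumes "smooth_on S f"
  shows "x \<in> S \<Longrightarrow> (f has_derivative frechet_derivative f (at x)) (at x)"
    and "smooth_on S (\<lambda>x. frechet_derivative f (at x) v)"
proof -
  have k: "C_k_on (Suc k) S f" for k using assms unfolding smooth_on_def by blast
  show "x \<in> S \<Longrightarrow> (f has_derivative frechet_derivative f (at x)) (at x)"
    by (rule C_k_on_SucD[OF k])
  show "smooth_on S (\<lambda>x. frechet_derivative f (at x) v)"
    using k unfolding smooth_on_def by auto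
qed

lemma smooth_on_continuous: "smooth_on S f \<Longrightarrow> continuous_on S f"
  unfolding smooth_on_def using C_k_on.simps(1) by blast

lemma smooth_on_subset: "smooth_on S f \<Longrightarrow> T \<subseteq> S \<Longrightarrow> smooth_on T f"
  unfolding smooth_on_def using C_k_on_subset by blast

lemma smooth_on_cong:
  "open S \<Longrightarrow> smooth_on S f \<Longrightarrow> (\<And>x. x \<in> S \<Longrightarrow> f x = g x) \<Longrightarrow> smooth_on S g"
  unfolding smooth_on_def by (intro allI, rule C_k_on_cong[of _ f]) auto

lemma smooth_on_local:
  "(\<And>x. x \<in> S \<Longrightarrow> \<exists>T. open T \<and> x \<in> T \<and> smooth_on T f) \<Longrightarrow> smooth_on S f"
  unfolding smooth_on_def by (intro allI, rule C_k_on_local) blast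

lemma smooth_on_const: "open S \<Longrightarrow> smooth_on S (\<lambda>x. c)"
  unfolding smooth_on_def by (auto intro: C_k_on_const)

lemma smooth_on_add:
  fixes f g :: "_ \<Rightarrow> real"
  shows "open S \<Longrightarrow> smooth_on S f \<Longrightarrow> smooth_on S g \<Longrightarrow> smooth_on S (\<lambda>x. f x + g x)"
  unfolding smooth_on_def by (auto intro: C_k_on_add)

lemma smooth_on_mult:
  fixes f g :: "_ \<Rightarrow> real"
  shows "open S \<Longrightarrow> smooth_on S f \<Longrightarrow> smooth_on S g \<Longrightarrow> smooth_on S (\<lambda>x. f x * g x)"
  unfolding smooth_on_def by (auto intro: C_k_on_mult)

lemma smooth_on_linear:
  "open S \<Longrightarrow> bounded_linear L \<Longrightarrow> smooth_on S f \<Longrightarrow> smooth_on S (\<lambda>x. L (f x))"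
  unfolding smooth_on_def by (auto intro: C_k_on_linear)

lemma smooth_on_ident: "open S \<Longrightarrow> smooth_on S (\<lambda>x. x)"
  unfolding smooth_on_def by (auto intro: C_k_on_ident)

lemma smooth_on_compose:
  fixes f :: "'b::euclidean_space \<Rightarrow> real"
  shows "open S \<Longrightarrow> open T \<Longrightarrow> g ` S \<subseteq> T \<Longrightarrow> smooth_on T f \<Longrightarrow> smooth_on S g \<Longrightarrow> smooth_on S (\<lambda>x. f (g x))"
  unfolding smooth_on_def using C_k_on_compose by blast

lemma smooth_on_inverse:
  fixes f :: "_ \<Rightarrow> real"
  assumes "open S" "smooth_on S f" "\<And>x. x \<in> S \<Longrightarrow> f x \<noteq> 0"
  shows "smooth_on S (\<lambda>x. inverse (f x))"
proof (rule smooth_on_compose[of S "-{0}" f inverse])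
  show "smooth_on (-{0}) (inverse :: real \<Rightarrow> real)"
    unfolding smooth_on_def by (rule allI) (rule C_k_on_inverse)
qed (use assms in auto)

subsection \<open>Smooth cut-off functions\<close>

text \<open>
  The classical flat function $e^{-1/x}$ and its products with powers of $1/x$. The powers
  make the family closed under differentiation up to linear combinations, so that smoothness
  of all its members follows by one induction.
\<close>

definition flat :: "nat \<Rightarrow> real \<Rightarrow> real" where
  "flat n x = (if x \<le> 0 then 0 else exp (- inverse x) * inverse x ^ n)"

lemma flat_deriv:
  "(flat n has_real_derivative flat (n+2) x - real n * flat (n+1) x) (at x)"
proof (cases x "0::real" rule: linorder_cases)
  case less
  have "((\<lambda>x. 0) has_real_derivative flat (n+2) x - real n * flat (n+1) x) (at x)"
    using less by (simp add: flat_def)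
  then show ?thesis
    by (rule has_field_derivative_transform_within_open[where S="{..<0}"])
       (use less in \<open>auto simp: flat_def\<close>)
next
  case greater
  have "((\<lambda>x. exp (- inverse x) * inverse x ^ n) has_real_derivative
      flat (n+2) x - real n * flat (n+1) x) (at x)"
    using greater
    by (cases "n = 0")
       (auto intro!: derivative_eq_intros simp: flat_def field_simps power2_eq_square power_eq_if[of x n])
  then show ?thesis
    by (rule has_field_derivative_transform_within_open[where S="{0<..}"])
       (use greater in \<open>auto simp: flat_def\<close>)
next
  case equal
  have lim: "((\<lambda>y::real. exp (-y) * y ^ k) \<longlongrightarrow> 0) at_top" for k
    using tendsto_power_div_exp_0[of k] by (simp add: exp_minus field_simps)
  have "((\<lambda>h::real. exp (- inverse h) * inverse h ^ (n+1)) \<longlongrightarrow> 0) (at_right 0)"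
    using filterlim_compose[OF lim filterlim_inverse_at_top_right, of "n+1"] by simp
  then have "((\<lambda>h. flat n h / h) \<longlongrightarrow> 0) (at_right 0)"
    by (rule Lim_transform_eventually)
       (auto simp: eventually_at_right_field flat_def field_simps intro: exI[of _ 1])
  moreover have "((\<lambda>h. flat n h / h) \<longlongrightarrow> 0) (at_left 0)"
    by (rule Lim_transform_eventually[OF tendsto_const])
       (auto simp: eventually_at_left_field flat_def intro: exI[of _ "-1"])
  ultimately have "(\<lambda>h. flat n h / h) \<midarrow>0\<rightarrow> 0"
    by (simp add: filterlim_split_at)
  then show ?thesis using equal
    by (simp add: DERIV_def flat_def)
qed

lemma smooth_on_flat: "smooth_on UNIV (flat n)"
proof -
  have "C_k_on k UNIV (flat n)" for k
  proof (induction k arbitrary: n)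
    case 0 then show ?case
      using flat_deriv DERIV_isCont by (force intro: continuous_at_imp_continuous_on)
  next
    case (Suc k)
    show ?case
    proof (rule C_k_on_SucI[OF open_UNIV, where D="\<lambda>x v. flat (n+2) x * v + (- real n * v) * flat (n+1) x"])
      show "(flat n has_derivative (\<lambda>v. flat (n+2) x * v + (- real n * v) * flat (n+1) x)) (at x)" for x
        by (rule has_derivative_eq_rhs[OF flat_deriv[of n x, unfolded has_field_derivative_def]])
           (simp add: fun_eq_iff algebra_simps)
      show "C_k_on k UNIV (\<lambda>x. flat (n+2) x * v + (- real n * v) * flat (n+1) x)" for v
        by (intro C_k_on_add C_k_on_mult C_k_on_const Suc open_UNIV)
    qed
  qed
  then show ?thesis by (simp add: smooth_on_def)
qed

text \<open>
  The quotient $b / (b + c)$ of flat functions of the squared distance, where \<open>b\<close> is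
  positive exactly inside the ball of radius \<open>2r\<close> and \<open>c\<close> exactly outside the closed ball of
  radius \<open>r\<close>; they have no common zero.
\<close>

lemma smooth_bump:
  fixes a :: "'b::euclidean_space"
  assumes "r > 0"
  obtains \<rho> :: "'b \<Rightarrow> real" where "smooth_on UNIV \<rho>" "\<And>x. 0 \<le> \<rho> x"
    "\<And>x. x \<in> ball a r \<Longrightarrow> \<rho> x = 1" "\<And>x. x \<notin> cball a (2*r) \<Longrightarrow> \<rho> x = 0"
proof -
  define q where "q = (\<lambda>x. \<Sum>i\<in>Basis. ((x-a)\<bullet>i) * ((x-a)\<bullet>i))"
  have q: "q x = (dist a x)\<^sup>2" for x
    unfolding q_def dist_norm norm_minus_commute[of a x] power2_norm_eq_inner
    by (rule euclidean_inner[symmetric])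
  have diff: "smooth_on UNIV (\<lambda>x. (x-a)\<bullet>i)" for i
    using smooth_on_add[OF open_UNIV smooth_on_linear[OF open_UNIV bounded_linear_inner_left smooth_on_ident[OF open_UNIV]]
        smooth_on_const[OF open_UNIV, of "- (a\<bullet>i)"]] by (simp add: inner_diff_left)
  have sq: "smooth_on UNIV q"
    unfolding q_def smooth_on_def using diff unfolding smooth_on_def
    by (intro allI C_k_on_sum[OF open_UNIV finite_Basis] C_k_on_mult[OF open_UNIV]) blast+
  define b c where "b = (\<lambda>x. flat 0 (4*r\<^sup>2 + (-1) * q x))" and "c = (\<lambda>x. flat 0 (q x + -r\<^sup>2))"
  have sb: "smooth_on UNIV b" "smooth_on UNIV c" unfolding b_def c_def
    by (rule smooth_on_compose[OF open_UNIV open_UNIV _ smooth_on_flat],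
        simp, intro smooth_on_add smooth_on_mult smooth_on_const sq open_UNIV)+
  have bc: "b x \<ge> 0" "c x \<ge> 0" for x by (auto simp: b_def c_def flat_def)
  have pos: "b x + c x \<noteq> 0" for x
  proof (cases "q x < 4*r\<^sup>2")
    case True
    then have "b x > 0" by (auto simp: b_def flat_def)
    then show ?thesis using bc[of x] by linarith
  next
    case False
    then have "q x > r\<^sup>2" using assms by (smt (verit) zero_less_power)
    then have "c x > 0" by (auto simp: c_def flat_def)
    then show ?thesis using bc[of x] by linarith
  qed
  show ?thesis
  proof
    show "smooth_on UNIV (\<lambda>x. b x * inverse (b x + c x))"
      by (intro smooth_on_mult smooth_on_inverse smooth_on_add sb pos open_UNIV)
    show "0 \<le> b x * inverse (b x + c x)" for x using bc[of x] by simp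
    show "b x * inverse (b x + c x) = 1" if "x \<in> ball a r" for x
    proof -
      have "q x \<le> r\<^sup>2" unfolding q using that by (simp add: power_mono)
      then have "c x = 0" by (simp add: c_def flat_def)
      then show ?thesis using pos[of x] by simp
    qed
    show "b x * inverse (b x + c x) = 0" if "x \<notin> cball a (2*r)" for x
    proof -
      have "(2*r)\<^sup>2 \<le> q x" unfolding q by (rule power_mono) (use that assms in auto)
      then have "b x = 0" by (simp add: b_def flat_def power_mult_distrib)
      then show ?thesis by simp
    qed
  qed
qed

subsection \<open>Hadamard's lemma\<close>

text \<open>
  The Leibniz rule and the inverse function theorem ask for a derivative that is continuous
  as a map into the bounded linear maps; in finite dimension it suffices to test on each
  vector.
\<close>

lemma blinfun_derivative_continuous:
  fixes F :: "'b::euclidean_space \<Rightarrow> 'c::real_normed_vector"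
  assumes "smooth_on S F"
  shows "continuous_on S (\<lambda>x. Blinfun (frechet_derivative F (at x)))"
    and "x \<in> S \<Longrightarrow> blinfun_apply (Blinfun (frechet_derivative F (at x))) = frechet_derivative F (at x)"
proof -
  have e: "blinfun_apply (Blinfun (frechet_derivative F (at x))) = frechet_derivative F (at x)"
    if "x \<in> S" for x
    by (rule bounded_linear_Blinfun_apply) (use smooth_on_SucD(1)[OF assms that] has_derivative_bounded_linear in blast)
  show "x \<in> S \<Longrightarrow> blinfun_apply (Blinfun (frechet_derivative F (at x))) = frechet_derivative F (at x)"
    by (rule e)
  show "continuous_on S (\<lambda>x. Blinfun (frechet_derivative F (at x)))"
  proof (rule continuous_on_blinfun_componentwise)
    fix i :: 'b
    show "continuous_on S (\<lambda>x. blinfun_apply (Blinfun (frechet_derivative F (at x))) i)"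
      using smooth_on_continuous[OF smooth_on_SucD(2)[OF assms, of i]] e
      by (simp cong: continuous_on_cong)
  qed
qed

text \<open>
  Differentiation under the integral sign reproduces an integral of the same kind, with one
  more factor \<open>t\<close> and a derivative of \<open>F\<close>. The weight \<open>t ^ n\<close> is there so that the induction
  closes.
\<close>

lemma smooth_on_ray_integral:
  fixes F :: "'b::euclidean_space \<Rightarrow> real"
  assumes "smooth_on (ball a r) F"
  shows "smooth_on (ball a r) (\<lambda>x. integral {0..1} (\<lambda>t. t ^ n * F (a + t *\<^sub>R (x - a))))"
proof -
  let ?B = "ball a r"
  have in_ball: "a + t *\<^sub>R (x - a) \<in> ?B" if "x \<in> ?B" "t \<in> {0..1}" for x t
  proof -
    have "\<bar>t\<bar> * norm (x - a) \<le> 1 * norm (x - a)" by (rule mult_right_mono) (use that in auto)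
    then show ?thesis using that by (auto simp: dist_norm norm_minus_commute)
  qed
  have der: "((\<lambda>x. integral {0..1} (\<lambda>t. t ^ n * F (a + t *\<^sub>R (x - a)))) has_derivative
      (\<lambda>v. integral {0..1} (\<lambda>t. t ^ (n+1) * frechet_derivative F (at (a + t *\<^sub>R (x - a))) v))) (at x)"
    if F: "smooth_on ?B F" and x: "x \<in> ?B" for F :: "'b \<Rightarrow> real" and x n
  proof -
    let ?D = "\<lambda>x. Blinfun (frechet_derivative F (at x))"
    have c1: "continuous_on (?B \<times> {0..1}) (\<lambda>(x,t). a + t *\<^sub>R (x - a))"
      by (auto intro!: continuous_intros simp: split_beta)
    have sub: "(\<lambda>(x,t). a + t *\<^sub>R (x - a)) ` (?B \<times> {0..1}) \<subseteq> ?B"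
      using in_ball by (auto simp del: mem_ball)
    have c2: "continuous_on (?B \<times> {0..1}) (\<lambda>(x,t). ?D (a + t *\<^sub>R (x - a)))"
      using continuous_on_compose2[OF blinfun_derivative_continuous(1)[OF F] c1 sub]
      by (simp add: split_beta)
    have c3: "continuous_on (?B \<times> {0..1}) (\<lambda>(x,t). (t^(n+1)) *\<^sub>R ?D (a + t *\<^sub>R (x - a)))"
      using c2 unfolding split_beta by (intro continuous_intros)
    have c4: "continuous_on (?B \<times> {0..1}) (\<lambda>(x,t). t^n * F (a + t *\<^sub>R (x - a)))"
      using continuous_on_compose2[OF smooth_on_continuous[OF F] c1 sub]
      unfolding split_beta by (intro continuous_intros)
    have "((\<lambda>x. integral (cbox 0 1) (\<lambda>t. t ^ n * F (a + t *\<^sub>R (x - a)))) has_derivative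
       blinfun_apply (integral (cbox 0 1) (\<lambda>t. (t^(n+1)) *\<^sub>R ?D (a + t *\<^sub>R (x - a))))) (at x within ?B)"
    proof (rule leibniz_rule)
      fix y and t :: real assume y: "y \<in> ?B" "t \<in> cbox 0 1"
      let ?y = "a + t *\<^sub>R (y - a)"
      have yB: "?y \<in> ?B" using in_ball y by auto
      have "((\<lambda>x. F (a + t *\<^sub>R (x - a))) has_derivative (\<lambda>v. frechet_derivative F (at ?y) (t *\<^sub>R v))) (at y)"
        by (rule has_derivative_compose[of "\<lambda>x. a + t *\<^sub>R (x - a)" _ _ _ F, OF _ smooth_on_SucD(1)[OF F yB]])
           (auto intro!: derivative_eq_intros)
      moreover have "frechet_derivative F (at ?y) (t *\<^sub>R v) = t * frechet_derivative F (at ?y) v" for v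
        using linear_scale[OF has_derivative_linear[OF smooth_on_SucD(1)[OF F yB]]] by simp
      ultimately have "((\<lambda>x. F (a + t *\<^sub>R (x - a))) has_derivative (\<lambda>v. t * frechet_derivative F (at ?y) v)) (at y)"
        by simp
      from has_derivative_mult_right[OF this, of "t^n"]
      have "((\<lambda>x. t^n * F (a + t *\<^sub>R (x - a))) has_derivative (\<lambda>v. t^(n+1) * frechet_derivative F (at ?y) v)) (at y)"
        by (simp add: mult_ac)
      then show "((\<lambda>x. t^n * F (a + t *\<^sub>R (x - a))) has_derivative blinfun_apply ((t^(n+1)) *\<^sub>R ?D ?y)) (at y within ?B)"
        using blinfun_derivative_continuous(2)[OF F yB]
        by (auto simp: scaleR_blinfun.rep_eq intro: has_derivative_at_withinI elim!: has_derivative_eq_rhs)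
    next
      fix y assume y: "y \<in> ?B"
      have "continuous_on {0..1} (\<lambda>t. t ^ n * F (a + t *\<^sub>R (y - a)))"
        using continuous_on_compose2[OF c4, of "{0..1}" "\<lambda>t. (y,t)"] y
        by (simp add: continuous_on_Pair image_subset_iff)
      then show "(\<lambda>t. t ^ n * F (a + t *\<^sub>R (y - a))) integrable_on cbox 0 1"
        using integrable_continuous_real by auto
    qed (use c3 x in auto)
    moreover have "blinfun_apply (integral (cbox 0 1) (\<lambda>t. (t^(n+1)) *\<^sub>R ?D (a + t *\<^sub>R (x - a)))) v
       = integral {0..1} (\<lambda>t. t ^ (n+1) * frechet_derivative F (at (a + t *\<^sub>R (x - a))) v)" for v
    proof -
      have "continuous_on {0..1} (\<lambda>t. (t^(n+1)) *\<^sub>R ?D (a + t *\<^sub>R (x - a)))"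
        using continuous_on_compose2[OF c3, of "{0..1}" "\<lambda>t. (x,t)"] x
        by (simp add: continuous_on_Pair image_subset_iff)
      then have "(\<lambda>t. (t^(n+1)) *\<^sub>R ?D (a + t *\<^sub>R (x - a))) integrable_on {0..1}"
        using integrable_continuous_real by blast
      then have "blinfun_apply (integral {0..1} (\<lambda>t. (t^(n+1)) *\<^sub>R ?D (a + t *\<^sub>R (x - a)))) v =
          integral {0..1} (\<lambda>t. blinfun_apply ((t^(n+1)) *\<^sub>R ?D (a + t *\<^sub>R (x - a))) v)"
        using blinfun_apply_integral by fastforce
      also have "\<dots> = integral {0..1} (\<lambda>t. t ^ (n+1) * frechet_derivative F (at (a + t *\<^sub>R (x - a))) v)"
        by (rule integral_cong) (use blinfun_derivative_continuous(2)[OF F] in_ball[OF x] in \<open>simp add: scaleR_blinfun.rep_eq\<close>)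
      finally show ?thesis by simp
    qed
    ultimately show ?thesis using at_within_open[OF x open_ball]
      by (auto elim!: has_derivative_eq_rhs simp del: power_Suc)
  qed
  have "C_k_on k ?B (\<lambda>x. integral {0..1} (\<lambda>t. t ^ n * F (a + t *\<^sub>R (x - a))))"
    if "smooth_on ?B F" for k n and F :: "'b \<Rightarrow> real"
    using that
  proof (induction k arbitrary: F n)
    case 0
    have "continuous (at x) (\<lambda>x. integral {0..1} (\<lambda>t. t ^ n * F (a + t *\<^sub>R (x - a))))" if "x \<in> ?B" for x
      using has_derivative_continuous[OF der[OF 0 that]] .
    then show ?case by (simp add: continuous_at_imp_continuous_on)
  next
    case (Suc k)
    show ?case
      by (rule C_k_on_SucI[OF open_ball der[OF Suc.prems]]) (assumption, rule Suc.IH[OF smooth_on_SucD(2)[OF Suc.prems]])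
  qed
  then show ?thesis using assms by (simp add: smooth_on_def)
qed

text \<open>$F(x) - F(a)$ is the integral of the derivative of \<open>F\<close> along the ray from \<open>a\<close> to \<open>x\<close>.\<close>

lemma hadamard:
  fixes F :: "'b::euclidean_space \<Rightarrow> real"
  assumes F: "smooth_on (ball a r) F"
  obtains G where "\<forall>i. smooth_on (ball a r) (G i)"
    "\<forall>x\<in>ball a r. F x = F a + (\<Sum>i\<in>Basis. ((x - a) \<bullet> i) * G i x)"
proof (rule that, safe del: equalityI)
  let ?D = "\<lambda>i x. frechet_derivative F (at x) i"
  let ?G = "\<lambda>i x. integral {0..1} (\<lambda>t. t^0 * ?D i (a + t *\<^sub>R (x - a)))"
  show "smooth_on (ball a r) (?G i)" for i
    by (rule smooth_on_ray_integral[OF smooth_on_SucD(2)[OF F]])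
  fix x assume x: "x \<in> ball a r"
  have inb: "a + t *\<^sub>R (x - a) \<in> ball a r" if "t \<in> {0..1}" for t
  proof -
    have "\<bar>t\<bar> * norm (x - a) \<le> 1 * norm (x - a)" by (rule mult_right_mono) (use that in auto)
    then show ?thesis using that x by (auto simp: dist_norm norm_minus_commute)
  qed
  have "((\<lambda>t. F (a + t *\<^sub>R (x - a))) has_vector_derivative ?D (x - a) (a + t *\<^sub>R (x - a))) (at t within {0..1})"
    if t: "t \<in> {0..1}" for t
  proof -
    let ?y = "a + t *\<^sub>R (x - a)"
    have "((\<lambda>t. F (a + t *\<^sub>R (x - a))) has_derivative (\<lambda>s. ?D (s *\<^sub>R (x - a)) ?y)) (at t within {0..1})"
      by (rule has_derivative_compose[of "\<lambda>t. a + t *\<^sub>R (x - a)" _ _ _ F, OF _ smooth_on_SucD(1)[OF F inb[OF t]]])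
         (auto intro!: derivative_eq_intros)
    moreover have "?D (s *\<^sub>R (x - a)) ?y = s *\<^sub>R ?D (x - a) ?y" for s
      using linear_scale[OF has_derivative_linear[OF smooth_on_SucD(1)[OF F inb[OF t]]]] by simp
    ultimately show ?thesis by (simp add: has_vector_derivative_def)
  qed
  from fundamental_theorem_of_calculus[OF _ this]
  have "((\<lambda>t. ?D (x - a) (a + t *\<^sub>R (x - a))) has_integral F x - F a) {0..1}" by simp
  then have "F x - F a = integral {0..1} (\<lambda>t. ?D (x - a) (a + t *\<^sub>R (x - a)))"
    by (simp add: integral_unique)
  also have "\<dots> = integral {0..1} (\<lambda>t. \<Sum>i\<in>Basis. ((x - a) \<bullet> i) * (t^0 * ?D i (a + t *\<^sub>R (x - a))))"
  proof (rule integral_cong)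
    fix t :: real assume t: "t \<in> {0..1}"
    note l = has_derivative_linear[OF smooth_on_SucD(1)[OF F inb[OF t]]]
    show "?D (x - a) (a + t *\<^sub>R (x - a)) = (\<Sum>i\<in>Basis. ((x - a) \<bullet> i) * (t^0 * ?D i (a + t *\<^sub>R (x - a))))"
      by (subst (1) euclidean_representation[symmetric, of "x - a"])
         (simp only: linear_sum[OF l] linear_scale[OF l], simp)
  qed
  also have "\<dots> = (\<Sum>i\<in>Basis. integral {0..1} (\<lambda>t. ((x - a) \<bullet> i) * (t^0 * ?D i (a + t *\<^sub>R (x - a)))))"
  proof (rule integral_sum)
    fix i :: 'b assume "i \<in> Basis"
    have "continuous_on {0..1} (\<lambda>t. ?D i (a + t *\<^sub>R (x - a)))"
      by (rule continuous_on_compose2[OF smooth_on_continuous[OF smooth_on_SucD(2)[OF F]]])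
         (use inb in \<open>auto intro!: continuous_intros\<close>)
    then show "(\<lambda>t. ((x - a) \<bullet> i) * (t^0 * ?D i (a + t *\<^sub>R (x - a)))) integrable_on {0..1}"
      by (intro integrable_continuous_real continuous_intros)
  qed simp
  finally show "F x = F a + (\<Sum>i\<in>Basis. ((x - a) \<bullet> i) * ?G i x)" by simp
qed

lemma inverse_function_ex:
  fixes f :: "'b::euclidean_space \<Rightarrow> 'b" and f' :: "'b \<Rightarrow> ('b \<Rightarrow>\<^sub>L 'b)"
  assumes "open U" "\<forall>x\<in>U. (f has_derivative (blinfun_apply (f' x))) (at x)"
    "continuous_on U f'" "x0 \<in> U" "invf o\<^sub>L f' x0 = id_blinfun"
  shows "\<exists>U' V g g'. open U' \<and> U' \<subseteq> U \<and> x0 \<in> U' \<and> open V \<and> f x0 \<in> V \<and> homeomorphism U' V f g \<and>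
    (\<forall>y\<in>V. (g has_derivative g' y) (at y) \<and> g' y = inv (blinfun_apply (f' (g y))) \<and> bij (blinfun_apply (f' (g y))))"
  by (rule inverse_function_theorem[OF assms(1) bspec[OF assms(2)] assms(3-5)]) blast+

lemma sum_Basis_axis:
  fixes h :: "real^'n \<Rightarrow> 'c::comm_monoid_add"
  shows "(\<Sum>b\<in>Basis. h b) = (\<Sum>i\<in>UNIV. h (axis i 1))"
proof -
  have e: "(Basis :: (real^'n) set) = range (\<lambda>i. axis i 1)" by (auto simp: Basis_vec_def)
  have "inj (\<lambda>i::'n. axis i (1::real))" by (auto simp: inj_def axis_eq_axis)
  then show ?thesis unfolding e by (simp add: sum.reindex)
qed

section \<open>Functions and vector fields on a three-dimensional manifold\<close>

locale manifold3 =
  fixes A :: "('a::{t2_space,second_countable_topology} set \<times> ('a \<Rightarrow> real^3)) set"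
  assumes atlas: "smooth_atlas A"
begin

abbreviation "SF \<equiv> smooth_funs A"
abbreviation "VF \<equiv> vector_fields A"

lemma chart_exists: obtains U \<phi> where "(U, \<phi>) \<in> A" "p \<in> U"
proof -
  have "p \<in> (\<Union>(U, \<phi>)\<in>A. U)" using atlas unfolding smooth_atlas_def by simp
  then show ?thesis using that by auto
qed

lemma chart:
  assumes "(U, \<phi>) \<in> A"
  shows "open U" "open (\<phi> ` U)" "continuous_on U \<phi>" "continuous_on (\<phi> ` U) (inv_into U \<phi>)"
    "\<And>p. p \<in> U \<Longrightarrow> inv_into U \<phi> (\<phi> p) = p"
    "\<And>x. x \<in> \<phi> ` U \<Longrightarrow> inv_into U \<phi> x \<in> U"
    "\<And>x. x \<in> \<phi> ` U \<Longrightarrow> \<phi> (inv_into U \<phi> x) = x"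
proof -
  have h: "open U" "open (\<phi> ` U)" "homeomorphism U (\<phi> ` U) \<phi> (inv_into U \<phi>)"
  proof -
    have "\<forall>(U, \<phi>)\<in>A. open U \<and> open (\<phi> ` U) \<and> homeomorphism U (\<phi> ` U) \<phi> (inv_into U \<phi>)"
      using atlas unfolding smooth_atlas_def by (elim conjE)
    from bspec[OF this assms] show "open U" "open (\<phi> ` U)" "homeomorphism U (\<phi> ` U) \<phi> (inv_into U \<phi>)"
      by simp_all
  qed
  show "open U" "open (\<phi> ` U)" "continuous_on U \<phi>" "continuous_on (\<phi> ` U) (inv_into U \<phi>)"
    "\<And>p. p \<in> U \<Longrightarrow> inv_into U \<phi> (\<phi> p) = p"
    using h unfolding homeomorphism_def by simp_all
  show "\<And>x. x \<in> \<phi> ` U \<Longrightarrow> inv_into U \<phi> x \<in> U" by (rule inv_into_into)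
  show "\<And>x. x \<in> \<phi> ` U \<Longrightarrow> \<phi> (inv_into U \<phi> x) = x" by (rule f_inv_into_f)
qed

lemma chart_open_image:
  assumes "(U, \<phi>) \<in> A" "open W"
  shows "open (\<phi> ` (U \<inter> W))"
proof -
  have "\<phi> ` (U \<inter> W) = \<phi> ` U \<inter> inv_into U \<phi> -` W"
    using chart[OF assms(1)] by (auto simp: image_iff)
  then show ?thesis
    using continuous_open_preimage[OF chart(4)[OF assms(1)] chart(2)[OF assms(1)] assms(2)] by simp
qed

lemma chart_open_vimage:
  assumes "(U, \<phi>) \<in> A" "open T"
  shows "open (U \<inter> \<phi> -` T)"
  using continuous_open_preimage[OF chart(3)[OF assms(1)] chart(1)[OF assms(1)] assms(2)] .

lemma SF_chart: "f \<in> SF \<Longrightarrow> (U, \<phi>) \<in> A \<Longrightarrow> smooth_on (\<phi> ` U) (\<lambda>x. f (inv_into U \<phi> x))"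
  by (auto simp: smooth_funs_def comp_def)

lemma SF_I: "(\<And>U \<phi>. (U, \<phi>) \<in> A \<Longrightarrow> smooth_on (\<phi> ` U) (\<lambda>x. f (inv_into U \<phi> x))) \<Longrightarrow> f \<in> SF"
  by (auto simp: smooth_funs_def comp_def)

text \<open>
  Smoothness is a local property; this is how global smooth functions are assembled from
  local ones below.
\<close>

lemma SF_local:
  assumes "\<And>p. \<exists>W. open W \<and> p \<in> W \<and> (\<exists>g\<in>SF. \<forall>q\<in>W. f q = g q)"
  shows "f \<in> SF"
proof (rule SF_I, rule smooth_on_local)
  fix U \<phi> x assume c: "(U, \<phi>) \<in> A" and x: "x \<in> \<phi> ` U"
  obtain W g where W: "open W" "inv_into U \<phi> x \<in> W" "g \<in> SF" "\<And>q. q \<in> W \<Longrightarrow> f q = g q"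
    using assms by metis
  have "smooth_on (\<phi> ` (U \<inter> W)) (\<lambda>x. f (inv_into U \<phi> x))"
    by (rule smooth_on_cong[OF chart_open_image[OF c W(1)] smooth_on_subset[OF SF_chart[OF W(3) c]]])
       (use chart[OF c] W(4) in auto)
  moreover have "x \<in> \<phi> ` (U \<inter> W)" using x W(2) chart[OF c] by (auto simp: image_iff)
  ultimately show "\<exists>T. open T \<and> x \<in> T \<and> smooth_on T (\<lambda>x. f (inv_into U \<phi> x))"
    using chart_open_image[OF c W(1)] by blast
qed

lemma SF_const: "(\<lambda>p. c) \<in> SF"
  by (rule SF_I, rule smooth_on_const, erule chart(2))

lemma SF_add: "f \<in> SF \<Longrightarrow> g \<in> SF \<Longrightarrow> (\<lambda>p. f p + g p) \<in> SF"
  by (rule SF_I, rule smooth_on_add, erule chart(2)) (erule (1) SF_chart)+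

lemma SF_mult: "f \<in> SF \<Longrightarrow> g \<in> SF \<Longrightarrow> (\<lambda>p. f p * g p) \<in> SF"
  by (rule SF_I, rule smooth_on_mult, erule chart(2)) (erule (1) SF_chart)+

lemma SF_inverse: "f \<in> SF \<Longrightarrow> (\<And>p. f p \<noteq> 0) \<Longrightarrow> (\<lambda>p. inverse (f p)) \<in> SF"
  by (rule SF_I, rule smooth_on_inverse, erule chart(2), erule (1) SF_chart, simp)

lemma SF_uminus: "f \<in> SF \<Longrightarrow> (\<lambda>p. - f p) \<in> SF"
  using SF_mult[OF SF_const[of "-1"], of f] by simp

lemma SF_diff: "f \<in> SF \<Longrightarrow> g \<in> SF \<Longrightarrow> (\<lambda>p. f p - g p) \<in> SF"
  using SF_add[OF _ SF_uminus, of f g] by simp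

lemma SF_power: "f \<in> SF \<Longrightarrow> (\<lambda>p. f p ^ n) \<in> SF"
  by (induction n) (simp_all add: SF_const SF_mult)

lemma SF_sum: "finite I \<Longrightarrow> (\<And>i. i \<in> I \<Longrightarrow> f i \<in> SF) \<Longrightarrow> (\<lambda>p. \<Sum>i\<in>I. f i p) \<in> SF"
  by (induction I rule: finite_induct) (simp_all add: SF_const SF_add)

lemmas SF_intros = SF_const SF_add SF_mult SF_uminus SF_diff SF_power

lemma SF_continuous:
  assumes "f \<in> SF" shows "continuous_on UNIV f"
proof (rule continuous_at_imp_continuous_on, rule ballI)
  fix p
  obtain U \<phi> where c: "(U, \<phi>) \<in> A" "p \<in> U" using chart_exists .
  have "continuous_on U (\<lambda>q. f (inv_into U \<phi> (\<phi> q)))"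
    by (rule continuous_on_compose2[OF smooth_on_continuous[OF SF_chart[OF assms c(1)]] chart(3)[OF c(1)]]) auto
  then have "continuous_on U f" using chart(5)[OF c(1)] by (simp cong: continuous_on_cong)
  then show "isCont f p" using c chart(1)[OF c(1)] continuous_on_eq_continuous_at by blast
qed

lemma SF_open_nonzero: "f \<in> SF \<Longrightarrow> open {p. f p \<noteq> 0}"
  by (rule open_Collect_neq[OF SF_continuous continuous_on_const])

lemma SF_open_pos: "f \<in> SF \<Longrightarrow> open {p. f p > 0}"
  by (rule open_Collect_less[OF continuous_on_const SF_continuous])

subsection \<open>Functions supported in a chart\<close>

text \<open>
  Near a point of the support the function is \<open>G\<close> composed with a transition map. The other
  points have a neighbourhood on which it is zero, because the image of the support is
  compact and hence closed: this is where the Hausdorff property enters.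
\<close>

lemma SF_chart_function:
  assumes c: "(U, \<phi>) \<in> A" and T: "open T" "T \<subseteq> \<phi> ` U" and G: "smooth_on T G"
    and K: "compact K" "K \<subseteq> T" "\<And>x. x \<in> T - K \<Longrightarrow> G x = 0"
  shows "(\<lambda>q. if q \<in> U \<and> \<phi> q \<in> T then G (\<phi> q) else 0) \<in> SF" (is "?f \<in> SF")
proof (rule SF_I, rule smooth_on_local)
  fix V \<psi> x assume d: "(V, \<psi>) \<in> A" and x: "x \<in> \<psi> ` V"
  let ?K = "inv_into U \<phi> ` K" and ?q = "inv_into V \<psi> x" and ?W = "U \<inter> \<phi> -` T"
  have "compact ?K"
    by (rule compact_continuous_image[OF continuous_on_subset[OF chart(4)[OF c]] K(1)]) (use K T in auto)
  then have oK: "open (- ?K)" using compact_imp_closed by blast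
  have W: "open ?W" by (rule chart_open_vimage[OF c T(1)])
  have fK: "?f q = 0" if "q \<notin> ?K" for q
    using that K(3) chart(5)[OF c] by (auto simp: image_iff) (metis DiffI)
  show "\<exists>S. open S \<and> x \<in> S \<and> smooth_on S (\<lambda>x. ?f (inv_into V \<psi> x))"
  proof (cases "?q \<in> ?K")
    case False
    have S: "open (\<psi> ` (V \<inter> - ?K))" by (rule chart_open_image[OF d oK])
    have "smooth_on (\<psi> ` (V \<inter> - ?K)) (\<lambda>x. ?f (inv_into V \<psi> x))"
    proof (rule smooth_on_cong[OF S smooth_on_const[OF S, of 0]])
      fix y assume "y \<in> \<psi> ` (V \<inter> - ?K)"
      then have "inv_into V \<psi> y \<notin> ?K" using chart(5)[OF d] by auto
      then show "0 = ?f (inv_into V \<psi> y)" using fK by metis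
    qed
    moreover have "x \<in> \<psi> ` (V \<inter> - ?K)" using x False chart[OF d] by (auto simp: image_iff)
    ultimately show ?thesis using S by blast
  next
    case True
    let ?S = "\<psi> ` (V \<inter> ?W)"
    have S: "open ?S" by (rule chart_open_image[OF d W])
    have qW: "?q \<in> ?W" using True K(2) T(2) chart[OF c] by auto (metis subsetD)+
    have "smooth_on (\<psi> ` (V \<inter> U)) (\<lambda>x. \<phi> (inv_into V \<psi> x))"
      using atlas c d unfolding smooth_atlas_def comp_def by blast
    then have tr: "smooth_on ?S (\<lambda>x. \<phi> (inv_into V \<psi> x))" by (rule smooth_on_subset) auto
    have "smooth_on ?S (\<lambda>x. G (\<phi> (inv_into V \<psi> x)))"
      by (rule smooth_on_compose[OF S T(1) _ G tr]) (use chart(5)[OF d] in auto)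
    then have "smooth_on ?S (\<lambda>x. ?f (inv_into V \<psi> x))"
      by (rule smooth_on_cong[OF S]) (use chart(5)[OF d] in auto)
    moreover have "x \<in> ?S" using x qW chart[OF d] by (auto simp: image_iff)
    ultimately show ?thesis using S by blast
  qed
qed

lemma chart_ball:
  assumes "(U, \<phi>) \<in> A" "open T" "p \<in> U" "\<phi> p \<in> T"
  obtains r where "r > 0" "cball (\<phi> p) (2*r) \<subseteq> T \<inter> \<phi> ` U"
proof -
  have "open (T \<inter> \<phi> ` U)" "\<phi> p \<in> T \<inter> \<phi> ` U" using assms chart(2) by auto
  then obtain e where "e > 0" "cball (\<phi> p) e \<subseteq> T \<inter> \<phi> ` U" using open_contains_cball by blast
  then show ?thesis using that[of "e/2"] by simp
qed

lemma SF_bump: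
  assumes "open W" "p \<in> W"
  obtains \<rho> W' K where "\<rho> \<in> SF" "\<And>q. 0 \<le> \<rho> q" "open W'" "p \<in> W'" "\<And>q. q \<in> W' \<Longrightarrow> \<rho> q = 1"
    "compact K" "K \<subseteq> W" "\<And>q. q \<notin> K \<Longrightarrow> \<rho> q = 0"
proof -
  obtain U \<phi> where c: "(U, \<phi>) \<in> A" "p \<in> U" using chart_exists .
  let ?a = "\<phi> p" and ?T = "\<phi> ` (U \<inter> W)"
  obtain r where r: "r > 0" "cball ?a (2*r) \<subseteq> ?T \<inter> \<phi> ` U"
    using chart_ball[OF c(1) chart_open_image[OF c(1) assms(1)] c(2)] c(2) assms(2) by auto
  obtain \<rho> :: "real^3 \<Rightarrow> real" where \<rho>: "smooth_on UNIV \<rho>" "\<And>x. 0 \<le> \<rho> x"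
    "\<And>x. x \<in> ball ?a r \<Longrightarrow> \<rho> x = 1" "\<And>x. x \<notin> cball ?a (2*r) \<Longrightarrow> \<rho> x = 0"
    using smooth_bump[OF r(1)] by metis
  let ?f = "\<lambda>q. if q \<in> U \<and> \<phi> q \<in> ?T then \<rho> (\<phi> q) else 0"
  let ?K = "inv_into U \<phi> ` cball ?a (2*r)"
  show ?thesis
  proof
    show "?f \<in> SF"
      by (rule SF_chart_function[OF c(1) chart_open_image[OF c(1) assms(1)] _ smooth_on_subset[OF \<rho>(1)] compact_cball])
         (use r \<rho>(4) in auto)
    show "0 \<le> ?f q" for q using \<rho>(2) by auto
    show "open (U \<inter> \<phi> -` ball ?a r)" by (rule chart_open_vimage[OF c(1) open_ball])
    show "p \<in> U \<inter> \<phi> -` ball ?a r" using c r by auto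
    show "?f q = 1" if "q \<in> U \<inter> \<phi> -` ball ?a r" for q
    proof -
      have "\<phi> q \<in> cball ?a (2*r)" using that r(1) by auto
      then show ?thesis using that r(2) \<rho>(3) by auto
    qed
    show "compact ?K"
      by (rule compact_continuous_image[OF continuous_on_subset[OF chart(4)[OF c(1)]] compact_cball]) (use r in auto)
    show "?K \<subseteq> W"
    proof
      fix q assume "q \<in> ?K"
      then obtain x where x: "x \<in> cball ?a (2*r)" "q = inv_into U \<phi> x" by auto
      then obtain q' where "q' \<in> U \<inter> W" "x = \<phi> q'" using r(2) by auto
      then show "q \<in> W" using x chart(5)[OF c(1)] by auto
    qed
    show "?f q = 0" if "q \<notin> ?K" for q
      using that \<rho>(4)[of "\<phi> q"] chart(5)[OF c(1), of q] by (auto simp: image_iff)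
  qed
qed

lemma SF_extend:
  assumes c: "(U, \<phi>) \<in> A" "p \<in> U" and T: "open T" "\<phi> p \<in> T" and F: "smooth_on T F"
  obtains f W where "f \<in> SF" "open W" "p \<in> W" "W \<subseteq> U" "\<And>q. q \<in> W \<Longrightarrow> \<phi> q \<in> T \<and> f q = F (\<phi> q)"
proof -
  let ?a = "\<phi> p"
  obtain r where r: "r > 0" "cball ?a (2*r) \<subseteq> T \<inter> \<phi> ` U"
    using chart_ball[OF c(1) T(1) c(2) T(2)] .
  obtain \<rho> :: "real^3 \<Rightarrow> real" where \<rho>: "smooth_on UNIV \<rho>" "\<And>x. 0 \<le> \<rho> x"
    "\<And>x. x \<in> ball ?a r \<Longrightarrow> \<rho> x = 1" "\<And>x. x \<notin> cball ?a (2*r) \<Longrightarrow> \<rho> x = 0"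
    using smooth_bump[OF r(1)] by metis
  let ?S = "T \<inter> \<phi> ` U"
  have S: "open ?S" using T(1) chart(2)[OF c(1)] by auto
  let ?f = "\<lambda>q. if q \<in> U \<and> \<phi> q \<in> ?S then \<rho> (\<phi> q) * F (\<phi> q) else 0"
  show ?thesis
  proof
    show "?f \<in> SF"
      by (rule SF_chart_function[OF c(1) S _ smooth_on_mult[OF S smooth_on_subset[OF \<rho>(1)] smooth_on_subset[OF F]] compact_cball])
         (use r \<rho>(4) in auto)
    show "open (U \<inter> \<phi> -` ball ?a r)" by (rule chart_open_vimage[OF c(1) open_ball])
    show "p \<in> U \<inter> \<phi> -` ball ?a r" using c r by auto
    show "\<phi> q \<in> T \<and> ?f q = F (\<phi> q)" if "q \<in> U \<inter> \<phi> -` ball ?a r" for q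
    proof -
      have "\<phi> q \<in> cball ?a (2*r)" using that r(1) by auto
      then show ?thesis using that r(2) \<rho>(3) by auto
    qed
  qed auto
qed

subsection \<open>Derivations are local\<close>

lemma VF_SF: "X \<in> VF \<Longrightarrow> f \<in> SF \<Longrightarrow> X f \<in> SF"
  by (auto simp: vector_fields_def)

lemma VF_lin: "X \<in> VF \<Longrightarrow> f \<in> SF \<Longrightarrow> g \<in> SF \<Longrightarrow> X (\<lambda>p. c * f p + g p) = (\<lambda>p. c * X f p + X g p)"
  by (auto simp: vector_fields_def)

lemma VF_mult: "X \<in> VF \<Longrightarrow> f \<in> SF \<Longrightarrow> g \<in> SF \<Longrightarrow> X (\<lambda>p. f p * g p) = (\<lambda>p. f p * X g p + g p * X f p)"
  by (auto simp: vector_fields_def)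

lemma VF_eqI:
  assumes "X \<in> VF" "Y \<in> VF" "\<And>f p. f \<in> SF \<Longrightarrow> X f p = Y f p"
  shows "X = Y"
proof
  fix f show "X f = Y f"
  proof (cases "f \<in> SF")
    case False
    then show ?thesis using assms(1,2) by (auto simp: vector_fields_def PiE_def extensional_def)
  qed (use assms(3) in auto)
qed

lemma VF_I:
  assumes "\<And>f. f \<in> SF \<Longrightarrow> F f \<in> SF"
    "\<And>c f g p. f \<in> SF \<Longrightarrow> g \<in> SF \<Longrightarrow> F (\<lambda>p. c * f p + g p) p = c * F f p + F g p"
    "\<And>f g p. f \<in> SF \<Longrightarrow> g \<in> SF \<Longrightarrow> F (\<lambda>p. f p * g p) p = f p * F g p + g p * F f p"
  shows "(\<lambda>f\<in>SF. F f) \<in> VF"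
  using assms by (auto simp: vector_fields_def SF_intros fun_eq_iff)

lemma VF_zero: "X \<in> VF \<Longrightarrow> X (\<lambda>p. 0) = (\<lambda>p. 0)"
  using VF_lin[OF _ SF_const SF_const, of X 1 0 0] by (auto simp: fun_eq_iff)

lemma VF_const: "X \<in> VF \<Longrightarrow> X (\<lambda>p. c) = (\<lambda>p. 0)"
proof -
  assume X: "X \<in> VF"
  have "X (\<lambda>p. 1) = (\<lambda>p. 0)"
    using VF_mult[OF X SF_const SF_const, of 1 1] by (auto simp: fun_eq_iff)
  then show ?thesis using VF_lin[OF X SF_const SF_const, of c 1 0] VF_zero[OF X] by simp
qed

lemma VF_cmult: "X \<in> VF \<Longrightarrow> f \<in> SF \<Longrightarrow> X (\<lambda>p. c * f p) = (\<lambda>p. c * X f p)"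
  using VF_lin[OF _ _ SF_const, of X f c 0] VF_zero by simp

lemma VF_add: "X \<in> VF \<Longrightarrow> f \<in> SF \<Longrightarrow> g \<in> SF \<Longrightarrow> X (\<lambda>p. f p + g p) = (\<lambda>p. X f p + X g p)"
  using VF_lin[of X f g 1] by simp

lemma VF_uminus: "X \<in> VF \<Longrightarrow> f \<in> SF \<Longrightarrow> X (\<lambda>p. - f p) = (\<lambda>p. - X f p)"
  using VF_cmult[of X f "-1"] by simp

lemma VF_diff: "X \<in> VF \<Longrightarrow> f \<in> SF \<Longrightarrow> g \<in> SF \<Longrightarrow> X (\<lambda>p. f p - g p) = (\<lambda>p. X f p - X g p)"
  using VF_lin[of X g f "-1"] by simp

lemma VF_sum:
  assumes "X \<in> VF" "finite I" "\<And>i. i \<in> I \<Longrightarrow> f i \<in> SF"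
  shows "X (\<lambda>p. \<Sum>i\<in>I. f i p) = (\<lambda>p. \<Sum>i\<in>I. X (f i) p)"
  using assms(2,3)
proof (induction I rule: finite_induct)
  case empty then show ?case using VF_zero[OF assms(1)] by simp
next
  case (insert i I)
  have "X (\<lambda>p. f i p + (\<Sum>i\<in>I. f i p)) = (\<lambda>p. X (f i) p + X (\<lambda>p. \<Sum>i\<in>I. f i p) p)"
    by (rule VF_add[OF assms(1)]) (use insert in \<open>auto intro: SF_sum\<close>)
  then show ?case using insert by simp
qed

lemma VF_mult_add:
  assumes "X \<in> VF" "f \<in> SF" "g \<in> SF" "h \<in> SF" "k \<in> SF"
  shows "X (\<lambda>p. f p * g p + h p * k p) =
    (\<lambda>p. f p * X g p + g p * X f p + (h p * X k p + k p * X h p))"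
  using VF_add[OF assms(1) SF_mult[OF assms(2,3)] SF_mult[OF assms(4,5)]]
    VF_mult[OF assms(1-3)] VF_mult[OF assms(1,4,5)] by simp

lemma VF_power:
  assumes "X \<in> VF" "f \<in> SF"
  shows "X (\<lambda>p. f p ^ n) p = real n * f p ^ (n - 1) * X f p"
proof (induction n)
  case 0 then show ?case using VF_const[OF assms(1)] by simp
next
  case (Suc n)
  have "X (\<lambda>p. f p ^ Suc n) p = f p * X (\<lambda>p. f p ^ n) p + f p ^ n * X f p"
    using VF_mult[OF assms(1,2) SF_power[OF assms(2)]] by simp
  then show ?case using Suc by (cases n) (auto simp: algebra_simps)
qed

text \<open>
  If \<open>\<rho>\<close> is a bump function at \<open>p\<close> supported in \<open>W\<close>, then \<open>\<rho> (f - g)\<close> is zero, and the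
  product rule evaluated at \<open>p\<close> leaves only \<open>X (f - g) p\<close>.
\<close>

lemma VF_local:
  assumes "X \<in> VF" "f \<in> SF" "g \<in> SF" "open W" "p \<in> W" "\<And>q. q \<in> W \<Longrightarrow> f q = g q"
  shows "X f p = X g p"
proof -
  obtain \<rho> W' K where \<rho>: "\<rho> \<in> SF" "open W'" "p \<in> W'" "\<And>q. q \<in> W' \<Longrightarrow> \<rho> q = 1"
    "K \<subseteq> W" "\<And>q. q \<notin> K \<Longrightarrow> \<rho> q = 0"
    using SF_bump[OF assms(4,5)] by metis
  let ?h = "\<lambda>q. f q - g q"
  have h: "?h \<in> SF" using assms SF_diff by blast
  have "(\<lambda>q. \<rho> q * ?h q) = (\<lambda>q. 0)"
  proof
    fix q show "\<rho> q * ?h q = 0" using \<rho>(5,6) assms(6) by (cases "q \<in> K") auto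
  qed
  then have "\<rho> p * X ?h p + ?h p * X \<rho> p = 0"
    using VF_mult[OF assms(1) \<rho>(1) h] VF_zero[OF assms(1)] by (metis (mono_tags))
  then have "X ?h p = 0" using \<rho>(3,4) assms(5,6) by simp
  then show ?thesis using VF_diff[OF assms(1-3)] by simp
qed

text \<open>
  The combination \<open>f X + Y\<close>, made extensional so that it is a vector field in the sense of
  \<open>vector_fields\<close>. It is the same expression as in the definition of one-forms.
\<close>

definition comb :: "('a \<Rightarrow> real) \<Rightarrow> 'a vfield \<Rightarrow> 'a vfield \<Rightarrow> 'a vfield" where
  "comb f X Y = (\<lambda>h\<in>SF. \<lambda>p. f p * X h p + Y h p)"

lemma VF_lincomb:
  assumes "finite I" "\<And>i. i \<in> I \<Longrightarrow> c i \<in> SF" "\<And>i. i \<in> I \<Longrightarrow> X i \<in> VF"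
  shows "(\<lambda>h\<in>SF. \<lambda>p. \<Sum>i\<in>I. c i p * X i h p) \<in> VF"
proof (rule VF_I)
  show "(\<lambda>p. \<Sum>i\<in>I. c i p * X i f p) \<in> SF" if "f \<in> SF" for f
    by (rule SF_sum[OF assms(1)]) (use assms that in \<open>auto intro: SF_mult VF_SF\<close>)
next
  fix k f g p assume fg: "f \<in> SF" "g \<in> SF"
  show "(\<Sum>i\<in>I. c i p * X i (\<lambda>p. k * f p + g p) p) = k * (\<Sum>i\<in>I. c i p * X i f p) + (\<Sum>i\<in>I. c i p * X i g p)"
    unfolding sum_distrib_left sum.distrib[symmetric]
    by (rule sum.cong) (simp_all add: VF_lin[OF assms(3) fg] distrib_left mult.left_commute)
  show "(\<Sum>i\<in>I. c i p * X i (\<lambda>p. f p * g p) p) = f p * (\<Sum>i\<in>I. c i p * X i g p) + g p * (\<Sum>i\<in>I. c i p * X i f p)"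
    unfolding sum_distrib_left sum.distrib[symmetric]
    by (rule sum.cong) (simp_all add: VF_mult[OF assms(3) fg] distrib_left mult.left_commute)
qed

definition zerof :: "'a vfield" where "zerof = (\<lambda>h\<in>SF. \<lambda>p. 0)"

lemma zerof: "zerof \<in> VF" "h \<in> SF \<Longrightarrow> zerof h = (\<lambda>p. 0)"
  unfolding zerof_def by (auto intro: VF_I simp: SF_const)

lemma comb:
  assumes "f \<in> SF" "X \<in> VF" "Y \<in> VF"
  shows "comb f X Y \<in> VF" "h \<in> SF \<Longrightarrow> comb f X Y h p = f p * X h p + Y h p"
  unfolding comb_def
   apply (rule VF_I)
  using assms by (auto simp: SF_add SF_mult VF_SF VF_lin VF_mult) (simp_all add: algebra_simps)

lemma lie_bracket:
  assumes "X \<in> VF" "Y \<in> VF"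
  shows "lie_bracket A X Y \<in> VF" "h \<in> SF \<Longrightarrow> lie_bracket A X Y h p = X (Y h) p - Y (X h) p"
proof -
  show "lie_bracket A X Y \<in> VF" unfolding lie_bracket_def
    by (rule VF_I)
       (use assms in \<open>auto simp: SF_diff VF_SF VF_lin VF_mult VF_mult_add\<close>, simp_all add: algebra_simps)
  show "h \<in> SF \<Longrightarrow> lie_bracket A X Y h p = X (Y h) p - Y (X h) p"
    by (simp add: lie_bracket_def)
qed

subsection \<open>Coordinate fields\<close>

text \<open>
  By Hadamard's lemma $f - f(q)$ is, near \<open>q\<close>, a combination of the $x_i - x_i(q)$ with
  smooth coefficients. A derivation at \<open>q\<close> sees only the values of these coefficients at
  \<open>q\<close>.
\<close>

lemma SF_hadamard:
  assumes c: "(U, \<phi>) \<in> A" and f: "f \<in> SF" and q: "q \<in> U"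
    and x: "\<And>i. x i \<in> SF" "open W" "q \<in> W" "\<And>i q. q \<in> W \<Longrightarrow> x i q = \<phi> q $ i"
  obtains g where "\<And>X. X \<in> VF \<Longrightarrow> X f q = (\<Sum>i\<in>UNIV. g i * X (x i) q)"
proof -
  let ?b = "\<phi> q" and ?F = "\<lambda>x. f (inv_into U \<phi> x)"
  obtain r where r: "r > 0" "cball ?b (2*r) \<subseteq> UNIV \<inter> \<phi> ` U"
    using chart_ball[OF c open_UNIV q] by auto
  have rU: "ball ?b r \<subseteq> \<phi> ` U" using r by (auto simp: subset_iff)
  obtain G where "\<forall>i. smooth_on (ball ?b r) (G i)"
    "\<forall>x\<in>ball ?b r. ?F x = ?F ?b + (\<Sum>i\<in>Basis. ((x - ?b) \<bullet> i) * G i x)"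
    using hadamard[OF smooth_on_subset[OF SF_chart[OF f c] rU]] .
  note G = this[rule_format]
  have "\<forall>i. \<exists>g W. g \<in> SF \<and> open W \<and> q \<in> W \<and> W \<subseteq> U \<and> (\<forall>q\<in>W. \<phi> q \<in> ball ?b r \<and> g q = G (axis i 1) (\<phi> q))"
  proof
    fix i :: 3
    have "?b \<in> ball ?b r" using r by simp
    then obtain g W where "g \<in> SF" "open W" "q \<in> W" "W \<subseteq> U"
      "\<And>q. q \<in> W \<Longrightarrow> \<phi> q \<in> ball ?b r \<and> g q = G (axis i 1) (\<phi> q)"
      using SF_extend[OF c q open_ball _ G(1)[of "axis i 1"]] by metis
    then show "\<exists>g W. g \<in> SF \<and> open W \<and> q \<in> W \<and> W \<subseteq> U \<and> (\<forall>q\<in>W. \<phi> q \<in> ball ?b r \<and> g q = G (axis i 1) (\<phi> q))"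
      by blast
  qed
  then obtain g W' where g: "\<And>i. g i \<in> SF" "\<And>i. open (W' i)" "\<And>i. q \<in> W' i" "\<And>i. W' i \<subseteq> U"
    "\<And>i q. q \<in> W' i \<Longrightarrow> \<phi> q \<in> ball ?b r \<and> g i q = G (axis i 1) (\<phi> q)"
    by metis
  let ?W = "W \<inter> (\<Inter>i. W' i)"
  have W: "open ?W" "q \<in> ?W" using x g by (auto intro!: open_Int open_INT)
  let ?k = "\<lambda>i q'. (x i q' + - (?b $ i)) * g i q'"
  have kS: "?k i \<in> SF" for i using x g by (intro SF_mult SF_add SF_const)
  have eq: "f q' = f q + (\<Sum>i\<in>UNIV. ?k i q')" if "q' \<in> ?W" for q'
  proof -
    have b: "\<phi> q' \<in> ball ?b r" "q' \<in> U" using that g(5)[of q' 1] g(4)[of 1] by auto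
    have "f q' = f q + (\<Sum>i\<in>Basis. ((\<phi> q' - ?b) \<bullet> i) * G i (\<phi> q'))"
      using G(2)[OF b(1)] chart(5)[OF c] b(2) q by simp
    also have "(\<Sum>i\<in>Basis. ((\<phi> q' - ?b) \<bullet> i) * G i (\<phi> q')) = (\<Sum>i\<in>UNIV. ((\<phi> q' - ?b) \<bullet> axis i 1) * G (axis i 1) (\<phi> q'))"
      by (rule sum_Basis_axis)
    also have "\<dots> = (\<Sum>i\<in>UNIV. ?k i q')"
      using that g(5) x(4) by (intro sum.cong) (auto simp: inner_axis)
    finally show ?thesis .
  qed
  show ?thesis
  proof
    fix X assume X: "X \<in> VF"
    have "X f q = X (\<lambda>q'. f q + (\<Sum>i\<in>UNIV. ?k i q')) q"
      by (rule VF_local[OF X f _ W eq]) (intro SF_add SF_const SF_sum kS, auto)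
    also have "\<dots> = (\<Sum>i\<in>UNIV. X (?k i) q)"
      using VF_add[OF X SF_const[of "f q"] SF_sum[of UNIV ?k, OF finite_class.finite_UNIV kS]] VF_const[OF X]
        VF_sum[of X UNIV ?k, OF X finite_class.finite_UNIV kS] by simp
    also have "\<dots> = (\<Sum>i\<in>UNIV. g i q * X (x i) q)"
    proof (rule sum.cong)
      fix i
      have "X (\<lambda>q'. x i q' + - (?b $ i)) q = X (x i) q"
        using VF_add[OF X x(1) SF_const, of i "- (?b $ i)"] VF_const[OF X] by simp
      then show "X (?k i) q = g i q * X (x i) q"
        using VF_mult[OF X SF_add[OF x(1) SF_const] g(1), of i "- (?b $ i)" i] x(3,4) by simp
    qed simp
    finally show "X f q = (\<Sum>i\<in>UNIV. g i q * X (x i) q)" .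
  qed
qed

text \<open>
  Coordinate functions and coordinate fields of a chart. Fields are derivations of global
  functions, so both have to be globally defined: they are cut off, and have their usual
  meaning only on \<open>W\<close>.
\<close>

definition coordinates_on where
  "coordinates_on U \<phi> W x E \<longleftrightarrow> (\<forall>i. x i \<in> SF) \<and> (\<forall>i. E i \<in> VF) \<and> (\<forall>i. \<forall>q\<in>W. x i q = \<phi> q $ i) \<and>
    (\<forall>i. \<forall>f\<in>SF. \<forall>q\<in>W. E i f q = frechet_derivative (\<lambda>x. f (inv_into U \<phi> x)) (at (\<phi> q)) (axis i 1)) \<and>
    (\<forall>i j. \<forall>q\<in>W. E i (x j) q = (if i = j then 1 else 0)) \<and>
    (\<forall>X\<in>VF. \<forall>f\<in>SF. \<forall>q\<in>W. X f q = (\<Sum>i\<in>UNIV. X (x i) q * E i f q))"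

lemma coordinates_onD:
  assumes "coordinates_on U \<phi> W x E"
  shows "x i \<in> SF" "E i \<in> VF"
    "f \<in> SF \<Longrightarrow> q \<in> W \<Longrightarrow> E i f q = frechet_derivative (\<lambda>x. f (inv_into U \<phi> x)) (at (\<phi> q)) (axis i 1)"
    "q \<in> W \<Longrightarrow> E i (x j) q = (if i = j then 1 else 0)"
    "X \<in> VF \<Longrightarrow> f \<in> SF \<Longrightarrow> q \<in> W \<Longrightarrow> X f q = (\<Sum>i\<in>UNIV. X (x i) q * E i f q)"
  using assms unfolding coordinates_on_def by blast+

lemma coordinate_fields:
  assumes c: "(U, \<phi>) \<in> A" "p \<in> U"
  obtains W x E where "open W" "p \<in> W" "W \<subseteq> U" "coordinates_on U \<phi> W x E"
proof -
  let ?a = "\<phi> p" and ?S = "\<phi> ` U" and ?I = "inv_into U \<phi>"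
  obtain r where r: "r > 0" "cball ?a (2*r) \<subseteq> UNIV \<inter> \<phi> ` U"
    using chart_ball[OF c(1) open_UNIV c(2)] by auto
  obtain \<rho> :: "real^3 \<Rightarrow> real" where \<rho>: "smooth_on UNIV \<rho>" "\<And>x. 0 \<le> \<rho> x"
    "\<And>x. x \<in> ball ?a r \<Longrightarrow> \<rho> x = 1" "\<And>x. x \<notin> cball ?a (2*r) \<Longrightarrow> \<rho> x = 0"
    using smooth_bump[OF r(1)] by metis
  have S: "open ?S" by (rule chart(2)[OF c(1)])
  let ?W = "U \<inter> \<phi> -` ball ?a r"
  define x where "x = (\<lambda>i q. if q \<in> U \<and> \<phi> q \<in> ?S then \<rho> (\<phi> q) * \<phi> q $ i else 0)"
  define d where "d = (\<lambda>i f q. if q \<in> U \<and> \<phi> q \<in> ?S then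
      \<rho> (\<phi> q) * frechet_derivative (\<lambda>x. f (?I x)) (at (\<phi> q)) (axis i 1) else 0)"
  have xS: "x i \<in> SF" for i unfolding x_def
    by (rule SF_chart_function[OF c(1) S _ smooth_on_mult[OF S smooth_on_subset[OF \<rho>(1)]
          smooth_on_linear[OF S bounded_linear_vec_nth smooth_on_ident[OF S]]] compact_cball])
       (use r \<rho>(4) in auto)
  have dS: "d i f \<in> SF" if "f \<in> SF" for i f unfolding d_def
    by (rule SF_chart_function[OF c(1) S _ smooth_on_mult[OF S smooth_on_subset[OF \<rho>(1)]
          smooth_on_SucD(2)[OF SF_chart[OF that c(1)]]] compact_cball])
       (use r \<rho>(4) in auto)
  have fd: "((\<lambda>x. f (?I x)) has_derivative frechet_derivative (\<lambda>x. f (?I x)) (at (\<phi> q))) (at (\<phi> q))"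
    if "f \<in> SF" "q \<in> U" for f q
    using smooth_on_SucD(1)[OF SF_chart[OF that(1) c(1)]] that(2) by blast
  have dVF: "(\<lambda>f\<in>SF. d i f) \<in> VF" for i
  proof (rule VF_I)
    fix k f g q assume fg: "f \<in> SF" "g \<in> SF"
    have "frechet_derivative (\<lambda>x. k * f (?I x) + g (?I x)) (at (\<phi> q)) =
      (\<lambda>v. k * frechet_derivative (\<lambda>x. f (?I x)) (at (\<phi> q)) v + frechet_derivative (\<lambda>x. g (?I x)) (at (\<phi> q)) v)"
      if "q \<in> U"
      by (rule frechet_derivative_at[symmetric])
         (intro has_derivative_add has_derivative_mult_right fd fg that)
    then show "d i (\<lambda>p. k * f p + g p) q = k * d i f q + d i g q"
      by (auto simp: d_def algebra_simps)
    have "frechet_derivative (\<lambda>x. f (?I x) * g (?I x)) (at (\<phi> q)) =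
      (\<lambda>v. f (?I (\<phi> q)) * frechet_derivative (\<lambda>x. g (?I x)) (at (\<phi> q)) v
        + frechet_derivative (\<lambda>x. f (?I x)) (at (\<phi> q)) v * g (?I (\<phi> q)))"
      if "q \<in> U"
      by (rule frechet_derivative_at[symmetric]) (intro has_derivative_mult fd fg that)
    then show "d i (\<lambda>p. f p * g p) q = f q * d i g q + g q * d i f q"
      using chart(5)[OF c(1)] by (auto simp: d_def algebra_simps)
  qed (rule dS)
  have W: "open ?W" "p \<in> ?W" using chart_open_vimage[OF c(1) open_ball] c r by auto
  have xW: "x i q = \<phi> q $ i" if "q \<in> ?W" for i q using that \<rho>(3) by (auto simp: x_def)
  have dW: "d i f q = frechet_derivative (\<lambda>x. f (?I x)) (at (\<phi> q)) (axis i 1)" if "q \<in> ?W" for i f q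
    using that \<rho>(3) by (auto simp: d_def)
  have dx: "d i (x j) q = (if i = j then 1 else 0)" if q: "q \<in> ?W" for i j q
  proof -
    have "((\<lambda>x. x $ j) has_derivative (\<lambda>v. v $ j)) (at (\<phi> q))"
      by (rule bounded_linear.has_derivative[OF bounded_linear_vec_nth has_derivative_ident])
    then have "((\<lambda>y. x j (?I y)) has_derivative (\<lambda>v. v $ j)) (at (\<phi> q))"
    proof (rule has_derivative_transform_within_open[OF _ chart_open_image[OF c(1) W(1)]])
      show "\<phi> q \<in> \<phi> ` (U \<inter> ?W)" using q by auto
      show "y $ j = x j (?I y)" if "y \<in> \<phi> ` (U \<inter> ?W)" for y
        using that xW chart(5)[OF c(1)] by auto
    qed
    then have "frechet_derivative (\<lambda>y. x j (?I y)) (at (\<phi> q)) = (\<lambda>v. v $ j)"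
      by (rule frechet_derivative_at[symmetric])
    then show ?thesis using dW[OF q] by (simp add: axis_def)
  qed
  have "coordinates_on U \<phi> ?W x (\<lambda>i. \<lambda>f\<in>SF. d i f)"
    unfolding coordinates_on_def
  proof (intro conjI allI ballI)
    fix X f q assume X: "X \<in> VF" and f: "f \<in> SF" and q: "q \<in> ?W"
    then have "q \<in> U" by auto
    obtain g where g: "\<And>X. X \<in> VF \<Longrightarrow> X f q = (\<Sum>i\<in>UNIV. g i * X (x i) q)"
      using SF_hadamard[OF c(1) f \<open>q \<in> U\<close> xS W(1) q xW] by metis
    have "(\<lambda>f\<in>SF. d i f) f q = g i" for i
      using g[OF dVF[of i]] xS dx[OF q] by (simp add: if_distrib sum.delta cong: if_cong)
    then show "X f q = (\<Sum>i\<in>UNIV. X (x i) q * (\<lambda>f\<in>SF. d i f) f q)"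
      using g[OF X] by (simp add: mult.commute)
  next
    fix i show "(\<lambda>f\<in>SF. d i f) \<in> VF" by (rule dVF)
  qed (use xW dW dx xS in auto)
  then show ?thesis using that[OF W] by blast
qed

subsection \<open>Local coordinates given by independent functions\<close>

text \<open>
  The inverse function theorem for three functions with independent differentials at \<open>p\<close>.
  The chart of the manifold does not occur in the conclusion: the derivative of $h \circ G$
  in the direction of the components of a field \<open>V\<close> is \<open>V h\<close>. This determines it and spares
  all matrices of partial derivatives.
\<close>

lemma inverse_coordinates:
  fixes f :: "3 \<Rightarrow> 'a \<Rightarrow> real"
  assumes f: "\<And>i. f i \<in> SF" and W0: "open W0" "p \<in> W0"
    and ind: "\<forall>V\<in>VF. (\<forall>i. V (f i) p = 0) \<longrightarrow> (\<forall>h\<in>SF. V h p = 0)"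
  obtains W B G where "open W" "p \<in> W" "W \<subseteq> W0" "open B" "(\<chi> i. f i p) \<in> B" "continuous_on B G"
    "\<forall>q\<in>W. (\<chi> i. f i q) \<in> B \<and> G (\<chi> i. f i q) = q"
    "\<forall>y\<in>B. G y \<in> W \<and> (\<chi> i. f i (G y)) = y"
    "\<forall>y\<in>B. \<forall>h\<in>SF. \<exists>D. ((\<lambda>y. h (G y)) has_derivative D) (at y) \<and>
        (\<forall>V\<in>VF. D (\<chi> i. V (f i) (G y)) = V h (G y))"
proof -
  obtain U \<phi> where c: "(U, \<phi>) \<in> A" "p \<in> U" using chart_exists .
  obtain W1 x e where W1: "open W1" "p \<in> W1" "W1 \<subseteq> U" and cd: "coordinates_on U \<phi> W1 x e"
    using coordinate_fields[OF c] .
  note x = coordinates_onD(1)[OF cd] and d = coordinates_onD(2-5)[OF cd]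
  let ?I = "inv_into U \<phi>"
  let ?T = "\<phi> ` (U \<inter> (W1 \<inter> W0))"
  have T: "open ?T" using chart_open_image[OF c(1)] W1 W0 by blast
  have TI: "?I y \<in> W1 \<inter> W0" "?I y \<in> U" "\<phi> (?I y) = y" if "y \<in> ?T" for y
    using that chart[OF c(1)] by auto
  let ?D = "\<lambda>h y. frechet_derivative (\<lambda>x. h (?I x)) (at y)"
  have D: "((\<lambda>x. h (?I x)) has_derivative ?D h y) (at y)" if "y \<in> ?T" "h \<in> SF" for h y
    using smooth_on_SucD(1)[OF smooth_on_subset[OF SF_chart[OF that(2) c(1)]] that(1)] by blast
  have Dsum: "?D h y v = (\<Sum>j\<in>UNIV. v $ j * e j h (?I y))" if "y \<in> ?T" "h \<in> SF" for h y v
  proof -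
    have l: "linear (?D h y)" using D[OF that] has_derivative_linear by blast
    have "v = (\<Sum>j\<in>UNIV. v $ j *\<^sub>R axis j 1)"
      by (simp add: vec_eq_iff axis_def if_distrib sum.delta cong: if_cong)
    then have "?D h y v = ?D h y (\<Sum>j\<in>UNIV. v $ j *\<^sub>R axis j 1)" by simp
    also have "\<dots> = (\<Sum>j\<in>UNIV. v $ j * e j h (?I y))"
      using d(2)[of h "?I y"] TI[OF that(1)] that(2) by (simp add: linear_sum[OF l] linear_scale[OF l])
    finally show ?thesis .
  qed
  define \<Theta> where "\<Theta> = (\<lambda>y. \<chi> i. f i (?I y))"
  define \<Theta>' where "\<Theta>' = (\<lambda>y v. \<chi> i. ?D (f i) y v)"
  have der: "(\<Theta> has_derivative \<Theta>' y) (at y)" if "y \<in> ?T" for y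
    unfolding \<Theta>_def \<Theta>'_def using D[OF that f]
    by (auto simp: has_derivative_componentwise_within[of _ "\<lambda>v. \<chi> i. _ i v"] Basis_vec_def inner_axis)
  have bl: "bounded_linear (\<Theta>' y)" if "y \<in> ?T" for y
    using der[OF that] has_derivative_bounded_linear by blast
  have cont: "continuous_on ?T (\<lambda>y. Blinfun (\<Theta>' y))"
  proof (rule continuous_on_blinfun_componentwise)
    fix v :: "real^3"
    have "continuous_on ?T (\<lambda>y. ?D (f i) y v)" for i
      by (rule smooth_on_continuous[OF smooth_on_SucD(2)[OF smooth_on_subset[OF SF_chart[OF f c(1)]]]]) auto
    then have "continuous_on ?T (\<lambda>y. \<Theta>' y v)" unfolding \<Theta>'_def
      by (intro continuous_on_vec_lambda)
    then show "continuous_on ?T (\<lambda>y. blinfun_apply (Blinfun (\<Theta>' y)) v)"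
      using bl by (simp add: bounded_linear_Blinfun_apply cong: continuous_on_cong)
  qed
  have pT: "\<phi> p \<in> ?T" using c W0 W1 by auto
  have pI: "?I (\<phi> p) = p" using chart(5)[OF c(1)] c(2) by blast
  have inj: "inj (\<Theta>' (\<phi> p))"
  proof (subst linear_injective_0)
    show "linear (\<Theta>' (\<phi> p))" using bl[OF pT] bounded_linear.linear by blast
    show "\<forall>v. \<Theta>' (\<phi> p) v = 0 \<longrightarrow> v = 0"
    proof (intro allI impI)
      fix v assume v: "\<Theta>' (\<phi> p) v = 0"
      let ?V = "\<lambda>h\<in>SF. \<lambda>q. \<Sum>j\<in>UNIV. v $ j * e j h q"
      have V: "?V \<in> VF" by (rule VF_lincomb) (auto simp: SF_const d(1))
      have "?V (f i) p = 0" for i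
        using arg_cong[OF v, of "\<lambda>w. w $ i"] Dsum[OF pT f] pI f by (simp add: \<Theta>'_def)
      then have "?V (x i) p = 0" for i using ind V x by blast
      then have "v $ i = 0" for i
        using x d(3)[OF W1(2)] by (simp add: if_distrib sum.delta cong: if_cong)
      then show "v = 0" by (simp add: vec_eq_iff)
    qed
  qed
  obtain L where L: "linear L" "L \<circ> \<Theta>' (\<phi> p) = id"
    using linear_injective_left_inverse[OF _ inj] bl[OF pT] bounded_linear.linear by blast
  have L': "Blinfun L o\<^sub>L Blinfun (\<Theta>' (\<phi> p)) = id_blinfun"
    using L bl[OF pT] by (intro blinfun_eqI)
      (simp add: bounded_linear_Blinfun_apply linear_conv_bounded_linear[symmetric] fun_eq_iff o_def)
  have der': "(\<Theta> has_derivative blinfun_apply (Blinfun (\<Theta>' y))) (at y)" if "y \<in> ?T" for y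
    using der[OF that] bl[OF that] by (simp add: bounded_linear_Blinfun_apply)
  then have der'': "\<forall>y\<in>?T. (\<Theta> has_derivative blinfun_apply (Blinfun (\<Theta>' y))) (at y)" by blast
  obtain U' V g g' where g: "open U'" "U' \<subseteq> ?T" "\<phi> p \<in> U'" "open V" "\<Theta> (\<phi> p) \<in> V"
      "homeomorphism U' V \<Theta> g"
      "\<forall>y\<in>V. (g has_derivative g' y) (at y) \<and> g' y = inv (blinfun_apply (Blinfun (\<Theta>' (g y))))
        \<and> bij (blinfun_apply (Blinfun (\<Theta>' (g y))))"
    using inverse_function_ex[OF T der'' cont pT L'] by (elim exE conjE) (rule that)
  have gV: "g y \<in> U'" "\<Theta> (g y) = y" if "y \<in> V" for y
    using g(6) that by (auto simp: homeomorphism_def)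
  have gU: "\<Theta> y \<in> V" "g (\<Theta> y) = y" if "y \<in> U'" for y
    using g(6) that by (auto simp: homeomorphism_def)
  let ?W = "U \<inter> \<phi> -` U'" and ?G = "\<lambda>y. ?I (g y)"
  have WI: "?I (\<phi> q) = q" if "q \<in> ?W" for q using that chart(5)[OF c(1)] by blast
  have WW: "q \<in> W1 \<inter> W0" if "q \<in> ?W" for q
  proof -
    have "\<phi> q \<in> ?T" using that g(2) by blast
    from TI(1)[OF this] show ?thesis using WI[OF that] by simp
  qed
  show ?thesis
  proof (rule that[of ?W V ?G]; (intro ballI)?)
    show "open ?W" by (rule chart_open_vimage[OF c(1) g(1)])
    show "p \<in> ?W" using c g by auto
    show "?W \<subseteq> W0" using WW by auto
    show "open V" "(\<chi> i. f i p) \<in> V" using g pI by (auto simp: \<Theta>_def)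
    show "continuous_on V ?G"
      by (rule continuous_on_compose2[OF chart(4)[OF c(1)], of V g])
         (use g gV in \<open>auto simp: homeomorphism_def\<close>)
    show "(\<chi> i. f i q) \<in> V \<and> ?G (\<chi> i. f i q) = q" if "q \<in> ?W" for q
      using gU[of "\<phi> q"] that WI[OF that] by (auto simp: \<Theta>_def)
    show "?G y \<in> ?W \<and> (\<chi> i. f i (?G y)) = y" if "y \<in> V" for y
      using gV[OF that] g(2) TI[of "g y"] by (auto simp: \<Theta>_def)
    fix y h assume y: "y \<in> V" and h: "h \<in> SF"
    have gT: "g y \<in> ?T" using gV[OF y] g(2) by blast
    have app: "blinfun_apply (Blinfun (\<Theta>' (g y))) = \<Theta>' (g y)"
      using bl[OF gT] by (simp add: bounded_linear_Blinfun_apply)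
    have "((\<lambda>y. h (?G y)) has_derivative (\<lambda>v. ?D h (g y) (g' y v))) (at y)"
      using g(7) y by (auto intro!: has_derivative_compose[of g _ _ _ "\<lambda>x. h (?I x)", OF _ D[OF gT h]])
    moreover have "?D h (g y) (g' y (\<chi> i. V' (f i) (?G y))) = V' h (?G y)" if V': "V' \<in> VF" for V'
    proof -
      let ?v = "\<chi> j. V' (x j) (?G y)"
      have e: "?D k (g y) ?v = V' k (?G y)" if "k \<in> SF" for k
        using Dsum[OF gT that] d(4)[OF V' that] TI[OF gT] by simp
      then have "\<Theta>' (g y) ?v = (\<chi> i. V' (f i) (?G y))" using f by (simp add: \<Theta>'_def)
      then have "g' y (\<chi> i. V' (f i) (?G y)) = ?v"
        using bspec[OF g(7) y] unfolding app by (metis bij_inv_eq_iff)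
      then show ?thesis using e[OF h] by simp
    qed
    ultimately show "\<exists>D. ((\<lambda>y. h (?G y)) has_derivative D) (at y) \<and>
        (\<forall>V\<in>VF. D (\<chi> i. V (f i) (?G y)) = V h (?G y))" by blast
  qed
qed

end

section \<open>Forms on the $b^m$-tangent bundle and the Reeb field\<close>

context manifold3 begin

text \<open>
  The denominator $h^2 + (1 - \rho)^2$, with \<open>\<rho>\<close> a bump function at \<open>p\<close>, has no zero
  anywhere and equals $h^2$ near \<open>p\<close>.
\<close>

lemma SF_local_div:
  assumes "f \<in> SF" "h \<in> SF" "h p \<noteq> 0"
  obtains g W where "g \<in> SF" "open W" "p \<in> W" "\<forall>q\<in>W. h q \<noteq> 0 \<and> g q = f q / h q"
proof -
  obtain \<rho> W K where \<rho>: "\<rho> \<in> SF" "\<And>q. 0 \<le> \<rho> q" "open W" "p \<in> W" "\<And>q. q \<in> W \<Longrightarrow> \<rho> q = 1"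
    "compact K" "K \<subseteq> {q. h q \<noteq> 0}" "\<And>q. q \<notin> K \<Longrightarrow> \<rho> q = 0"
    using SF_bump[OF SF_open_nonzero[OF assms(2)], of p] assms(3) by blast
  let ?d = "\<lambda>q. h q * h q + (1 - \<rho> q) * (1 - \<rho> q)"
  have d: "?d q \<noteq> 0" for q
  proof (cases "h q = 0")
    case True
    then have "\<rho> q = 0" using \<rho>(7,8) by blast
    then show ?thesis using True by simp
  next
    case False
    then have "h q * h q > 0" by (metis not_real_square_gt_zero)
    moreover have "(1 - \<rho> q) * (1 - \<rho> q) \<ge> 0" by simp
    ultimately show ?thesis by linarith
  qed
  have "(\<lambda>q. f q * h q * inverse (?d q)) \<in> SF"
    by (intro SF_mult SF_inverse SF_add SF_diff SF_const assms \<rho>(1) d)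
  moreover have "open (W \<inter> {q. h q \<noteq> 0})" using \<rho>(3) SF_open_nonzero[OF assms(2)] by blast
  moreover have "\<forall>q\<in>W \<inter> {q. h q \<noteq> 0}. h q \<noteq> 0 \<and> f q * h q * inverse (?d q) = f q / h q"
    using \<rho>(5) by (simp add: field_simps)
  ultimately show ?thesis using that \<rho>(4) assms(3) by blast
qed

lemma SF_div_support:
  assumes "f \<in> SF" "h \<in> SF" "compact K" "\<And>q. q \<notin> K \<Longrightarrow> f q = 0" "\<And>q. q \<in> K \<Longrightarrow> h q \<noteq> 0"
  shows "(\<lambda>q. f q / h q) \<in> SF"
proof (rule SF_local)
  fix p
  show "\<exists>W. open W \<and> p \<in> W \<and> (\<exists>g\<in>SF. \<forall>q\<in>W. f q / h q = g q)"
  proof (cases "p \<in> K")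
    case True
    obtain g W where "g \<in> SF" "open W" "p \<in> W" "\<forall>q\<in>W. h q \<noteq> 0 \<and> g q = f q / h q"
      using SF_local_div[OF assms(1,2) assms(5)[OF True]] .
    then show ?thesis by (intro exI[of _ W] conjI bexI[of _ g]) auto
  next
    case False
    then show ?thesis
      using assms(4) compact_imp_closed[OF assms(3)]
      by (intro exI[of _ "-K"] conjI bexI[of _ "\<lambda>p. 0"]) (auto simp: SF_const open_Compl)
  qed
qed

end

locale bm_contact = manifold3 A
  for A :: "('a::{t2_space,second_countable_topology} set \<times> ('a \<Rightarrow> real^3)) set" +
  fixes z :: "'a \<Rightarrow> real" and m :: nat and \<alpha> :: "'a bm_form1"
  assumes defining: "defining_function A z"
    and m_pos: "m \<ge> 1"
    and contact: "bm_contact_form A z m \<alpha>"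
begin

abbreviation "BV \<equiv> bm_vector_fields A z m"
abbreviation "\<omega> \<equiv> ext_deriv A \<alpha>"

lemma z_SF: "z \<in> SF" using defining by (simp add: defining_function_def)

lemma BV_VF: "X \<in> BV \<Longrightarrow> X \<in> VF" by (simp add: bm_vector_fields_def)

lemma BV_D: "X \<in> BV \<Longrightarrow> \<exists>g\<in>SF. X z = (\<lambda>p. z p ^ m * g p)" by (simp add: bm_vector_fields_def)

lemma BV_I: "X \<in> VF \<Longrightarrow> g \<in> SF \<Longrightarrow> (\<And>p. X z p = z p ^ m * g p) \<Longrightarrow> X \<in> BV"
  by (auto simp: bm_vector_fields_def fun_eq_iff)

lemma BV_comb: assumes "f \<in> SF" "X \<in> BV" "Y \<in> BV" shows "comb f X Y \<in> BV"
proof -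
  obtain g h where gh: "g \<in> SF" "X z = (\<lambda>p. z p ^ m * g p)" "h \<in> SF" "Y z = (\<lambda>p. z p ^ m * h p)"
    using BV_D[OF assms(2)] BV_D[OF assms(3)] by blast
  show ?thesis
  proof (rule BV_I)
    show "comb f X Y \<in> VF" by (intro comb BV_VF assms)
    show "(\<lambda>p. f p * g p + h p) \<in> SF" by (intro SF_add SF_mult assms gh)
    show "comb f X Y z p = z p ^ m * (f p * g p + h p)" for p
      unfolding comb(2)[OF assms(1) BV_VF[OF assms(2)] BV_VF[OF assms(3)] z_SF] gh(2) gh(4)
      by (simp add: distrib_left mult.left_commute)
  qed
qed

lemma BV_zerof: "zerof \<in> BV"
  by (rule BV_I[of _ "\<lambda>p. 0"]) (simp_all add: zerof z_SF SF_const)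

lemma BV_lie: assumes "X \<in> BV" "Y \<in> BV" shows "lie_bracket A X Y \<in> BV"
proof -
  note XY = BV_VF[OF assms(1)] BV_VF[OF assms(2)]
  obtain g h where gh: "g \<in> SF" "X z = (\<lambda>p. z p ^ m * g p)" "h \<in> SF" "Y z = (\<lambda>p. z p ^ m * h p)"
    using BV_D[OF assms(1)] BV_D[OF assms(2)] by blast
  let ?k = "\<lambda>p. X h p - Y g p"
  have "lie_bracket A X Y z p = z p ^ m * ?k p" for p
  proof -
    have 1: "X (Y z) p = z p ^ m * X h p + h p * (real m * z p ^ (m - 1) * X z p)"
      unfolding gh(4) using VF_mult[OF XY(1) SF_power[OF z_SF] gh(3)] VF_power[OF XY(1) z_SF] by simp
    have 2: "Y (X z) p = z p ^ m * Y g p + g p * (real m * z p ^ (m - 1) * Y z p)"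
      unfolding gh(2) using VF_mult[OF XY(2) SF_power[OF z_SF] gh(1)] VF_power[OF XY(2) z_SF] by simp
    have 3: "X z p = z p ^ m * g p" "Y z p = z p ^ m * h p" using gh by simp_all
    show ?thesis unfolding lie_bracket(2)[OF XY z_SF] 1 2 unfolding 3 by (simp add: algebra_simps)
  qed
  then show ?thesis
    by (rule BV_I[OF lie_bracket(1)[OF XY] SF_diff[OF VF_SF[OF XY(1) gh(3)] VF_SF[OF XY(2) gh(1)]]])
qed

lemma comb_one: "X \<in> VF \<Longrightarrow> comb (\<lambda>p. 1) X zerof = X"
  by (rule VF_eqI) (simp_all add: comb SF_const zerof)

subsection \<open>Tensorial functionals\<close>

text \<open>
  Evaluation at a point of a form, of a vector field on a fixed function, or of a two-form
  with one slot filled all depend only on the germ of the field and are linear over the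
  smooth functions. One notion covers them all, so that changing frames is a single
  computation.
\<close>

definition tens :: "'a \<Rightarrow> ('a vfield \<Rightarrow> real) \<Rightarrow> bool" where
  "tens p L \<longleftrightarrow> (\<forall>f\<in>SF. \<forall>X\<in>BV. \<forall>Y\<in>BV. L (comb f X Y) = f p * L X + L Y) \<and>
     (\<forall>X\<in>BV. \<forall>Y\<in>BV. \<forall>W. open W \<longrightarrow> p \<in> W \<longrightarrow> (\<forall>f\<in>SF. \<forall>q\<in>W. X f q = Y f q) \<longrightarrow> L X = L Y)"

lemma tens_comb: "tens p L \<Longrightarrow> f \<in> SF \<Longrightarrow> X \<in> BV \<Longrightarrow> Y \<in> BV \<Longrightarrow> L (comb f X Y) = f p * L X + L Y"
  by (simp add: tens_def)

lemma tens_local: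
  "tens p L \<Longrightarrow> X \<in> BV \<Longrightarrow> Y \<in> BV \<Longrightarrow> open W \<Longrightarrow> p \<in> W \<Longrightarrow> \<forall>f\<in>SF. \<forall>q\<in>W. X f q = Y f q \<Longrightarrow> L X = L Y"
  unfolding tens_def by blast

lemma tens_I:
  assumes "\<And>f X Y. f \<in> SF \<Longrightarrow> X \<in> BV \<Longrightarrow> Y \<in> BV \<Longrightarrow> L (comb f X Y) = f p * L X + L Y"
  shows "tens p L"
  unfolding tens_def
proof (intro conjI ballI allI impI)
  fix X Y W assume XY: "X \<in> BV" "Y \<in> BV" and W: "open W" "p \<in> W" "\<forall>f\<in>SF. \<forall>q\<in>W. X f q = Y f q"
  obtain \<rho> W' K where \<rho>: "\<rho> \<in> SF" "\<And>q. 0 \<le> \<rho> q" "open W'" "p \<in> W'" "\<And>q. q \<in> W' \<Longrightarrow> \<rho> q = 1"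
    "compact K" "K \<subseteq> W" "\<And>q. q \<notin> K \<Longrightarrow> \<rho> q = 0"
    using SF_bump[OF W(1,2)] by blast
  have "comb \<rho> X zerof = comb \<rho> Y zerof"
  proof (rule VF_eqI)
    fix f q assume f: "f \<in> SF"
    have "\<rho> q * X f q = \<rho> q * Y f q" using W(3) f \<rho>(7,8) by (cases "q \<in> K") auto
    then show "comb \<rho> X zerof f q = comb \<rho> Y zerof f q"
      using f \<rho>(1) BV_VF XY zerof by (simp add: comb)
  qed (use \<rho>(1) BV_VF XY zerof comb in auto)
  then have "\<rho> p * L X + L zerof = \<rho> p * L Y + L zerof"
    unfolding assms[OF \<rho>(1) XY(1) BV_zerof, symmetric] assms[OF \<rho>(1) XY(2) BV_zerof, symmetric] by simp
  then show "L X = L Y" using \<rho>(5)[OF \<rho>(4)] by simp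
qed (rule assms)

lemma tens_zerof: "tens p L \<Longrightarrow> L zerof = 0"
  using tens_comb[OF _ SF_const BV_zerof BV_zerof, of p L 1] comb_one[OF zerof(1)] by simp

lemma tens_apply: "f \<in> SF \<Longrightarrow> tens p (\<lambda>X. X f p)"
  by (rule tens_I) (simp add: comb BV_VF)

lemma form_SF: "\<theta> \<in> bm_one_forms A z m \<Longrightarrow> X \<in> BV \<Longrightarrow> \<theta> X \<in> SF"
  by (auto simp: bm_one_forms_def)

lemma tens_form: "\<theta> \<in> bm_one_forms A z m \<Longrightarrow> tens p (\<lambda>X. \<theta> X p)"
  by (rule tens_I) (simp add: comb_def bm_one_forms_def)

lemma \<alpha>_form: "\<alpha> \<in> bm_one_forms A z m" using contact by (simp add: bm_contact_form_def)

lemmas \<alpha>_SF = form_SF[OF \<alpha>_form]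
lemmas tens_\<alpha> = tens_form[OF \<alpha>_form]

lemma \<omega>_SF: assumes "X \<in> BV" "Y \<in> BV" shows "\<omega> X Y \<in> SF"
  unfolding ext_deriv_def
  by (rule SF_diff[OF SF_diff[OF VF_SF[OF BV_VF[OF assms(1)] \<alpha>_SF[OF assms(2)]]
      VF_SF[OF BV_VF[OF assms(2)] \<alpha>_SF[OF assms(1)]]] \<alpha>_SF[OF BV_lie[OF assms]]])

lemma \<omega>_antisym: assumes "X \<in> BV" "Y \<in> BV" shows "\<omega> Y X p = - \<omega> X Y p"
proof -
  have "lie_bracket A Y X = comb (\<lambda>p. -1) (lie_bracket A X Y) zerof"
    by (rule VF_eqI) (use assms BV_VF in \<open>simp_all add: lie_bracket comb SF_const zerof\<close>)
  then have "\<alpha> (lie_bracket A Y X) p = - \<alpha> (lie_bracket A X Y) p"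
    using tens_comb[OF tens_\<alpha> SF_const BV_lie[OF assms] BV_zerof] tens_zerof[OF tens_\<alpha>] by simp
  then show ?thesis by (simp add: ext_deriv_def)
qed

lemma \<omega>_comb:
  assumes "f \<in> SF" "X \<in> BV" "X' \<in> BV" "Y \<in> BV"
  shows "\<omega> (comb f X X') Y p = f p * \<omega> X Y p + \<omega> X' Y p"
proof -
  note v = BV_VF[OF assms(2)] BV_VF[OF assms(3)] BV_VF[OF assms(4)]
  have Yf: "(\<lambda>p. - Y f p) \<in> SF" by (rule SF_uminus[OF VF_SF[OF v(3) assms(1)]])
  have c: "comb f X X' \<in> VF" by (rule comb(1)[OF assms(1) v(1,2)])
  have "lie_bracket A (comb f X X') Y = comb f (lie_bracket A X Y) (comb (\<lambda>p. - Y f p) X (lie_bracket A X' Y))"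
  proof (rule VF_eqI)
    fix h q assume h: "h \<in> SF"
    have "comb f X X' h = (\<lambda>q. f q * X h q + X' h q)" using comb(2)[OF assms(1) v(1,2) h] by (simp add: fun_eq_iff)
    then have e1: "Y (comb f X X' h) q = f q * Y (X h) q + X h q * Y f q + Y (X' h) q"
      using VF_add[OF v(3) SF_mult[OF assms(1) VF_SF[OF v(1) h]] VF_SF[OF v(2) h]]
        VF_mult[OF v(3) assms(1) VF_SF[OF v(1) h]] by simp
    have e2: "comb f X X' (Y h) q = f q * X (Y h) q + X' (Y h) q"
      using comb(2)[OF assms(1) v(1,2) VF_SF[OF v(3) h]] .
    show "lie_bracket A (comb f X X') Y h q =
        comb f (lie_bracket A X Y) (comb (\<lambda>p. - Y f p) X (lie_bracket A X' Y)) h q"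
      unfolding lie_bracket(2)[OF c v(3) h] comb(2)[OF assms(1) lie_bracket(1)[OF v(1,3)] comb(1)[OF Yf v(1) lie_bracket(1)[OF v(2,3)]] h]
        comb(2)[OF Yf v(1) lie_bracket(1)[OF v(2,3)] h] lie_bracket(2)[OF v(1,3) h] lie_bracket(2)[OF v(2,3) h] e1 e2
      by (simp add: algebra_simps)
  qed (rule lie_bracket(1)[OF c v(3)] comb(1)[OF assms(1) lie_bracket(1)[OF v(1,3)]
        comb(1)[OF Yf v(1) lie_bracket(1)[OF v(2,3)]]])+
  then have "\<alpha> (lie_bracket A (comb f X X') Y) p =
      f p * \<alpha> (lie_bracket A X Y) p - Y f p * \<alpha> X p + \<alpha> (lie_bracket A X' Y) p"
    using tens_comb[OF tens_\<alpha> assms(1) BV_lie[OF assms(2,4)] BV_comb[OF Yf assms(2) BV_lie[OF assms(3,4)]]]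
      tens_comb[OF tens_\<alpha> Yf assms(2) BV_lie[OF assms(3,4)]] by simp
  moreover have "\<alpha> (comb f X X') = (\<lambda>q. f q * \<alpha> X q + \<alpha> X' q)"
    using tens_comb[OF tens_\<alpha> assms(1-3)] by (simp add: fun_eq_iff)
  then have "Y (\<alpha> (comb f X X')) p = f p * Y (\<alpha> X) p + \<alpha> X p * Y f p + Y (\<alpha> X') p"
    using VF_add[OF v(3) SF_mult[OF assms(1) \<alpha>_SF[OF assms(2)]] \<alpha>_SF[OF assms(3)]]
      VF_mult[OF v(3) assms(1) \<alpha>_SF[OF assms(2)]] by simp
  moreover have "comb f X X' (\<alpha> Y) p = f p * X (\<alpha> Y) p + X' (\<alpha> Y) p"
    by (rule comb(2)[OF assms(1) v(1,2) \<alpha>_SF[OF assms(4)]])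
  ultimately show ?thesis by (simp add: ext_deriv_def algebra_simps)
qed

lemma tens_\<omega>: "Y \<in> BV \<Longrightarrow> tens p (\<lambda>X. \<omega> X Y p)"
  by (rule tens_I) (rule \<omega>_comb)

lemma tens_\<omega>': assumes "Y \<in> BV" shows "tens p (\<lambda>X. \<omega> Y X p)"
proof (rule tens_I)
  fix f X X' assume *: "f \<in> SF" "X \<in> BV" "X' \<in> BV"
  show "\<omega> Y (comb f X X') p = f p * \<omega> Y X p + \<omega> Y X' p"
    unfolding \<omega>_antisym[OF BV_comb[OF *] assms, of p] \<omega>_antisym[OF *(2) assms, of p]
      \<omega>_antisym[OF *(3) assms, of p] \<omega>_comb[OF * assms] by simp
qed

subsection \<open>Local frames\<close>

definition frame :: "'a \<Rightarrow> 'a vfield \<Rightarrow> 'a vfield \<Rightarrow> 'a vfield \<Rightarrow> bool" where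
  "frame p E1 E2 E3 \<longleftrightarrow> E1 \<in> BV \<and> E2 \<in> BV \<and> E3 \<in> BV \<and>
     (\<forall>X\<in>BV. \<exists>W c1 c2 c3. open W \<and> p \<in> W \<and> c1 \<in> SF \<and> c2 \<in> SF \<and> c3 \<in> SF \<and>
        (\<forall>f\<in>SF. \<forall>q\<in>W. X f q = c1 q * E1 f q + c2 q * E2 f q + c3 q * E3 f q))"

lemma tens_combination:
  assumes "tens p L" "X \<in> BV" "E1 \<in> BV" "E2 \<in> BV" "E3 \<in> BV" "c1 \<in> SF" "c2 \<in> SF" "c3 \<in> SF" "open W" "p \<in> W"
    "\<forall>f\<in>SF. \<forall>q\<in>W. X f q = c1 q * E1 f q + c2 q * E2 f q + c3 q * E3 f q"
  shows "L X = c1 p * L E1 + c2 p * L E2 + c3 p * L E3"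
proof -
  let ?Y3 = "comb c3 E3 zerof" let ?Y2 = "comb c2 E2 ?Y3" let ?Y1 = "comb c1 E1 ?Y2"
  have B: "?Y3 \<in> BV" "?Y2 \<in> BV" "?Y1 \<in> BV" by (intro BV_comb assms BV_zerof)+
  have "L X = L ?Y1"
    by (rule tens_local[OF assms(1,2) B(3) assms(9,10)])
       (use assms B BV_VF zerof in \<open>simp add: comb\<close>)
  then show ?thesis
    using tens_comb[OF assms(1) assms(6,3) B(2)] tens_comb[OF assms(1) assms(7,4) B(1)]
      tens_comb[OF assms(1) assms(8,5) BV_zerof] tens_zerof[OF assms(1)] by simp
qed

lemma frame_expand:
  assumes "frame p E1 E2 E3" "X \<in> BV"
  obtains a1 a2 a3 where "\<forall>L. tens p L \<longrightarrow> L X = a1 * L E1 + a2 * L E2 + a3 * L E3"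
proof -
  obtain W c1 c2 c3 where *: "open W" "p \<in> W" "c1 \<in> SF" "c2 \<in> SF" "c3 \<in> SF"
      "\<forall>f\<in>SF. \<forall>q\<in>W. X f q = c1 q * E1 f q + c2 q * E2 f q + c3 q * E3 f q"
    using assms unfolding frame_def by blast
  have "\<forall>L. tens p L \<longrightarrow> L X = c1 p * L E1 + c2 p * L E2 + c3 p * L E3"
    using tens_combination[OF _ assms(2) _ _ _ *(3-5,1,2,6)] assms(1) unfolding frame_def by blast
  then show ?thesis by (rule that)
qed

text \<open>
  The value of $L \wedge d\alpha$ on a triple of fields. That it is nonzero for \<open>L = \<alpha>\<close> and
  some triple is the contact condition; other functionals in place of \<open>\<alpha>\<close> give the
  numerators in Cramer's rule.
\<close>

definition tw :: "'a \<Rightarrow> ('a vfield \<Rightarrow> real) \<Rightarrow> 'a vfield \<Rightarrow> 'a vfield \<Rightarrow> 'a vfield \<Rightarrow> real" where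
  "tw p L X Y W = L X * \<omega> Y W p + L Y * \<omega> W X p + L W * \<omega> X Y p"

lemma \<omega>_expand:
  assumes "\<forall>L. tens p L \<longrightarrow> L X = a1 * L E1 + a2 * L E2 + a3 * L E3"
    "\<forall>L. tens p L \<longrightarrow> L Y = b1 * L E1 + b2 * L E2 + b3 * L E3"
    "X \<in> BV" "Y \<in> BV" "E1 \<in> BV" "E2 \<in> BV" "E3 \<in> BV"
  shows "\<omega> X Y p = (a1 * b2 - a2 * b1) * \<omega> E1 E2 p + (a2 * b3 - a3 * b2) * \<omega> E2 E3 p + (a3 * b1 - a1 * b3) * \<omega> E3 E1 p"
proof -
  have self: "\<omega> E E p = 0" if "E \<in> BV" for E using \<omega>_antisym[OF that that, of p] by simp
  have "\<omega> X Y p = a1 * \<omega> E1 Y p + a2 * \<omega> E2 Y p + a3 * \<omega> E3 Y p"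
    using assms(1) tens_\<omega>[OF assms(4)] by blast
  moreover have "\<omega> E Y p = b1 * \<omega> E E1 p + b2 * \<omega> E E2 p + b3 * \<omega> E E3 p" if "E \<in> BV" for E
    using assms(2) tens_\<omega>'[OF that] by blast
  ultimately show ?thesis
    using assms(5-7) self \<omega>_antisym[OF assms(5,6), of p] \<omega>_antisym[OF assms(6,7), of p] \<omega>_antisym[OF assms(7,5), of p]
    by (simp add: algebra_simps)
qed

text \<open>
  An alternating trilinear functional is determined by its value on a frame. The factor is
  the determinant of the triple with respect to the frame and does not depend on \<open>L\<close>.
\<close>

lemma tw_frame:
  assumes E: "frame p E1 E2 E3" and X: "X \<in> BV" "Y \<in> BV" "W \<in> BV"
  obtains D where "\<forall>L. tens p L \<longrightarrow> tw p L X Y W = D * tw p L E1 E2 E3"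
proof -
  have B: "E1 \<in> BV" "E2 \<in> BV" "E3 \<in> BV" using E by (auto simp: frame_def)
  obtain a1 a2 a3 where a: "\<forall>L. tens p L \<longrightarrow> L X = a1 * L E1 + a2 * L E2 + a3 * L E3"
    using frame_expand[OF E X(1)] .
  obtain b1 b2 b3 where b: "\<forall>L. tens p L \<longrightarrow> L Y = b1 * L E1 + b2 * L E2 + b3 * L E3"
    using frame_expand[OF E X(2)] .
  obtain c1 c2 c3 where c: "\<forall>L. tens p L \<longrightarrow> L W = c1 * L E1 + c2 * L E2 + c3 * L E3"
    using frame_expand[OF E X(3)] .
  let ?D = "a1 * (b2 * c3 - b3 * c2) + a2 * (b3 * c1 - b1 * c3) + a3 * (b1 * c2 - b2 * c1)"
  have "tw p L X Y W = ?D * tw p L E1 E2 E3" if L: "tens p L" for L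
    unfolding tw_def \<omega>_expand[OF a b X(1,2) B] \<omega>_expand[OF b c X(2,3) B] \<omega>_expand[OF c a X(3,1) B]
      a[rule_format, OF L] b[rule_format, OF L] c[rule_format, OF L]
    by algebra
  then show ?thesis using that by blast
qed

lemma tw_proportional:
  assumes E: "frame p E1 E2 E3" and "tens p L" "tens p L'"
    and X: "X \<in> BV" "Y \<in> BV" "W \<in> BV" and X': "X' \<in> BV" "Y' \<in> BV" "W' \<in> BV"
  shows "tw p L X Y W * tw p L' X' Y' W' = tw p L X' Y' W' * tw p L' X Y W"
proof -
  obtain D where D: "\<forall>L. tens p L \<longrightarrow> tw p L X Y W = D * tw p L E1 E2 E3" using tw_frame[OF E X] .
  obtain D' where D': "\<forall>L. tens p L \<longrightarrow> tw p L X' Y' W' = D' * tw p L E1 E2 E3" using tw_frame[OF E X'] .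
  show ?thesis using D D' assms(2,3) by simp
qed

lemma contact_tw:
  "\<exists>X Y W. X \<in> BV \<and> Y \<in> BV \<and> W \<in> BV \<and> tw p (\<lambda>X. \<alpha> X p) X Y W \<noteq> 0"
  using contact unfolding bm_contact_form_def tw_def wedge12_def by blast

lemma frame_tw_nonzero:
  assumes "frame p E1 E2 E3" shows "tw p (\<lambda>X. \<alpha> X p) E1 E2 E3 \<noteq> 0"
proof -
  obtain X Y W where *: "X \<in> BV" "Y \<in> BV" "W \<in> BV" "tw p (\<lambda>X. \<alpha> X p) X Y W \<noteq> 0"
    using contact_tw by blast
  obtain D where "\<forall>L. tens p L \<longrightarrow> tw p L X Y W = D * tw p L E1 E2 E3" using tw_frame[OF assms *(1-3)] .
  then show ?thesis using *(4) tens_\<alpha> by fastforce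
qed

text \<open>
  Here \<open>L\<close> is the contraction of $d\alpha$ with \<open>V\<close>, and $i_V d\alpha \wedge d\alpha$ is
  half of $i_V (d\alpha \wedge d\alpha)$, which is zero because in dimension three there are
  no forms of degree four.
\<close>

lemma \<omega>_tw_zero:
  assumes E: "frame p E1 E2 E3" and X: "X \<in> BV" "Y \<in> BV" "W \<in> BV" and V: "V \<in> BV"
  shows "tw p (\<lambda>X. \<omega> X V p) X Y W = 0"
proof -
  have B: "E1 \<in> BV" "E2 \<in> BV" "E3 \<in> BV" using E by (auto simp: frame_def)
  obtain a1 a2 a3 where a: "\<forall>L. tens p L \<longrightarrow> L V = a1 * L E1 + a2 * L E2 + a3 * L E3"
    using frame_expand[OF E V] .
  have e: "\<omega> F V p = a1 * \<omega> F E1 p + a2 * \<omega> F E2 p + a3 * \<omega> F E3 p" if "F \<in> BV" for F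
    using a tens_\<omega>'[OF that] by blast
  have self: "\<omega> F F p = 0" if "F \<in> BV" for F using \<omega>_antisym[OF that that, of p] by simp
  have "tw p (\<lambda>X. \<omega> X V p) E1 E2 E3 = 0"
    unfolding tw_def e[OF B(1)] e[OF B(2)] e[OF B(3)] self[OF B(1)] self[OF B(2)] self[OF B(3)]
      \<omega>_antisym[OF B(1,2), of p] \<omega>_antisym[OF B(2,3), of p] \<omega>_antisym[OF B(3,1), of p]
    by algebra
  moreover obtain D where "\<forall>L. tens p L \<longrightarrow> tw p L X Y W = D * tw p L E1 E2 E3" using tw_frame[OF E X] .
  ultimately show ?thesis using tens_\<omega>[OF V] by simp
qed

text \<open>
  Contract $L \wedge d\alpha$ with a field \<open>R\<close> that satisfies the Reeb equations:
  $i_R (L \wedge d\alpha) = L(R)\, d\alpha$, and $\alpha \wedge d\alpha$ gives $d\alpha$. So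
  $L \wedge d\alpha$ and $L(R)\, \alpha \wedge d\alpha$ have the same contraction with the
  nonzero vector \<open>R\<close>, and being of top degree they agree. In particular \<open>R\<close> is determined.
\<close>

lemma reeb_unique_formula:
  assumes E: "frame p E1 E2 E3" and R: "R \<in> BV" "\<And>Y. Y \<in> BV \<Longrightarrow> \<omega> R Y p = 0" "\<alpha> R p = 1" and L: "tens p L"
  shows "L R * tw p (\<lambda>X. \<alpha> X p) E1 E2 E3 = tw p L E1 E2 E3"
proof -
  have B: "E1 \<in> BV" "E2 \<in> BV" "E3 \<in> BV" using E by (auto simp: frame_def)
  obtain r1 r2 r3 where r: "\<forall>L. tens p L \<longrightarrow> L R = r1 * L E1 + r2 * L E2 + r3 * L E3"
    using frame_expand[OF E R(1)] .
  have e: "r1 * \<omega> E1 F p + r2 * \<omega> E2 F p + r3 * \<omega> E3 F p = 0" if "F \<in> BV" for F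
    using r tens_\<omega>[OF that] R(2)[OF that] by fastforce
  have self: "\<omega> F F p = 0" if "F \<in> BV" for F using \<omega>_antisym[OF that that, of p] by simp
  have a: "r1 * \<alpha> E1 p + r2 * \<alpha> E2 p + r3 * \<alpha> E3 p = 1"
    using r tens_\<alpha>[of p] R(3) by fastforce
  note s = self[OF B(1)] self[OF B(2)] self[OF B(3)]
  note as = \<omega>_antisym[OF B(1,2), of p] \<omega>_antisym[OF B(2,3), of p] \<omega>_antisym[OF B(3,1), of p]
  have e1: "r3 * \<omega> E3 E1 p = r2 * \<omega> E1 E2 p" using e[OF B(1)] s as by simp
  have e2: "r1 * \<omega> E1 E2 p = r3 * \<omega> E2 E3 p" using e[OF B(2)] s as by simp
  have e3: "r2 * \<omega> E2 E3 p = r1 * \<omega> E3 E1 p" using e[OF B(3)] s as by simp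
  show ?thesis
    unfolding r[rule_format, OF L] tw_def using a e1 e2 e3 by algebra
qed

end

section \<open>Coordinates adapted to the critical surface\<close>

lemma three_indices: "\<exists>i j :: 3. i \<noteq> j \<and> i \<noteq> k \<and> j \<noteq> k \<and> UNIV = {i, j, k}"
proof -
  have ne: "(1::3) \<noteq> 2" "(1::3) \<noteq> 3" "(2::3) \<noteq> 3" by simp_all
  have U: "UNIV = {2, 3, 1::3}" "UNIV = {1, 3, 2::3}" "UNIV = {1, 2, 3::3}"
    using exhaust_3 by blast+
  consider "k = 1" | "k = 2" | "k = 3" using exhaust_3 by blast
  then show ?thesis using ne ne[symmetric] U by cases metis+
qed

context manifold3 begin

lemma VF_locally_const:
  assumes "X \<in> VF" "f \<in> SF" "open W" "q \<in> W" "\<forall>q\<in>W. f q = c"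
  shows "X f q = 0"
proof -
  have "X f q = X (\<lambda>_. c) q" by (rule VF_local[OF assms(1,2) SF_const assms(3,4)]) (use assms(5) in blast)
  then show ?thesis using VF_const[OF assms(1)] by simp
qed

text \<open>
  The functions \<open>f1\<close>, \<open>f2\<close>, \<open>f3\<close> map \<open>W\<close> onto an open cube of half-width \<open>\<epsilon>\<close>, with inverse
  \<open>G\<close>. The last clause is the chain rule for functions $h \circ G$ and for fields at once:
  \<open>D1\<close>, \<open>D2\<close>, \<open>D3\<close> are the partial derivatives of \<open>h\<close>. A cube contains the coordinate lines
  and planes through its centre, and these become the level curves and surface patches used
  later.
\<close>

definition cube_chart where
  "cube_chart f1 f2 f3 p W \<epsilon> G \<longleftrightarrow> open W \<and> p \<in> W \<and> 0 < \<epsilon> \<and>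
    (\<forall>q\<in>W. \<bar>f1 q - f1 p\<bar> < \<epsilon> \<and> \<bar>f2 q - f2 p\<bar> < \<epsilon> \<and> \<bar>f3 q - f3 p\<bar> < \<epsilon> \<and> G (f1 q, f2 q, f3 q) = q) \<and>
    (\<forall>a b c. \<bar>a - f1 p\<bar> < \<epsilon> \<longrightarrow> \<bar>b - f2 p\<bar> < \<epsilon> \<longrightarrow> \<bar>c - f3 p\<bar> < \<epsilon> \<longrightarrow>
       G (a, b, c) \<in> W \<and> f1 (G (a, b, c)) = a \<and> f2 (G (a, b, c)) = b \<and> f3 (G (a, b, c)) = c \<and>
       (\<forall>h\<in>SF. \<exists>D1 D2 D3. ((\<lambda>y. h (G y)) has_derivative (\<lambda>(x, y, w). D1 * x + D2 * y + D3 * w)) (at (a, b, c)) \<and>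
          (\<forall>V\<in>VF. V h (G (a, b, c)) = D1 * V f1 (G (a, b, c)) + D2 * V f2 (G (a, b, c)) + D3 * V f3 (G (a, b, c)))))"

lemmas cube_chartD =
  cube_chart_def[THEN iffD1, THEN conjunct1]
  cube_chart_def[THEN iffD1, THEN conjunct2, THEN conjunct1]
  cube_chart_def[THEN iffD1, THEN conjunct2, THEN conjunct2, THEN conjunct1]
  cube_chart_def[THEN iffD1, THEN conjunct2, THEN conjunct2, THEN conjunct2, THEN conjunct1]
  cube_chart_def[THEN iffD1, THEN conjunct2, THEN conjunct2, THEN conjunct2, THEN conjunct2]

lemma coordinate_box:
  assumes f: "f1 \<in> SF" "f2 \<in> SF" "f3 \<in> SF" and W0: "open W0" "p \<in> W0"
    and ind: "\<forall>V\<in>VF. V f1 p = 0 \<longrightarrow> V f2 p = 0 \<longrightarrow> V f3 p = 0 \<longrightarrow> (\<forall>h\<in>SF. V h p = 0)"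
  obtains W G \<epsilon> where "cube_chart f1 f2 f3 p W \<epsilon> G" "W \<subseteq> W0"
proof -
  define f where "f = (\<lambda>i::3. if i = 1 then f1 else if i = 2 then f2 else f3)"
  have f123: "f 1 = f1" "f 2 = f2" "f 3 = f3" by (simp_all add: f_def)
  have fSF: "f i \<in> SF" for i using f by (simp add: f_def)
  have ind': "\<forall>V\<in>VF. (\<forall>i. V (f i) p = 0) \<longrightarrow> (\<forall>h\<in>SF. V h p = 0)"
    using ind f123 by metis
  obtain W1 B G1 where W1: "open W1" "p \<in> W1" "W1 \<subseteq> W0" and B: "open B" "(\<chi> i. f i p) \<in> B" "continuous_on B G1"
    and G1: "\<forall>q\<in>W1. (\<chi> i. f i q) \<in> B \<and> G1 (\<chi> i. f i q) = q"
    "\<forall>y\<in>B. G1 y \<in> W1 \<and> (\<chi> i. f i (G1 y)) = y"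
    "\<forall>y\<in>B. \<forall>h\<in>SF. \<exists>D. ((\<lambda>y. h (G1 y)) has_derivative D) (at y) \<and>
        (\<forall>V\<in>VF. D (\<chi> i. V (f i) (G1 y)) = V h (G1 y))"
    using inverse_coordinates[of f W0 p, OF fSF W0 ind'] .
  define j where "j = (\<lambda>(a, b, c). a *\<^sub>R axis 1 1 + b *\<^sub>R axis 2 1 + c *\<^sub>R axis 3 1 :: real^3)"
  have jn: "j (a, b, c) $ 1 = a" "j (a, b, c) $ 2 = b" "j (a, b, c) $ 3 = c" for a b c
    by (simp_all add: j_def axis_def)
  have jvec: "(\<chi> i. g i) = j (g 1, g 2, g 3)" for g :: "3 \<Rightarrow> real"
    by (simp add: vec_eq_iff forall_3 jn)
  have jder: "(j has_derivative j) (at y)" for y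
    unfolding j_def split_beta by (auto intro!: derivative_eq_intros)
  have jcont: "continuous_on UNIV j"
    using has_derivative_continuous[OF jder] by (auto intro: continuous_at_imp_continuous_on)
  let ?p = "(f1 p, f2 p, f3 p)"
  have "open (j -` B)" using continuous_open_preimage[OF jcont open_UNIV B(1)] by simp
  moreover have "?p \<in> j -` B" using B(2) jvec[of "\<lambda>i. f i p"] f123 by simp
  ultimately obtain d where d: "d > 0" "ball ?p d \<subseteq> j -` B" using open_contains_ball by blast
  define \<epsilon> where "\<epsilon> = d / 3"
  have \<epsilon>: "\<epsilon> > 0" using d by (simp add: \<epsilon>_def)
  have inB: "j (a, b, c) \<in> B" if "\<bar>a - f1 p\<bar> < \<epsilon>" "\<bar>b - f2 p\<bar> < \<epsilon>" "\<bar>c - f3 p\<bar> < \<epsilon>" for a b c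
  proof -
    have 1: "dist (x, y) (x', y') \<le> dist x x' + dist y y'" for x x' :: "'c::metric_space" and y y' :: "'d::metric_space"
      unfolding dist_Pair_Pair using sqrt_sum_squares_le_sum_abs[of "dist x x'" "dist y y'"] by simp
    have "dist ?p (a, b, c) \<le> dist (f1 p) a + (dist (f2 p) b + dist (f3 p) c)"
      using 1[of "f1 p" "(f2 p, f3 p)" a "(b, c)"] 1[of "f2 p" "f3 p" b c] by linarith
    also have "\<dots> = \<bar>a - f1 p\<bar> + (\<bar>b - f2 p\<bar> + \<bar>c - f3 p\<bar>)"
      by (simp add: dist_real_def abs_minus_commute)
    also have "\<dots> < d" using that by (simp add: \<epsilon>_def)
    finally have "(a, b, c) \<in> ball ?p d" by simp
    then show ?thesis using d(2) by blast
  qed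
  let ?W = "W1 \<inter> {q. \<bar>f1 q - f1 p\<bar> < \<epsilon>} \<inter> {q. \<bar>f2 q - f2 p\<bar> < \<epsilon>} \<inter> {q. \<bar>f3 q - f3 p\<bar> < \<epsilon>}"
  have op: "open {q. \<bar>g q - g p\<bar> < \<epsilon>}" if "g \<in> SF" for g
    by (intro open_Collect_less continuous_intros SF_continuous[OF that])
  have "cube_chart f1 f2 f3 p ?W \<epsilon> (\<lambda>y. G1 (j y))"
    unfolding cube_chart_def
  proof (intro conjI)
    show "open ?W" using W1(1) op f by auto
    show "p \<in> ?W" using W1 \<epsilon> by simp
    show "\<epsilon> > 0" by (rule \<epsilon>)
    show "\<forall>q\<in>?W. \<bar>f1 q - f1 p\<bar> < \<epsilon> \<and> \<bar>f2 q - f2 p\<bar> < \<epsilon> \<and> \<bar>f3 q - f3 p\<bar> < \<epsilon> \<and> G1 (j (f1 q, f2 q, f3 q)) = q"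
    proof
      fix q assume q: "q \<in> ?W"
      have "G1 (\<chi> i. f i q) = q" using G1(1) q by blast
      then have "G1 (j (f1 q, f2 q, f3 q)) = q" unfolding jvec f123 .
      then show "\<bar>f1 q - f1 p\<bar> < \<epsilon> \<and> \<bar>f2 q - f2 p\<bar> < \<epsilon> \<and> \<bar>f3 q - f3 p\<bar> < \<epsilon> \<and> G1 (j (f1 q, f2 q, f3 q)) = q"
        using q by blast
    qed
    show "\<forall>a b c. \<bar>a - f1 p\<bar> < \<epsilon> \<longrightarrow> \<bar>b - f2 p\<bar> < \<epsilon> \<longrightarrow> \<bar>c - f3 p\<bar> < \<epsilon> \<longrightarrow>
       G1 (j (a, b, c)) \<in> ?W \<and> f1 (G1 (j (a, b, c))) = a \<and> f2 (G1 (j (a, b, c))) = b \<and> f3 (G1 (j (a, b, c))) = c \<and>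
       (\<forall>h\<in>SF. \<exists>D1 D2 D3. ((\<lambda>y. h (G1 (j y))) has_derivative (\<lambda>(x, y, w). D1 * x + D2 * y + D3 * w)) (at (a, b, c)) \<and>
          (\<forall>V\<in>VF. V h (G1 (j (a, b, c))) = D1 * V f1 (G1 (j (a, b, c))) + D2 * V f2 (G1 (j (a, b, c))) + D3 * V f3 (G1 (j (a, b, c)))))"
    proof (intro allI impI)
      fix a b c assume abc: "\<bar>a - f1 p\<bar> < \<epsilon>" "\<bar>b - f2 p\<bar> < \<epsilon>" "\<bar>c - f3 p\<bar> < \<epsilon>"
      let ?y = "j (a, b, c)" let ?q = "G1 ?y"
      have y: "?y \<in> B" by (rule inB[OF abc])
      have q: "?q \<in> W1" "(\<chi> i. f i ?q) = ?y" using G1(2) y by blast+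
      have fq: "f1 ?q = a" "f2 ?q = b" "f3 ?q = c"
        using arg_cong[OF q(2), of "\<lambda>v. v $ 1"] arg_cong[OF q(2), of "\<lambda>v. v $ 2"] arg_cong[OF q(2), of "\<lambda>v. v $ 3"]
        unfolding jn by (simp_all add: f123)
      have "\<forall>h\<in>SF. \<exists>D1 D2 D3. ((\<lambda>y. h (G1 (j y))) has_derivative (\<lambda>(x, y, w). D1 * x + D2 * y + D3 * w)) (at (a, b, c)) \<and>
          (\<forall>V\<in>VF. V h ?q = D1 * V f1 ?q + D2 * V f2 ?q + D3 * V f3 ?q)"
      proof
        fix h assume h: "h \<in> SF"
        obtain D where D: "((\<lambda>y. h (G1 y)) has_derivative D) (at ?y)" "\<forall>V\<in>VF. D (\<chi> i. V (f i) ?q) = V h ?q"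
          using G1(3) y h by blast
        have lin: "linear D" using D(1) has_derivative_linear by blast
        have Dj: "D (j t) = (case t of (x, y, w) \<Rightarrow> D (axis 1 1) * x + D (axis 2 1) * y + D (axis 3 1) * w)" for t
          by (simp add: j_def split_beta linear_add[OF lin] linear_scale[OF lin] mult.commute)
        have "((\<lambda>y. h (G1 (j y))) has_derivative (\<lambda>t. D (j t))) (at (a, b, c))"
          by (rule has_derivative_compose[of j _ _ _ "\<lambda>y. h (G1 y)", OF jder D(1)])
        moreover have "V h ?q = D (axis 1 1) * V f1 ?q + D (axis 2 1) * V f2 ?q + D (axis 3 1) * V f3 ?q" if "V \<in> VF" for V
        proof -
          have "V h ?q = D (\<chi> i. V (f i) ?q)" using D(2) that by simp
          then show ?thesis unfolding jvec f123 Dj by simp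
        qed
        ultimately show "\<exists>D1 D2 D3. ((\<lambda>y. h (G1 (j y))) has_derivative (\<lambda>(x, y, w). D1 * x + D2 * y + D3 * w)) (at (a, b, c)) \<and>
          (\<forall>V\<in>VF. V h ?q = D1 * V f1 ?q + D2 * V f2 ?q + D3 * V f3 ?q)"
          unfolding Dj by blast
      qed
      then show "?q \<in> ?W \<and> f1 ?q = a \<and> f2 ?q = b \<and> f3 ?q = c \<and>
       (\<forall>h\<in>SF. \<exists>D1 D2 D3. ((\<lambda>y. h (G1 (j y))) has_derivative (\<lambda>(x, y, w). D1 * x + D2 * y + D3 * w)) (at (a, b, c)) \<and>
          (\<forall>V\<in>VF. V h ?q = D1 * V f1 ?q + D2 * V f2 ?q + D3 * V f3 ?q))"
        using q(1) fq abc by simp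
    qed
  qed
  moreover have "?W \<subseteq> W0" using W1 by blast
  ultimately show ?thesis by (rule that)
qed

end

context bm_contact begin

text \<open>
  The functions $z, x_1, x_2$ are coordinates on \<open>W\<close> with coordinate fields \<open>Y0\<close>, \<open>T1\<close>,
  \<open>T2\<close>. The fields \<open>T1\<close> and \<open>T2\<close> are tangent to the levels of \<open>z\<close> on the whole manifold,
  because they have to be $b^m$-fields; \<open>Y0 z\<close> is nonnegative everywhere so that sums of
  such fields stay transverse.
\<close>

definition adapted where
  "adapted W x1 x2 T1 T2 Y0 \<longleftrightarrow> open W \<and> x1 \<in> SF \<and> x2 \<in> SF \<and> T1 \<in> VF \<and> T2 \<in> VF \<and> Y0 \<in> VF \<and>
     (\<forall>q. T1 z q = 0 \<and> T2 z q = 0 \<and> 0 \<le> Y0 z q) \<and>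
     (\<forall>q\<in>W. Y0 z q = 1 \<and> T1 x1 q = 1 \<and> T1 x2 q = 0 \<and> T2 x1 q = 0 \<and> T2 x2 q = 1 \<and> Y0 x1 q = 0 \<and> Y0 x2 q = 0) \<and>
     (\<forall>V\<in>VF. \<forall>h\<in>SF. \<forall>q\<in>W. V h q = V x1 q * T1 h q + V x2 q * T2 h q + V z q * Y0 h q)"

text \<open>
  Since \<open>dz\<close> does not vanish at \<open>p\<close>, some coordinate field \<open>e k\<close> has \<open>e k z p \<noteq> 0\<close>. Divided
  by \<open>e k z\<close> it becomes the transverse field, and subtracting multiples of it from the other
  two makes these tangent.
\<close>

lemma adapted_exists:
  assumes "z p = 0"
  obtains W x1 x2 T1 T2 Y0 where "adapted W x1 x2 T1 T2 Y0" "p \<in> W"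
proof -
  obtain U \<phi> where c: "(U, \<phi>) \<in> A" "p \<in> U" using chart_exists .
  obtain W1 x e where W1: "open W1" "p \<in> W1" "W1 \<subseteq> U" and cd: "coordinates_on U \<phi> W1 x e"
    using coordinate_fields[OF c] .
  note xS = coordinates_onD(1)[OF cd] and e = coordinates_onD(2)[OF cd] and dx = coordinates_onD(4)[OF cd]
    and exp = coordinates_onD(5)[OF cd]
  obtain V where V: "V \<in> VF" "V z p \<noteq> 0" using defining assms unfolding defining_function_def by blast
  have "\<exists>k. e k z p \<noteq> 0"
  proof (rule ccontr)
    assume "\<nexists>k. e k z p \<noteq> 0"
    then have "V z p = 0" using exp[OF V(1) z_SF W1(2)] by simp
    then show False using V(2) by simp
  qed
  then obtain k where k: "e k z p \<noteq> 0" by blast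
  obtain i j where ij: "i \<noteq> j" "i \<noteq> k" "j \<noteq> k" "UNIV = {i, j, k}" using three_indices by blast
  have sum3: "(\<Sum>l\<in>UNIV. g l) = g i + (g j + g k)" for g :: "3 \<Rightarrow> real" unfolding ij(4) using ij(1-3) by simp
  have ez: "e l z \<in> SF" for l by (rule VF_SF[OF e z_SF])
  have o: "open (W1 \<inter> {q. e k z q \<noteq> 0})" "p \<in> W1 \<inter> {q. e k z q \<noteq> 0}"
    using W1(1,2) SF_open_nonzero[OF ez[of k]] k by auto
  obtain \<rho> W' K where \<rho>: "\<rho> \<in> SF" "\<And>q. 0 \<le> \<rho> q" "open W'" "p \<in> W'" "\<And>q. q \<in> W' \<Longrightarrow> \<rho> q = 1"
    "compact K" "K \<subseteq> W1 \<inter> {q. e k z q \<noteq> 0}" "\<And>q. q \<notin> K \<Longrightarrow> \<rho> q = 0"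
    using SF_bump[OF o] by blast
  have W'1: "W' \<subseteq> W1 \<inter> {q. e k z q \<noteq> 0}"
  proof
    fix q assume "q \<in> W'"
    then have "q \<in> K" using \<rho>(5)[of q] \<rho>(8)[of q] by fastforce
    then show "q \<in> W1 \<inter> {q. e k z q \<noteq> 0}" using \<rho>(7) by blast
  qed
  define c where "c = (\<lambda>q. \<rho> q / e k z q)"
  have c: "c \<in> SF" unfolding c_def by (rule SF_div_support[OF \<rho>(1) ez \<rho>(6,8)]) (use \<rho>(7) in auto)
  have cd: "c q * e k z q = \<rho> q" for q
    using \<rho>(7,8) by (cases "q \<in> K") (auto simp: c_def)
  define Y0 where "Y0 = comb c (e k) zerof"
  define T where "T = (\<lambda>l. comb \<rho> (e l) (comb (\<lambda>q. - (c q * e l z q)) (e k) zerof))"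
  have cl: "(\<lambda>q. - (c q * e l z q)) \<in> SF" for l by (rule SF_uminus[OF SF_mult[OF c ez]])
  have in_k: "comb (\<lambda>q. - (c q * e l z q)) (e k) zerof \<in> VF" for l by (rule comb(1)[OF cl e zerof(1)])
  have Y0: "Y0 \<in> VF" "\<And>h q. h \<in> SF \<Longrightarrow> Y0 h q = c q * e k h q"
    unfolding Y0_def using comb[OF c e zerof(1)] by (simp_all add: zerof(2))
  have T: "T l \<in> VF" "\<And>h q. h \<in> SF \<Longrightarrow> T l h q = \<rho> q * e l h q - c q * e l z q * e k h q" for l
    unfolding T_def using comb[OF \<rho>(1) e in_k] comb(2)[OF cl e zerof(1)] by (simp_all add: zerof(2))
  have "adapted W' (x i) (x j) (T i) (T j) Y0"
    unfolding adapted_def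
  proof (intro conjI allI ballI)
    show "T i z q = 0" "T j z q = 0" for q
      using cd[of q] by (simp_all add: T(2)[OF z_SF] algebra_simps)
    show "0 \<le> Y0 z q" for q using \<rho>(2) cd by (simp add: Y0(2)[OF z_SF])
    fix q assume q: "q \<in> W'"
    then have q1: "q \<in> W1" "e k z q \<noteq> 0" using W'1 by auto
    have r: "\<rho> q = 1" by (rule \<rho>(5)[OF q])
    show "Y0 z q = 1" using cd r by (simp add: Y0(2)[OF z_SF])
    note dd = dx[OF q1(1)]
    show "T i (x i) q = 1" "T i (x j) q = 0" "T j (x i) q = 0" "T j (x j) q = 1" "Y0 (x i) q = 0" "Y0 (x j) q = 0"
      using ij(1-3) by (simp_all add: T(2)[OF xS] Y0(2)[OF xS] dd r)
    fix V h assume V: "V \<in> VF" and h: "h \<in> SF"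
    have Vh: "V h q = V (x i) q * e i h q + (V (x j) q * e j h q + V (x k) q * e k h q)"
      using exp[OF V h q1(1)] unfolding sum3 .
    have Vz: "V z q = V (x i) q * e i z q + (V (x j) q * e j z q + V (x k) q * e k z q)"
      using exp[OF V z_SF q1(1)] unfolding sum3 .
    have ck: "c q * e k z q = 1" using cd r by simp
    show "V h q = V (x i) q * T i h q + V (x j) q * T j h q + V z q * Y0 h q"
      unfolding T(2)[OF h] Y0(2)[OF h] Vh Vz r using ck by algebra
  qed (rule \<rho>(3) xS T(1) Y0(1))+
  then show ?thesis using that \<rho>(4) by blast
qed

lemma adaptedD:
  assumes "adapted W x1 x2 T1 T2 Y0"
  shows "open W" "x1 \<in> SF" "x2 \<in> SF" "T1 \<in> VF" "T2 \<in> VF" "Y0 \<in> VF"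
    "\<And>q. T1 z q = 0" "\<And>q. T2 z q = 0" "\<And>q. 0 \<le> Y0 z q"
    "\<And>q. q \<in> W \<Longrightarrow> Y0 z q = 1" "\<And>q. q \<in> W \<Longrightarrow> T1 x1 q = 1" "\<And>q. q \<in> W \<Longrightarrow> T1 x2 q = 0"
    "\<And>q. q \<in> W \<Longrightarrow> T2 x1 q = 0" "\<And>q. q \<in> W \<Longrightarrow> T2 x2 q = 1" "\<And>q. q \<in> W \<Longrightarrow> Y0 x1 q = 0" "\<And>q. q \<in> W \<Longrightarrow> Y0 x2 q = 0"
    "\<And>V h q. V \<in> VF \<Longrightarrow> h \<in> SF \<Longrightarrow> q \<in> W \<Longrightarrow> V h q = V x1 q * T1 h q + V x2 q * T2 h q + V z q * Y0 h q"
  using assms unfolding adapted_def by blast+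

text \<open>The bracket of two of these fields kills $z, x_1, x_2$ on \<open>W\<close>, hence all functions.\<close>

lemma adapted_commute:
  assumes a: "adapted W x1 x2 T1 T2 Y0" and q: "q \<in> W" and h: "h \<in> SF"
  shows "T1 (T2 h) q = T2 (T1 h) q" "Y0 (T1 h) q = T1 (Y0 h) q" "Y0 (T2 h) q = T2 (Y0 h) q"
proof -
  note ad = adaptedD[OF a]
  have key: "X (X' h) q = X' (X h) q"
    if X: "X \<in> VF" "X' \<in> VF"
      and k: "\<And>f. f \<in> {x1, x2, z} \<Longrightarrow> \<exists>k. \<forall>q\<in>W. X f q = k" "\<And>f. f \<in> {x1, x2, z} \<Longrightarrow> \<exists>k. \<forall>q\<in>W. X' f q = k" for X X'
  proof -
    have f0: "lie_bracket A X X' f q = 0" if f: "f \<in> {x1, x2, z}" for f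
    proof -
      have fS: "f \<in> SF" using f ad(2,3) z_SF by blast
      obtain k1 where "\<forall>q\<in>W. X f q = k1" using k(1)[OF f] by blast
      then have "X' (X f) q = 0" using VF_locally_const[OF X(2) VF_SF[OF X(1) fS] ad(1) q] by blast
      moreover obtain k2 where "\<forall>q\<in>W. X' f q = k2" using k(2)[OF f] by blast
      then have "X (X' f) q = 0" using VF_locally_const[OF X(1) VF_SF[OF X(2) fS] ad(1) q] by blast
      ultimately show ?thesis using lie_bracket(2)[OF X fS] by simp
    qed
    have "lie_bracket A X X' h q = 0"
      using ad(17)[OF lie_bracket(1)[OF X] h q] f0 by simp
    then show ?thesis using lie_bracket(2)[OF X h] by simp
  qed
  have c1: "\<exists>k. \<forall>q\<in>W. T1 f q = k" and c2: "\<exists>k. \<forall>q\<in>W. T2 f q = k" and c0: "\<exists>k. \<forall>q\<in>W. Y0 f q = k"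
    if "f \<in> {x1, x2, z}" for f using that ad(7-16) by auto
  show "T1 (T2 h) q = T2 (T1 h) q" by (rule key[OF ad(4,5) c1 c2])
  show "Y0 (T1 h) q = T1 (Y0 h) q" by (rule key[OF ad(6,4) c0 c1])
  show "Y0 (T2 h) q = T2 (Y0 h) q" by (rule key[OF ad(6,5) c0 c2])
qed

lemma BV_tangent: "T \<in> VF \<Longrightarrow> (\<And>q. T z q = 0) \<Longrightarrow> T \<in> BV"
  by (rule BV_I[of _ "\<lambda>p. 0"]) (simp_all add: SF_const)

definition normal :: "'a vfield \<Rightarrow> 'a vfield" where "normal Y = comb (\<lambda>p. z p ^ m) Y zerof"

lemma normal:
  assumes "Y \<in> VF"
  shows "normal Y \<in> BV" "h \<in> SF \<Longrightarrow> normal Y h p = z p ^ m * Y h p"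
proof -
  show e: "normal Y h p = z p ^ m * Y h p" if "h \<in> SF" for h p
    unfolding normal_def using comb(2)[OF SF_power[OF z_SF] assms zerof(1) that] by (simp add: zerof(2)[OF that])
  have "normal Y \<in> VF" unfolding normal_def by (rule comb(1)[OF SF_power[OF z_SF] assms zerof(1)])
  then show "normal Y \<in> BV" by (rule BV_I[OF _ VF_SF[OF assms z_SF]]) (rule e[OF z_SF])
qed

text \<open>
  For a $b^m$-field the component \<open>V z\<close> is divisible by \<open>z ^ m\<close>, and the quotient is the
  component along \<open>normal Y0\<close>.
\<close>

lemma adapted_frame:
  assumes a: "adapted W x1 x2 T1 T2 Y0" and q: "p \<in> W"
  shows "frame p T1 T2 (normal Y0)"
proof -
  note ad = adaptedD[OF a]
  show ?thesis unfolding frame_def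
  proof (intro conjI ballI)
    fix X assume X: "X \<in> BV"
    then obtain g where g: "g \<in> SF" "X z = (\<lambda>p. z p ^ m * g p)" using BV_D by blast
    note v = BV_VF[OF X]
    have "\<forall>f\<in>SF. \<forall>q\<in>W. X f q = X x1 q * T1 f q + X x2 q * T2 f q + g q * normal Y0 f q"
      using ad(17)[OF v] g(2) normal(2)[OF ad(6)] by (simp add: algebra_simps)
    then show "\<exists>W c1 c2 c3. open W \<and> p \<in> W \<and> c1 \<in> SF \<and> c2 \<in> SF \<and> c3 \<in> SF \<and>
        (\<forall>f\<in>SF. \<forall>q\<in>W. X f q = c1 q * T1 f q + c2 q * T2 f q + c3 q * normal Y0 f q)"
      using ad(1) q VF_SF[OF v ad(2)] VF_SF[OF v ad(3)] g(1) by blast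
  qed (rule BV_tangent[OF ad(4,7)] BV_tangent[OF ad(5,8)] normal(1)[OF ad(6)])+
qed

text \<open>
  Away from \<open>Z\<close> the coordinate fields, cut off so that \<open>z ^ m\<close> can be divided out, form a
  frame.
\<close>

lemma frames_exist: "\<exists>E1 E2 E3. frame p E1 E2 E3"
proof (cases "z p = 0")
  case True
  obtain W x1 x2 T1 T2 Y0 where "adapted W x1 x2 T1 T2 Y0" "p \<in> W" using adapted_exists[OF True] .
  then show ?thesis using adapted_frame by blast
next
  case False
  obtain U \<phi> where c: "(U, \<phi>) \<in> A" "p \<in> U" using chart_exists .
  obtain W1 x e where W1: "open W1" "p \<in> W1" "W1 \<subseteq> U" and cd: "coordinates_on U \<phi> W1 x e"
    using coordinate_fields[OF c] .
  note xS = coordinates_onD(1)[OF cd] and e = coordinates_onD(2)[OF cd] and dx = coordinates_onD(4)[OF cd]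
    and exp = coordinates_onD(5)[OF cd]
  have o: "open (W1 \<inter> {q. z q \<noteq> 0})" "p \<in> W1 \<inter> {q. z q \<noteq> 0}"
    using W1(1,2) SF_open_nonzero[OF z_SF] False by auto
  obtain \<rho> W' K where \<rho>: "\<rho> \<in> SF" "\<And>q. 0 \<le> \<rho> q" "open W'" "p \<in> W'" "\<And>q. q \<in> W' \<Longrightarrow> \<rho> q = 1"
    "compact K" "K \<subseteq> W1 \<inter> {q. z q \<noteq> 0}" "\<And>q. q \<notin> K \<Longrightarrow> \<rho> q = 0"
    using SF_bump[OF o] by blast
  define E where "E = (\<lambda>l. comb \<rho> (e l) zerof)"
  have E: "E l \<in> VF" "\<And>h q. h \<in> SF \<Longrightarrow> E l h q = \<rho> q * e l h q" for l
    unfolding E_def using comb[OF \<rho>(1) e zerof(1)] by (simp_all add: zerof(2))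
  have EB: "E l \<in> BV" for l
  proof (rule BV_I[OF E(1)])
    show "(\<lambda>q. \<rho> q * e l z q / z q ^ m) \<in> SF"
      by (rule SF_div_support[OF SF_mult[OF \<rho>(1) VF_SF[OF e z_SF]] SF_power[OF z_SF] \<rho>(6)])
         (use \<rho>(7,8) in auto)
    show "E l z q = z q ^ m * (\<rho> q * e l z q / z q ^ m)" for q
      using \<rho>(7,8) by (cases "q \<in> K") (auto simp: E(2)[OF z_SF])
  qed
  have "frame p (E 1) (E 2) (E 3)" unfolding frame_def
  proof (intro conjI ballI EB)
    fix X assume X: "X \<in> BV"
    note v = BV_VF[OF X]
    have "X f q = X (x 1) q * E 1 f q + X (x 2) q * E 2 f q + X (x 3) q * E 3 f q"
      if f: "f \<in> SF" and q: "q \<in> W' \<inter> W1" for f q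
      using exp[OF v f, of q] q \<rho>(5)[of q] unfolding E(2)[OF f] by (simp add: sum_3)
    then show "\<exists>W c1 c2 c3. open W \<and> p \<in> W \<and> c1 \<in> SF \<and> c2 \<in> SF \<and> c3 \<in> SF \<and>
        (\<forall>f\<in>SF. \<forall>q\<in>W. X f q = c1 q * E 1 f q + c2 q * E 2 f q + c3 q * E 3 f q)"
      using \<rho>(3,4) W1(1,2) VF_SF[OF v xS]
      by (intro exI[of _ "W' \<inter> W1"] exI[of _ "X (x 1)"] exI[of _ "X (x 2)"] exI[of _ "X (x 3)"]) auto
  qed
  then show ?thesis by blast
qed

subsection \<open>The Reeb field\<close>

text \<open>The one-form usually written $dz/z^m$.\<close>

definition zeta :: "'a vfield \<Rightarrow> 'a \<Rightarrow> real" where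
  "zeta X = (SOME g. g \<in> SF \<and> X z = (\<lambda>p. z p ^ m * g p))"

lemma zeta: assumes "X \<in> BV" shows "zeta X \<in> SF" "X z p = z p ^ m * zeta X p"
proof -
  have "\<exists>g. g \<in> SF \<and> X z = (\<lambda>p. z p ^ m * g p)" using BV_D[OF assms] by blast
  from someI_ex[OF this] show "zeta X \<in> SF" "X z p = z p ^ m * zeta X p"
    unfolding zeta_def by (blast, metis)
qed

text \<open>
  The zero set of \<open>z\<close> has no interior point: where \<open>z\<close> is locally zero, so is \<open>X z\<close> for
  every field.
\<close>

lemma z_factor_unique:
  assumes "g \<in> SF" "h \<in> SF" "\<And>p. z p ^ m * g p = z p ^ m * h p"
  shows "g p = h p"
proof (rule ccontr)
  assume ne: "g p \<noteq> h p"
  let ?W = "{q. g q - h q \<noteq> 0}"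
  have W: "open ?W" "p \<in> ?W" using SF_open_nonzero[OF SF_diff[OF assms(1,2)]] ne by auto
  have zz: "z q = 0" if "q \<in> ?W" for q using assms(3)[of q] that by auto
  then have "z p = 0" using W(2) by blast
  then obtain X where X: "X \<in> VF" "X z p \<noteq> 0" using defining unfolding defining_function_def by blast
  have "X z p = X (\<lambda>p. 0) p" by (rule VF_local[OF X(1) z_SF SF_const W]) (rule zz)
  then show False using X VF_zero[OF X(1)] by simp
qed

lemma tens_zeta: "tens p (\<lambda>X. zeta X p)"
proof (rule tens_I)
  fix f X Y assume *: "f \<in> SF" "X \<in> BV" "Y \<in> BV"
  show "zeta (comb f X Y) p = f p * zeta X p + zeta Y p"
  proof (rule z_factor_unique[OF zeta(1)[OF BV_comb[OF *]] SF_add[OF SF_mult[OF *(1) zeta(1)[OF *(2)]] zeta(1)[OF *(3)]]])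
    fix q
    show "z q ^ m * zeta (comb f X Y) q = z q ^ m * (f q * zeta X q + zeta Y q)"
      unfolding zeta(2)[OF BV_comb[OF *], symmetric] comb(2)[OF *(1) BV_VF[OF *(2)] BV_VF[OF *(3)] z_SF]
        zeta(2)[OF *(2)] zeta(2)[OF *(3)] by (simp add: distrib_left mult.left_commute)
  qed
qed

text \<open>
  Any triple on which $\alpha \wedge d\alpha$ is nonzero at \<open>p\<close> computes the Reeb field at
  \<open>p\<close>. The choice may depend on \<open>p\<close> in an arbitrary way.
\<close>

definition contact_triple :: "'a \<Rightarrow> 'a vfield \<times> 'a vfield \<times> 'a vfield" where
  "contact_triple p = (SOME (X, Y, W). X \<in> BV \<and> Y \<in> BV \<and> W \<in> BV \<and> tw p (\<lambda>X. \<alpha> X p) X Y W \<noteq> 0)"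

definition reeb_value :: "'a \<Rightarrow> ('a vfield \<Rightarrow> real) \<Rightarrow> real" where
  "reeb_value p L = (case contact_triple p of (X, Y, W) \<Rightarrow> tw p L X Y W / tw p (\<lambda>X. \<alpha> X p) X Y W)"

lemma reeb_value_obtain:
  obtains X Y W where "X \<in> BV" "Y \<in> BV" "W \<in> BV" "tw p (\<lambda>X. \<alpha> X p) X Y W \<noteq> 0"
    "\<forall>L. reeb_value p L = tw p L X Y W / tw p (\<lambda>X. \<alpha> X p) X Y W"
proof -
  have "\<exists>t. case t of (X, Y, W) \<Rightarrow> X \<in> BV \<and> Y \<in> BV \<and> W \<in> BV \<and> tw p (\<lambda>X. \<alpha> X p) X Y W \<noteq> 0"
    using contact_tw[of p] by auto
  from someI_ex[OF this] obtain X Y W where "contact_triple p = (X, Y, W)" "X \<in> BV" "Y \<in> BV" "W \<in> BV"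
    "tw p (\<lambda>X. \<alpha> X p) X Y W \<noteq> 0"
    unfolding contact_triple_def[symmetric] by (auto split: prod.splits)
  then show ?thesis using that unfolding reeb_value_def by simp
qed

lemma reeb_value_eq:
  assumes "tens p L" "X \<in> BV" "Y \<in> BV" "W \<in> BV" "tw p (\<lambda>X. \<alpha> X p) X Y W \<noteq> 0"
  shows "reeb_value p L = tw p L X Y W / tw p (\<lambda>X. \<alpha> X p) X Y W"
proof -
  obtain X' Y' W' where *: "X' \<in> BV" "Y' \<in> BV" "W' \<in> BV" "tw p (\<lambda>X. \<alpha> X p) X' Y' W' \<noteq> 0"
    "\<forall>L. reeb_value p L = tw p L X' Y' W' / tw p (\<lambda>X. \<alpha> X p) X' Y' W'" using reeb_value_obtain .
  obtain E1 E2 E3 where E: "frame p E1 E2 E3" using frames_exist by blast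
  have "tw p L X' Y' W' * tw p (\<lambda>X. \<alpha> X p) X Y W = tw p L X Y W * tw p (\<lambda>X. \<alpha> X p) X' Y' W'"
    by (rule tw_proportional[OF E assms(1) tens_\<alpha> *(1-3) assms(2-4)])
  then show ?thesis using *(4,5) assms(5) by (simp add: frac_eq_eq)
qed

lemma tw_SF:
  assumes "X \<in> BV" "Y \<in> BV" "W \<in> BV" "F X \<in> SF" "F Y \<in> SF" "F W \<in> SF"
  shows "(\<lambda>p. tw p (\<lambda>X. F X p) X Y W) \<in> SF"
  unfolding tw_def
  by (rule SF_add[OF SF_add[OF SF_mult[OF assms(4) \<omega>_SF[OF assms(2,3)]] SF_mult[OF assms(5) \<omega>_SF[OF assms(3,1)]]]
      SF_mult[OF assms(6) \<omega>_SF[OF assms(1,2)]]])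

text \<open>
  The triple chosen at one point may be used at all nearby points, where it gives a quotient
  of smooth functions.
\<close>

lemma reeb_value_SF:
  assumes "\<And>X. X \<in> BV \<Longrightarrow> F X \<in> SF" "\<And>p. tens p (\<lambda>X. F X p)"
  shows "(\<lambda>p. reeb_value p (\<lambda>X. F X p)) \<in> SF"
proof (rule SF_local)
  fix p
  obtain X Y W where *: "X \<in> BV" "Y \<in> BV" "W \<in> BV" "tw p (\<lambda>X. \<alpha> X p) X Y W \<noteq> 0"
    using contact_tw by blast
  let ?n = "\<lambda>p. tw p (\<lambda>X. F X p) X Y W" and ?d = "\<lambda>p. tw p (\<lambda>X. \<alpha> X p) X Y W"
  have n: "?n \<in> SF" and d: "?d \<in> SF"
    by (rule tw_SF[of X Y W F, OF *(1-3) assms(1)[OF *(1)] assms(1)[OF *(2)] assms(1)[OF *(3)]],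
        rule tw_SF[of X Y W \<alpha>, OF *(1-3) \<alpha>_SF[OF *(1)] \<alpha>_SF[OF *(2)] \<alpha>_SF[OF *(3)]])
  obtain g W' where g: "g \<in> SF" "open W'" "p \<in> W'" "\<forall>q\<in>W'. ?d q \<noteq> 0 \<and> g q = ?n q / ?d q"
    using SF_local_div[of ?n ?d p, OF n d *(4)] .
  have "\<forall>q\<in>W'. reeb_value q (\<lambda>X. F X q) = g q"
  proof
    fix q assume q: "q \<in> W'"
    have "reeb_value q (\<lambda>X. F X q) = ?n q / ?d q"
      by (rule reeb_value_eq[OF assms(2) *(1-3)]) (use g(4) q in blast)
    then show "reeb_value q (\<lambda>X. F X q) = g q" using g(4) q by simp
  qed
  then show "\<exists>W. open W \<and> p \<in> W \<and> (\<exists>g\<in>SF. \<forall>q\<in>W. reeb_value q (\<lambda>X. F X q) = g q)"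
    using g(1-3) by (intro exI[of _ W'] conjI bexI[of _ g])
qed

definition Reeb :: "'a vfield" where
  "Reeb = (\<lambda>f\<in>SF. \<lambda>p. reeb_value p (\<lambda>X. X f p))"

lemma Reeb_apply: "f \<in> SF \<Longrightarrow> Reeb f p = reeb_value p (\<lambda>X. X f p)"
  by (simp add: Reeb_def)

lemma Reeb_VF: "Reeb \<in> VF"
  unfolding Reeb_def
proof (rule VF_I)
  show "(\<lambda>p. reeb_value p (\<lambda>X. X f p)) \<in> SF" if "f \<in> SF" for f
  proof (rule reeb_value_SF[of "\<lambda>X. X f"])
    show "X f \<in> SF" if "X \<in> BV" for X by (rule VF_SF[OF BV_VF[OF that] \<open>f \<in> SF\<close>])
    show "tens p (\<lambda>X. X f p)" for p by (rule tens_apply[OF that])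
  qed
next
  fix c f g p assume fg: "f \<in> SF" "g \<in> SF"
  obtain X Y W where *: "X \<in> BV" "Y \<in> BV" "W \<in> BV" "tw p (\<lambda>X. \<alpha> X p) X Y W \<noteq> 0"
    "\<forall>L. reeb_value p L = tw p L X Y W / tw p (\<lambda>X. \<alpha> X p) X Y W" using reeb_value_obtain .
  have v: "X \<in> VF" "Y \<in> VF" "W \<in> VF" using * BV_VF by auto
  let ?d = "tw p (\<lambda>X. \<alpha> X p) X Y W"
  have "tw p (\<lambda>X. X (\<lambda>p. c * f p + g p) p) X Y W = c * tw p (\<lambda>X. X f p) X Y W + tw p (\<lambda>X. X g p) X Y W"
    unfolding tw_def VF_lin[OF v(1) fg] VF_lin[OF v(2) fg] VF_lin[OF v(3) fg] by algebra
  then show "reeb_value p (\<lambda>X. X (\<lambda>p. c * f p + g p) p) = c * reeb_value p (\<lambda>X. X f p) + reeb_value p (\<lambda>X. X g p)"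
    using *(5) by (simp add: add_divide_distrib)
  have "tw p (\<lambda>X. X (\<lambda>p. f p * g p) p) X Y W = f p * tw p (\<lambda>X. X g p) X Y W + g p * tw p (\<lambda>X. X f p) X Y W"
    unfolding tw_def VF_mult[OF v(1) fg] VF_mult[OF v(2) fg] VF_mult[OF v(3) fg] by algebra
  then show "reeb_value p (\<lambda>X. X (\<lambda>p. f p * g p) p) = f p * reeb_value p (\<lambda>X. X g p) + g p * reeb_value p (\<lambda>X. X f p)"
    using *(5) by (simp add: add_divide_distrib)
qed

lemma Reeb_BV: "Reeb \<in> BV"
proof (rule BV_I[OF Reeb_VF reeb_value_SF[of zeta, OF zeta(1) tens_zeta]])
  fix p
  obtain X Y W where *: "X \<in> BV" "Y \<in> BV" "W \<in> BV" "tw p (\<lambda>X. \<alpha> X p) X Y W \<noteq> 0"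
    "\<forall>L. reeb_value p L = tw p L X Y W / tw p (\<lambda>X. \<alpha> X p) X Y W" using reeb_value_obtain .
  have "tw p (\<lambda>X. X z p) X Y W = z p ^ m * tw p (\<lambda>X. zeta X p) X Y W"
    unfolding tw_def zeta(2)[OF *(1)] zeta(2)[OF *(2)] zeta(2)[OF *(3)] by algebra
  then show "Reeb z p = z p ^ m * reeb_value p (\<lambda>X. zeta X p)"
    using *(5) by (simp add: Reeb_apply[OF z_SF])
qed

text \<open>
  By definition the Reeb field acts on functions through \<open>reeb_value\<close>. That the same formula
  holds for all tensorial functionals follows by writing \<open>Reeb\<close> near \<open>p\<close> as a combination of
  a triple, whose coefficients are the values of $d\alpha$ on pairs divided by that of
  $\alpha \wedge d\alpha$.
\<close>

lemma Reeb_tens: assumes L: "tens p L" shows "L Reeb = reeb_value p L"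
proof -
  obtain X Y W where *: "X \<in> BV" "Y \<in> BV" "W \<in> BV" "tw p (\<lambda>X. \<alpha> X p) X Y W \<noteq> 0"
    using contact_tw by blast
  let ?d = "\<lambda>p. tw p (\<lambda>X. \<alpha> X p) X Y W"
  have d: "?d \<in> SF" by (rule tw_SF[of X Y W \<alpha>, OF *(1-3) \<alpha>_SF[OF *(1)] \<alpha>_SF[OF *(2)] \<alpha>_SF[OF *(3)]])
  obtain c1 W1 where 1: "c1 \<in> SF" "open W1" "p \<in> W1" "\<forall>q\<in>W1. ?d q \<noteq> 0 \<and> c1 q = \<omega> Y W q / ?d q"
    using SF_local_div[of "\<omega> Y W" ?d p, OF \<omega>_SF[OF *(2,3)] d *(4)] .
  obtain c2 W2 where 2: "c2 \<in> SF" "open W2" "p \<in> W2" "\<forall>q\<in>W2. ?d q \<noteq> 0 \<and> c2 q = \<omega> W X q / ?d q"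
    using SF_local_div[of "\<omega> W X" ?d p, OF \<omega>_SF[OF *(3,1)] d *(4)] .
  obtain c3 W3 where 3: "c3 \<in> SF" "open W3" "p \<in> W3" "\<forall>q\<in>W3. ?d q \<noteq> 0 \<and> c3 q = \<omega> X Y q / ?d q"
    using SF_local_div[of "\<omega> X Y" ?d p, OF \<omega>_SF[OF *(1,2)] d *(4)] .
  have o: "open (W1 \<inter> W2 \<inter> W3)" "p \<in> W1 \<inter> W2 \<inter> W3" using 1 2 3 by auto
  have "L Reeb = c1 p * L X + c2 p * L Y + c3 p * L W"
  proof (rule tens_combination[OF L Reeb_BV *(1-3) 1(1) 2(1) 3(1) o], intro ballI)
    fix f q assume f: "f \<in> SF" and q: "q \<in> W1 \<inter> W2 \<inter> W3"
    have "Reeb f q = tw q (\<lambda>X. X f q) X Y W / ?d q"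
      unfolding Reeb_apply[OF f] by (rule reeb_value_eq[OF tens_apply[OF f] *(1-3)]) (use 1(4) q in blast)
    then show "Reeb f q = c1 q * X f q + c2 q * Y f q + c3 q * W f q"
      using 1(4) 2(4) 3(4) q by (simp add: tw_def add_divide_distrib mult.commute)
  qed
  also have "\<dots> = tw p L X Y W / ?d p"
    using 1(3,4) 2(3,4) 3(3,4) by (simp add: tw_def add_divide_distrib mult.commute)
  also have "\<dots> = reeb_value p L" by (rule reeb_value_eq[OF L *, symmetric])
  finally show ?thesis .
qed

lemma Reeb_\<alpha>: "\<alpha> Reeb p = 1"
proof -
  obtain X Y W where *: "X \<in> BV" "Y \<in> BV" "W \<in> BV" "tw p (\<lambda>X. \<alpha> X p) X Y W \<noteq> 0"
    using contact_tw by blast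
  show ?thesis using Reeb_tens[OF tens_\<alpha>[of p]] reeb_value_eq[OF tens_\<alpha> *] *(4) by simp
qed

lemma Reeb_\<omega>: assumes "V \<in> BV" shows "\<omega> Reeb V p = 0"
proof -
  obtain X Y W where *: "X \<in> BV" "Y \<in> BV" "W \<in> BV" "tw p (\<lambda>X. \<alpha> X p) X Y W \<noteq> 0"
    using contact_tw by blast
  obtain E1 E2 E3 where E: "frame p E1 E2 E3" using frames_exist by blast
  show ?thesis
    using Reeb_tens[OF tens_\<omega>[OF assms, of p]] reeb_value_eq[OF tens_\<omega>[OF assms] *]
      \<omega>_tw_zero[OF E *(1-3) assms] by simp
qed

lemma reeb_field_eq: "reeb_field A z m \<alpha> = Reeb"
  unfolding reeb_field_def
proof (rule the_equality)
  show "Reeb \<in> BV \<and> (\<forall>Y\<in>BV. \<omega> Reeb Y = (\<lambda>p. 0)) \<and> \<alpha> Reeb = (\<lambda>p. 1)"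
    by (simp add: Reeb_BV Reeb_\<alpha> Reeb_\<omega> fun_eq_iff)
next
  fix R assume R: "R \<in> BV \<and> (\<forall>Y\<in>BV. \<omega> R Y = (\<lambda>p. 0)) \<and> \<alpha> R = (\<lambda>p. 1)"
  show "R = Reeb"
  proof (rule VF_eqI)
    fix f p assume f: "f \<in> SF"
    obtain E1 E2 E3 where E: "frame p E1 E2 E3" using frames_exist by blast
    have "R f p * tw p (\<lambda>X. \<alpha> X p) E1 E2 E3 = tw p (\<lambda>X. X f p) E1 E2 E3"
      by (rule reeb_unique_formula[OF E _ _ _ tens_apply[OF f]]) (use R in simp_all)
    moreover have "Reeb f p * tw p (\<lambda>X. \<alpha> X p) E1 E2 E3 = tw p (\<lambda>X. X f p) E1 E2 E3"
      by (rule reeb_unique_formula[OF E Reeb_BV Reeb_\<omega> Reeb_\<alpha> tens_apply[OF f]])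
    ultimately show "R f p = Reeb f p" using frame_tw_nonzero[OF E] by (metis mult_right_cancel)
  qed (use R BV_VF Reeb_VF in auto)
qed

end

section \<open>The Reeb field on the critical surface is Hamiltonian\<close>

locale bm_contact_closed = bm_contact +
  assumes compact_Z: "compact (critical_set z)"
begin

abbreviation "Z \<equiv> critical_set z"

lemma Z_iff: "p \<in> Z \<longleftrightarrow> z p = 0" by (simp add: critical_set_def)

text \<open>
  Local transverse fields $Y_p$ are added with the common weight $1/(s + z^2)$, where
  $s = \sum_p Y_p z$. The term $z^2$ keeps the denominator positive away from \<open>Z\<close>, at the
  cost of an error in \<open>Y z = 1\<close>. The error is of second order on \<open>Z\<close>: it and its first
  derivatives vanish there, which is all that is needed.
\<close>

lemma transverse_field_exists: "\<exists>Y. Y \<in> VF \<and> (\<exists>r\<in>SF. \<forall>q. Y z q = 1 - (z q)\<^sup>2 * r q)"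
proof -
  have "\<forall>p\<in>Z. \<exists>W Y0. open W \<and> p \<in> W \<and> Y0 \<in> VF \<and> (\<forall>q. 0 \<le> Y0 z q) \<and> (\<forall>q\<in>W. Y0 z q = 1)"
  proof
    fix p assume "p \<in> Z"
    then obtain W x1 x2 T1 T2 Y0 where a: "adapted W x1 x2 T1 T2 Y0" "p \<in> W"
      using adapted_exists Z_iff by blast
    show "\<exists>W Y0. open W \<and> p \<in> W \<and> Y0 \<in> VF \<and> (\<forall>q. 0 \<le> Y0 z q) \<and> (\<forall>q\<in>W. Y0 z q = 1)"
      using adaptedD(1,6,9,10)[OF a(1)] a(2) by blast
  qed
  then obtain W Y where WY: "\<And>p. p \<in> Z \<Longrightarrow> open (W p) \<and> p \<in> W p \<and> Y p \<in> VF \<and> (\<forall>q. 0 \<le> Y p z q) \<and> (\<forall>q\<in>W p. Y p z q = 1)"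
    by metis
  obtain C where C: "C \<subseteq> Z" "finite C" "Z \<subseteq> (\<Union>p\<in>C. W p)"
    using compactE_image[OF compact_Z, of Z W] WY by blast
  define s where "s = (\<lambda>q. \<Sum>p\<in>C. Y p z q)"
  have sS: "s \<in> SF" unfolding s_def by (rule SF_sum[OF C(2)]) (use WY C(1) VF_SF z_SF in blast)
  have s0: "0 \<le> s q" for q unfolding s_def by (rule sum_nonneg) (use WY C(1) in blast)
  have pos: "s q + (z q)\<^sup>2 \<noteq> 0" for q
  proof (cases "q \<in> Z")
    case True
    then obtain p where p: "p \<in> C" "q \<in> W p" using C(3) by blast
    have "Y p z q \<le> s q" unfolding s_def
      by (rule member_le_sum[OF p(1) _ C(2)]) (use WY C(1) in blast)
    then have "1 \<le> s q" using WY p C(1) by (metis subsetD)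
    then show ?thesis by (smt (verit) zero_le_power2)
  next
    case False
    then have "0 < (z q)\<^sup>2" by (simp add: Z_iff)
    then show ?thesis using s0[of q] by linarith
  qed
  let ?r = "\<lambda>q. inverse (s q + (z q)\<^sup>2)"
  have r: "?r \<in> SF" by (rule SF_inverse[OF SF_add[OF sS SF_power[OF z_SF]] pos])
  let ?Y = "\<lambda>h\<in>SF. \<lambda>q. \<Sum>p\<in>C. ?r q * Y p h q"
  have "?Y \<in> VF" by (rule VF_lincomb[OF C(2) r]) (use WY C(1) in blast)
  moreover have "?Y z q = 1 - (z q)\<^sup>2 * ?r q" for q
  proof -
    have "?Y z q = (\<Sum>p\<in>C. ?r q * Y p z q)" by (rule fun_cong[OF restrict_apply'[OF z_SF]])
    also have "\<dots> = ?r q * (\<Sum>p\<in>C. Y p z q)" by (rule sum_distrib_left[symmetric])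
    also have "(\<Sum>p\<in>C. Y p z q) = s q" by (simp add: s_def)
    finally have "?Y z q = ?r q * s q" .
    then show ?thesis using pos[of q] by (simp add: field_simps)
  qed
  ultimately show ?thesis using r
    by (intro exI[of _ ?Y] conjI bexI[of _ ?r] allI)
qed

definition transverse :: "'a vfield" where
  "transverse = (SOME Y. Y \<in> VF \<and> (\<exists>r\<in>SF. \<forall>q. Y z q = 1 - (z q)\<^sup>2 * r q))"

lemma transverse: "transverse \<in> VF" "\<exists>r\<in>SF. \<forall>q. transverse z q = 1 - (z q)\<^sup>2 * r q"
  using someI_ex[OF transverse_field_exists] unfolding transverse_def by blast+

text \<open>
  The coefficient of $dz/z^m$ in \<open>\<alpha>\<close> along \<open>Z\<close>, for a transverse field chosen once and for
  all, so that it is a global function. On \<open>Z\<close> the transverse field of any adapted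
  coordinates gives the same value (\<open>u_on_Z\<close>).
\<close>

definition u :: "'a \<Rightarrow> real" where "u = \<alpha> (normal transverse)"

lemma u_SF: "u \<in> SF" unfolding u_def by (rule \<alpha>_SF[OF normal(1)[OF transverse(1)]])

lemma tangent_power: "T \<in> VF \<Longrightarrow> T z q = 0 \<Longrightarrow> T (\<lambda>p. z p ^ n) q = 0"
  using VF_power[of T z n q] z_SF by simp

lemma normal_flat: "Y \<in> VF \<Longrightarrow> h \<in> SF \<Longrightarrow> z q = 0 \<Longrightarrow> normal Y h q = 0"
  using normal(2) m_pos by simp

lemma \<alpha>_locally_zero:
  assumes "X \<in> BV" "open W" "q \<in> W" "\<And>h q. h \<in> SF \<Longrightarrow> q \<in> W \<Longrightarrow> X h q = 0"
  shows "\<alpha> X q = 0"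
proof -
  have "\<alpha> X q = \<alpha> zerof q"
    by (rule tens_local[OF tens_\<alpha> assms(1) BV_zerof assms(2,3)]) (use assms(4) zerof(2) in simp)
  then show ?thesis using tens_zerof[OF tens_\<alpha>] by simp
qed

text \<open>
  The fields \<open>normal transverse\<close> and \<open>normal Y0\<close> differ by \<open>z ^ m\<close> times tangent fields, and
  by a multiple of \<open>normal Y0\<close> with factor of order \<open>z\<^sup>2\<close>. Both contributions vanish on \<open>Z\<close>
  with their tangential derivatives.
\<close>

lemma u_on_Z:
  assumes a: "adapted W x1 x2 T1 T2 Y0" and q: "q \<in> W" "z q = 0"
  shows "u q = \<alpha> (normal Y0) q" "T \<in> VF \<Longrightarrow> (\<And>q. T z q = 0) \<Longrightarrow> T u q = T (\<alpha> (normal Y0)) q"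
proof -
  note ad = adaptedD[OF a] and Y = transverse(1)
  obtain r where r: "r \<in> SF" "\<forall>q. transverse z q = 1 - (z q)\<^sup>2 * r q" using transverse(2) by blast
  have B: "T1 \<in> BV" "T2 \<in> BV" "normal Y0 \<in> BV"
    using BV_tangent[OF ad(4,7)] BV_tangent[OF ad(5,8)] normal(1)[OF ad(6)] by auto
  let ?n = "\<alpha> (normal Y0)"
  let ?k = "\<lambda>q. transverse x1 q * \<alpha> T1 q + transverse x2 q * \<alpha> T2 q"
  have nS: "?n \<in> SF" by (rule \<alpha>_SF[OF B(3)])
  have x: "transverse x1 \<in> SF" "transverse x2 \<in> SF" by (rule VF_SF[OF Y ad(2)], rule VF_SF[OF Y ad(3)])
  have k: "?k \<in> SF" by (rule SF_add[OF SF_mult[OF x(1) \<alpha>_SF[OF B(1)]] SF_mult[OF x(2) \<alpha>_SF[OF B(2)]]])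
  have c1: "(\<lambda>q. z q ^ m * transverse x1 q) \<in> SF" and c2: "(\<lambda>q. z q ^ m * transverse x2 q) \<in> SF"
    by (rule SF_mult[OF SF_power[OF z_SF] x(1)], rule SF_mult[OF SF_power[OF z_SF] x(2)])
  have c0: "(\<lambda>q. 1 - (z q)\<^sup>2 * r q) \<in> SF" by (rule SF_diff[OF SF_const SF_mult[OF SF_power[OF z_SF] r(1)]])
  have u: "u p = (1 - (z p)\<^sup>2 * r p) * ?n p + z p ^ m * ?k p" if "p \<in> W" for p
  proof -
    have "\<alpha> (normal transverse) p = z p ^ m * transverse x1 p * \<alpha> T1 p + z p ^ m * transverse x2 p * \<alpha> T2 p
        + (1 - (z p)\<^sup>2 * r p) * ?n p"
    proof (rule tens_combination[OF tens_\<alpha> normal(1)[OF Y] B c1 c2 c0 ad(1) that], intro ballI)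
      fix f q assume "f \<in> SF" "q \<in> W"
      then show "normal transverse f q = z q ^ m * transverse x1 q * T1 f q + z q ^ m * transverse x2 q * T2 f q
          + (1 - (z q)\<^sup>2 * r q) * normal Y0 f q"
        unfolding normal(2)[OF Y \<open>f \<in> SF\<close>] normal(2)[OF ad(6) \<open>f \<in> SF\<close>] ad(17)[OF Y \<open>f \<in> SF\<close> \<open>q \<in> W\<close>]
          r(2)[rule_format, of q]
        by (simp add: algebra_simps)
    qed
    then show ?thesis unfolding u_def by (simp add: algebra_simps)
  qed
  have zm: "z q ^ m = 0" using q(2) m_pos by simp
  show "u q = ?n q" using u[OF q(1)] q(2) zm by simp
  assume T: "T \<in> VF" "\<And>q. T z q = 0"
  have "T u q = T (\<lambda>p. (1 - (z p)\<^sup>2 * r p) * ?n p + z p ^ m * ?k p) q"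
    by (rule VF_local[OF T(1) u_SF SF_add[OF SF_mult[OF c0 nS] SF_mult[OF SF_power[OF z_SF] k]] ad(1) q(1)]) (rule u)
  also have "\<dots> = (1 - (z q)\<^sup>2 * r q) * T ?n q + ?n q * T (\<lambda>p. 1 - (z p)\<^sup>2 * r p) q
      + (z q ^ m * T ?k q + ?k q * T (\<lambda>p. z p ^ m) q)"
    unfolding VF_mult_add[OF T(1) c0 nS SF_power[OF z_SF] k] by simp
  also have "T (\<lambda>p. 1 - (z p)\<^sup>2 * r p) q = 0"
    unfolding VF_diff[OF T(1) SF_const SF_mult[OF SF_power[OF z_SF] r(1)]] VF_mult[OF T(1) SF_power[OF z_SF] r(1)]
      VF_const[OF T(1)] tangent_power[OF T(1) T(2)] using q(2) by simp
  also have "T (\<lambda>p. z p ^ m) q = 0" by (rule tangent_power[OF T(1) T(2)])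
  finally show "T u q = T ?n q" using q(2) zm by simp
qed

lemma normal_tangent_bracket:
  assumes a: "adapted W x1 x2 T1 T2 Y0" and q: "q \<in> W" "h \<in> SF" and T: "T = T1 \<or> T = T2"
  shows "lie_bracket A (normal Y0) T h q = 0"
proof -
  note ad = adaptedD[OF a]
  have TV: "T \<in> VF" and Tz: "\<And>q. T z q = 0" and cm: "Y0 (T h) q = T (Y0 h) q"
    using T ad adapted_commute[OF a q] by auto
  have Nh: "normal Y0 h = (\<lambda>p. z p ^ m * Y0 h p)" using normal(2)[OF ad(6) q(2)] by (simp add: fun_eq_iff)
  have "T (normal Y0 h) q = z q ^ m * T (Y0 h) q"
    unfolding Nh VF_mult[OF TV SF_power[OF z_SF] VF_SF[OF ad(6) q(2)]] tangent_power[OF TV Tz] by simp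
  then show ?thesis
    unfolding lie_bracket(2)[OF BV_VF[OF normal(1)[OF ad(6)]] TV q(2)] normal(2)[OF ad(6) VF_SF[OF TV q(2)]] cm by simp
qed

text \<open>
  In $d\alpha(N, T) = N(\alpha(T)) - T(\alpha(N)) - \alpha([N, T])$ the field
  \<open>N = normal Y0\<close> vanishes on \<open>Z\<close> as an ordinary field and commutes with \<open>T\<close>, so only the
  middle term is left.
\<close>

lemma \<omega>_normal_tangent:
  assumes a: "adapted W x1 x2 T1 T2 Y0" and q: "q \<in> W" "z q = 0" and T: "T = T1 \<or> T = T2"
  shows "\<omega> (normal Y0) T q = - T u q"
proof -
  note ad = adaptedD[OF a]
  have TV: "T \<in> VF" and Tz: "\<And>q. T z q = 0" using T ad by auto
  have TB: "T \<in> BV" by (rule BV_tangent[OF TV Tz])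
  have "\<alpha> (lie_bracket A (normal Y0) T) q = 0"
    by (rule \<alpha>_locally_zero[OF BV_lie[OF normal(1)[OF ad(6)] TB] ad(1) q(1)])
       (rule normal_tangent_bracket[OF a _ _ T])
  then show ?thesis
    unfolding ext_deriv_def using normal_flat[OF ad(6) \<alpha>_SF[OF TB] q(2)] u_on_Z(2)[OF a q TV Tz] by simp
qed

lemma \<omega>_tangent:
  assumes a: "adapted W x1 x2 T1 T2 Y0" and q: "q \<in> W"
  shows "\<omega> T1 T2 q = T1 (\<alpha> T2) q - T2 (\<alpha> T1) q"
proof -
  note ad = adaptedD[OF a]
  have B: "T1 \<in> BV" "T2 \<in> BV" using BV_tangent[OF ad(4,7)] BV_tangent[OF ad(5,8)] by auto
  have "\<alpha> (lie_bracket A T1 T2) q = 0"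
    by (rule \<alpha>_locally_zero[OF BV_lie[OF B] ad(1) q])
       (use lie_bracket(2)[OF ad(4,5)] adapted_commute(1)[OF a] in simp)
  then show ?thesis by (simp add: ext_deriv_def)
qed

text \<open>
  Cramer's rule in the frame \<open>T1\<close>, \<open>T2\<close>, \<open>normal Y0\<close>, which as an ordinary field is zero on
  \<open>Z\<close> in its last member. This is $i_R (u\,d\beta + \beta \wedge du) = du$ in coordinates,
  with \<open>w\<close> the density of the area form.
\<close>

lemma Reeb_on_Z:
  assumes a: "adapted W x1 x2 T1 T2 Y0" and q: "q \<in> W" "z q = 0"
  defines "w \<equiv> u q * \<omega> T1 T2 q + \<alpha> T1 q * T2 u q - \<alpha> T2 q * T1 u q"
  shows "w \<noteq> 0" "f \<in> SF \<Longrightarrow> Reeb f q * w = T2 u q * T1 f q - T1 u q * T2 f q"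
proof -
  note ad = adaptedD[OF a]
  have B: "T1 \<in> BV" "T2 \<in> BV" "normal Y0 \<in> BV"
    using BV_tangent[OF ad(4,7)] BV_tangent[OF ad(5,8)] normal(1)[OF ad(6)] by auto
  have tw: "tw q L T1 T2 (normal Y0) = L T1 * T2 u q - L T2 * T1 u q + L (normal Y0) * \<omega> T1 T2 q" for L
    unfolding tw_def \<omega>_antisym[OF B(3,2)] \<omega>_normal_tangent[OF a q disjI2[OF refl]] \<omega>_normal_tangent[OF a q disjI1[OF refl]]
    by simp
  have w: "tw q (\<lambda>X. \<alpha> X q) T1 T2 (normal Y0) = w"
    unfolding tw w_def u_on_Z(1)[OF a q] by simp
  show "w \<noteq> 0" using frame_tw_nonzero[OF adapted_frame[OF a q(1)]] unfolding w .
  show "Reeb f q * w = T2 u q * T1 f q - T1 u q * T2 f q" if f: "f \<in> SF"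
    using reeb_unique_formula[OF adapted_frame[OF a q(1)] Reeb_BV Reeb_\<omega> Reeb_\<alpha> tens_apply[OF f]]
    unfolding w tw using normal_flat[OF ad(6) f q(2)] by simp
qed

lemma Reeb_tangent: "z q = 0 \<Longrightarrow> Reeb z q = 0"
  using BV_D[OF Reeb_BV] m_pos by fastforce

lemma Reeb_u: assumes "z q = 0" shows "Reeb u q = 0"
proof -
  obtain W x1 x2 T1 T2 Y0 where a: "adapted W x1 x2 T1 T2 Y0" "q \<in> W" using adapted_exists[OF assms] .
  show ?thesis using Reeb_on_Z(1)[OF a assms] Reeb_on_Z(2)[OF a assms u_SF] by (simp add: mult.commute)
qed

end

section \<open>Flows on compact unions of flow lines\<close>

text \<open>
  Separation of variables: the time \<open>\<theta>\<close> is a primitive of $1/v$, and the solution \<open>s\<close> is its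
  inverse.
\<close>

lemma autonomous_flow_1d:
  fixes v :: "real \<Rightarrow> real"
  assumes e: "e > 0" and v: "\<forall>r. \<bar>r - x0\<bar> < e \<longrightarrow> isCont v r \<and> v r > 0"
  obtains \<delta> \<theta> s e' where "\<delta> > 0" "0 < e'" "e' \<le> e" "\<theta> x0 = 0"
    "\<forall>r. \<bar>r - x0\<bar> < e' \<longrightarrow> (\<theta> has_real_derivative inverse (v r)) (at r) \<and> s (\<theta> r) = r"
    "\<forall>t. \<bar>t\<bar> < \<delta> \<longrightarrow> \<bar>s t - x0\<bar> < e' \<and> (s has_real_derivative v (s t)) (at t)"
proof -
  define e' where "e' = e / 2"
  let ?a = "x0 - e'" and ?b = "x0 + e'"
  have e': "0 < e'" "e' < e" using e by (simp_all add: e'_def)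
  have vin: "isCont v r" "v r > 0" if "r \<in> {?a..?b}" for r
    using v[rule_format, of r] that e' by (auto simp: abs_less_iff)
  have "continuous_on {?a..?b} (\<lambda>r. inverse (v r))"
    by (intro continuous_at_imp_continuous_on ballI continuous_intros) (use vin in fastforce)+
  then obtain g where g: "\<And>x. x \<in> {?a..?b} \<Longrightarrow> (g has_vector_derivative inverse (v x)) (at x within {?a..?b})"
    using antiderivative_continuous by blast
  define \<theta> where "\<theta> = (\<lambda>r. g r - g x0)"
  have gc: "continuous_on {?a..?b} g"
    using g by (meson has_vector_derivative_continuous continuous_on_eq_continuous_within)
  have \<theta>c: "continuous_on {?a..?b} \<theta>" unfolding \<theta>_def by (intro continuous_intros gc)
  have \<theta>d: "(\<theta> has_real_derivative inverse (v r)) (at r)" if r: "\<bar>r - x0\<bar> < e'" for r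
  proof -
    have ri: "r \<in> {?a<..<?b}" using r by (auto simp: abs_less_iff)
    then have "(g has_vector_derivative inverse (v r)) (at r within {?a<..<?b})"
      using g[of r] by (meson has_vector_derivative_within_subset greaterThanLessThan_subseteq_atLeastAtMost_iff
          greaterThanLessThan_iff atLeastAtMost_iff less_imp_le order_refl)
    then have "(g has_real_derivative inverse (v r)) (at r)"
      using at_within_open[OF ri open_greaterThanLessThan] by (simp add: has_real_derivative_iff_has_vector_derivative)
    then show ?thesis unfolding \<theta>_def by (auto intro!: derivative_eq_intros)
  qed
  have mono: "\<theta> r < \<theta> r'" if "?a \<le> r" "r < r'" "r' \<le> ?b" for r r'
  proof (rule DERIV_pos_imp_increasing_open[OF that(2)])
    fix x assume "r < x" "x < r'"
    then have x: "\<bar>x - x0\<bar> < e'" using that by (auto simp: abs_less_iff)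
    then have "v x > 0" using vin(2)[of x] by (auto simp: abs_less_iff)
    then show "\<exists>y. DERIV \<theta> x :> y \<and> y > 0" using \<theta>d[OF x] by (intro exI[of _ "inverse (v x)"]) simp
  next
    show "continuous_on {r..r'} \<theta>" by (rule continuous_on_subset[OF \<theta>c]) (use that in auto)
  qed
  define s where "s = (\<lambda>t. SOME r. \<bar>r - x0\<bar> < e' \<and> \<theta> r = t)"
  have s\<theta>: "s (\<theta> r) = r" if r: "\<bar>r - x0\<bar> < e'" for r
    unfolding s_def
  proof (rule some_equality)
    fix r' assume r': "\<bar>r' - x0\<bar> < e' \<and> \<theta> r' = \<theta> r"
    have b: "?a \<le> r" "r \<le> ?b" "?a \<le> r'" "r' \<le> ?b" "\<theta> r' = \<theta> r" using r r' by linarith+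
    show "r' = r"
    proof (rule ccontr)
      assume "r' \<noteq> r"
      then have "r < r' \<or> r' < r" by linarith
      then show False using mono[OF b(1) _ b(4)] mono[OF b(3) _ b(2)] b(5) by auto
    qed
  qed (use r in simp)
  define \<delta> where "\<delta> = min (\<theta> ?b) (- \<theta> ?a)"
  have z0: "\<theta> x0 = 0" by (simp add: \<theta>_def)
  have \<delta>: "\<delta> > 0" using mono[of x0 ?b] mono[of ?a x0] e' z0 by (simp add: \<delta>_def)
  have st: "\<bar>s t - x0\<bar> < e' \<and> \<theta> (s t) = t" if t: "\<bar>t\<bar> < \<delta>" for t
  proof -
    have "\<theta> ?a < t" "t < \<theta> ?b" using t unfolding \<delta>_def by linarith+
    then obtain r where r: "r \<in> {?a..?b}" "\<theta> r = t"
      using IVT'[of \<theta> ?a t ?b] \<theta>c e' by auto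
    have "r \<noteq> ?a" "r \<noteq> ?b" using r \<open>\<theta> ?a < t\<close> \<open>t < \<theta> ?b\<close> by auto
    then have "\<bar>r - x0\<bar> < e'" using r(1) by (auto simp: abs_less_iff)
    then show ?thesis using s\<theta>[of r] r(2) by auto
  qed
  have sd: "(s has_real_derivative v (s t)) (at t)" if t: "\<bar>t\<bar> < \<delta>" for t
  proof -
    let ?r = "s t"
    have r: "\<bar>?r - x0\<bar> < e'" "\<theta> ?r = t" using st[OF t] by auto
    define k where "k = (e' - \<bar>?r - x0\<bar>) / 2"
    have k: "k > 0" using r(1) by (simp add: k_def)
    have kin: "\<bar>y - x0\<bar> < e'" if "?r - k \<le> y" "y \<le> ?r + k" for y
    proof -
      have "\<bar>y - ?r\<bar> \<le> k" using that by (simp add: abs_le_iff)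
      moreover have "\<bar>y - x0\<bar> \<le> \<bar>y - ?r\<bar> + \<bar>?r - x0\<bar>" by linarith
      moreover have "2 * k = e' - \<bar>?r - x0\<bar>" by (simp add: k_def)
      ultimately show ?thesis using k by linarith
    qed
    have "isCont s (\<theta> ?r)"
      by (rule isCont_inverse_function2[of "?r - k" ?r "?r + k"]) (use k kin s\<theta> DERIV_isCont[OF \<theta>d] in auto)
    then have "isCont s t" using r(2) by simp
    then have "(s has_real_derivative inverse (inverse (v ?r))) (at t)"
      by (intro DERIV_inverse_function[where f=\<theta> and g=s and x=t and a="-\<delta>" and b=\<delta>])
         (use \<theta>d[OF r(1)] vin(2)[of ?r] r t st in \<open>auto simp: abs_less_iff\<close>)
    then show ?thesis by simp
  qed
  show ?thesis
    by (rule that[of \<delta> e' \<theta> s]) (use \<delta> e' z0 \<theta>d s\<theta> st sd in auto)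
qed

context manifold3 begin

text \<open>
  The part of \<open>L\<close> in \<open>N\<close> is a piece of the single integral curve \<open>\<sigma>\<close>, and \<open>\<tau>\<close> is the time at
  which it passes a given point. By the last clause \<open>\<tau>\<close> grows with unit speed along every
  integral curve in \<open>L\<close>, which gives uniqueness of integral curves. Points of the smaller
  set \<open>N'\<close> can be followed for the time \<open>\<delta> / 2\<close> in both directions.
\<close>

definition flow_box where
  "flow_box X L N N' \<delta> \<tau> \<sigma> \<longleftrightarrow> open N \<and> open N' \<and> N' \<subseteq> N \<and> (0::real) < \<delta> \<and>
     (\<forall>q\<in>N \<inter> L. \<bar>\<tau> q\<bar> < \<delta> \<and> \<sigma> (\<tau> q) = q) \<and> (\<forall>q\<in>N' \<inter> L. \<bar>\<tau> q\<bar> < \<delta> / 2) \<and>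
     (\<forall>t. \<bar>t\<bar> < \<delta> \<longrightarrow> \<sigma> t \<in> L \<and> (\<forall>h\<in>SF. ((\<lambda>s. h (\<sigma> s)) has_real_derivative X h (\<sigma> t)) (at t))) \<and>
     (\<forall>\<gamma> t. \<gamma> t \<in> N \<inter> L \<longrightarrow> (\<forall>h\<in>SF. ((\<lambda>s. h (\<gamma> s)) has_real_derivative X h (\<gamma> t)) (at t)) \<longrightarrow>
        ((\<lambda>s. \<tau> (\<gamma> s)) has_real_derivative 1) (at t))"

end

locale flow_lines = manifold3 A
  for A :: "('a::{t2_space,second_countable_topology} set \<times> ('a \<Rightarrow> real^3)) set" +
  fixes X :: "'a vfield" and L :: "'a set"
  assumes compact_L: "compact L"
    and boxes: "\<forall>p\<in>L. \<exists>N N' \<delta> \<tau> \<sigma>. flow_box X L N N' \<delta> \<tau> \<sigma> \<and> p \<in> N'"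
begin

definition icurve :: "real \<Rightarrow> real \<Rightarrow> (real \<Rightarrow> 'a) \<Rightarrow> bool" where
  "icurve a b \<gamma> \<longleftrightarrow> (\<forall>t. a < t \<and> t < b \<longrightarrow> \<gamma> t \<in> L \<and>
     (\<forall>h\<in>SF. ((\<lambda>s. h (\<gamma> s)) has_real_derivative X h (\<gamma> t)) (at t)))"

lemma icurveD:
  assumes "icurve a b \<gamma>" "a < t" "t < b"
  shows "\<gamma> t \<in> L" "h \<in> SF \<Longrightarrow> ((\<lambda>s. h (\<gamma> s)) has_real_derivative X h (\<gamma> t)) (at t)"
  using assms unfolding icurve_def by blast+

lemma icurve_subset: "icurve a b \<gamma> \<Longrightarrow> a \<le> c \<Longrightarrow> d \<le> b \<Longrightarrow> icurve c d \<gamma>"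
  unfolding icurve_def by force

lemma icurve_local:
  assumes "\<And>t. a < t \<Longrightarrow> t < b \<Longrightarrow> \<exists>c d \<beta>. c < t \<and> t < d \<and> icurve c d \<beta> \<and> (\<forall>s. c < s \<and> s < d \<longrightarrow> \<gamma> s = \<beta> s)"
  shows "icurve a b \<gamma>"
  unfolding icurve_def
proof (intro allI impI, elim conjE)
  fix t assume "a < t" "t < b"
  then obtain c d \<beta> where *: "c < t" "t < d" "icurve c d \<beta>" "\<forall>s. c < s \<and> s < d \<longrightarrow> \<gamma> s = \<beta> s"
    using assms by blast
  have e: "\<gamma> t = \<beta> t" using * by blast
  have "((\<lambda>s. h (\<gamma> s)) has_real_derivative X h (\<gamma> t)) (at t)" if h: "h \<in> SF" for h
    unfolding e
    by (rule has_field_derivative_transform_within_open[OF icurveD(2)[OF *(3,1,2) h] open_greaterThanLessThan[of c d]])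
       (use * in auto)
  then show "\<gamma> t \<in> L \<and> (\<forall>h\<in>SF. ((\<lambda>s. h (\<gamma> s)) has_real_derivative X h (\<gamma> t)) (at t))"
    using icurveD(1)[OF *(3,1,2)] e by simp
qed

lemma icurve_shift: assumes "icurve a b \<gamma>" shows "icurve (a + k) (b + k) (\<lambda>t. \<gamma> (t - k))"
  unfolding icurve_def
proof (intro allI impI conjI ballI)
  fix t assume t: "a + k < t \<and> t < b + k"
  then have t': "a < t - k" "t - k < b" by auto
  show "\<gamma> (t - k) \<in> L" by (rule icurveD(1)[OF assms t'])
  fix h assume h: "h \<in> SF"
  have "((\<lambda>s. s - k) has_real_derivative 1) (at t)" by (auto intro!: derivative_eq_intros)
  from DERIV_chain2[OF icurveD(2)[OF assms t' h] this]
  show "((\<lambda>s. h (\<gamma> (s - k))) has_real_derivative X h (\<gamma> (t - k))) (at t)" by simp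
qed

lemma icurve_stays:
  assumes \<gamma>: "icurve a b \<gamma>" "a < t" "t < b" and N: "open N" "\<gamma> t \<in> N"
  obtains d where "d > 0" "\<forall>s. \<bar>s - t\<bar> < d \<longrightarrow> a < s \<and> s < b \<and> \<gamma> s \<in> N"
proof -
  obtain \<rho> W' K where \<rho>: "\<rho> \<in> SF" "\<And>q. 0 \<le> \<rho> q" "open W'" "\<gamma> t \<in> W'" "\<And>q. q \<in> W' \<Longrightarrow> \<rho> q = 1"
    "compact K" "K \<subseteq> N" "\<And>q. q \<notin> K \<Longrightarrow> \<rho> q = 0"
    using SF_bump[OF N] by blast
  have "isCont (\<lambda>s. \<rho> (\<gamma> s)) t" using DERIV_isCont[OF icurveD(2)[OF \<gamma> \<rho>(1)]] .
  moreover have "\<rho> (\<gamma> t) = 1" by (rule \<rho>(5)[OF \<rho>(4)])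
  ultimately have "(\<lambda>s. \<rho> (\<gamma> s)) \<midarrow>t\<rightarrow> 1" by (simp add: isCont_def)
  then obtain d where d: "d > 0" "\<And>s. s \<noteq> t \<Longrightarrow> \<bar>s - t\<bar> < d \<Longrightarrow> \<bar>\<rho> (\<gamma> s) - 1\<bar> < 1"
    using LIM_D[of "\<lambda>s. \<rho> (\<gamma> s)" 1 t 1] by auto
  have "\<gamma> s \<in> N" if "\<bar>s - t\<bar> < d" for s
  proof (cases "s = t")
    case False
    then have "\<rho> (\<gamma> s) \<noteq> 0" using d(2)[OF False that] by auto
    then show ?thesis using \<rho>(7,8) by blast
  qed (use N in simp)
  then show ?thesis
    using d(1) \<gamma>(2,3) by (intro that[of "min d (min (t - a) (b - t))"]) (auto simp: abs_less_iff)
qed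

text \<open>
  The times \<open>\<tau>\<close> along the two curves in a flow box differ by a constant, so the set where
  the curves agree is open. So is its complement, the space being Hausdorff, and the
  interval is connected.
\<close>

lemma icurve_unique:
  assumes \<gamma>: "icurve a b \<gamma>" and \<beta>: "icurve a b \<beta>" and t0: "a < t0" "t0 < b" "\<gamma> t0 = \<beta> t0"
    and t: "a < t" "t < b"
  shows "\<gamma> t = \<beta> t"
proof -
  let ?I = "{a<..<b}"
  let ?S = "{t \<in> ?I. \<gamma> t = \<beta> t}" and ?D = "{t \<in> ?I. \<gamma> t \<noteq> \<beta> t}"
  have S: "open ?S" unfolding open_dist
  proof
    fix t assume t: "t \<in> ?S"
    then have ab: "a < t" "t < b" and e: "\<gamma> t = \<beta> t" by auto
    have "\<gamma> t \<in> L" by (rule icurveD(1)[OF \<gamma> ab])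
    then obtain N N' \<delta> \<tau> \<sigma> where B: "flow_box X L N N' \<delta> \<tau> \<sigma>" "\<gamma> t \<in> N'" using boxes by blast
    have N: "open N" "\<gamma> t \<in> N" "\<beta> t \<in> N" using B e unfolding flow_box_def by auto
    have inv: "\<And>q. q \<in> N \<Longrightarrow> q \<in> L \<Longrightarrow> \<sigma> (\<tau> q) = q"
      and der: "\<And>\<gamma> t. \<gamma> t \<in> N \<Longrightarrow> \<gamma> t \<in> L \<Longrightarrow> (\<forall>h\<in>SF. ((\<lambda>s. h (\<gamma> s)) has_real_derivative X h (\<gamma> t)) (at t)) \<Longrightarrow>
        ((\<lambda>s. \<tau> (\<gamma> s)) has_real_derivative 1) (at t)"
      using B(1) unfolding flow_box_def by blast+
    obtain d1 where d1: "d1 > 0" "\<forall>s. \<bar>s - t\<bar> < d1 \<longrightarrow> a < s \<and> s < b \<and> \<gamma> s \<in> N"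
      using icurve_stays[OF \<gamma> ab N(1,2)] .
    obtain d2 where d2: "d2 > 0" "\<forall>s. \<bar>s - t\<bar> < d2 \<longrightarrow> a < s \<and> s < b \<and> \<beta> s \<in> N"
      using icurve_stays[OF \<beta> ab N(1,3)] .
    let ?d = "min d1 d2"
    have "s \<in> ?S" if s: "dist s t < ?d" for s
    proof -
      have in': "\<bar>x - t\<bar> < d1" "\<bar>x - t\<bar> < d2" if "x \<in> {t - ?d<..<t + ?d}" for x
        using that by (auto simp: abs_less_iff)
      have D: "((\<lambda>s. \<tau> (\<gamma> s) - \<tau> (\<beta> s)) has_real_derivative 0) (at x)" if x: "x \<in> {t - ?d<..<t + ?d}" for x
      proof -
        have 1: "a < x" "x < b" "\<gamma> x \<in> N" "\<beta> x \<in> N" using d1(2) d2(2) in'[OF x] by auto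
        have "((\<lambda>s. \<tau> (\<gamma> s)) has_real_derivative 1) (at x)"
          by (rule der[of \<gamma> x, OF 1(3) icurveD(1)[OF \<gamma> 1(1,2)]]) (use icurveD(2)[OF \<gamma> 1(1,2)] in blast)
        moreover have "((\<lambda>s. \<tau> (\<beta> s)) has_real_derivative 1) (at x)"
          by (rule der[of \<beta> x, OF 1(4) icurveD(1)[OF \<beta> 1(1,2)]]) (use icurveD(2)[OF \<beta> 1(1,2)] in blast)
        ultimately show ?thesis using DERIV_diff by fastforce
      qed
      have sI: "s \<in> {t - ?d<..<t + ?d}" using s by (auto simp: dist_real_def abs_less_iff)
      have tI: "t \<in> {t - ?d<..<t + ?d}" using d1 d2 by auto
      have "\<tau> (\<gamma> s) - \<tau> (\<beta> s) = \<tau> (\<gamma> t) - \<tau> (\<beta> t)"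
        by (rule DERIV_isconst3[of "t - ?d" "t + ?d" s t "\<lambda>s. \<tau> (\<gamma> s) - \<tau> (\<beta> s)"])
           (use d1(1) d2(1) sI tI D in auto)
      then have "\<tau> (\<gamma> s) = \<tau> (\<beta> s)" using e by simp
      moreover have 1: "a < s" "s < b" "\<gamma> s \<in> N" "\<beta> s \<in> N" using d1(2) d2(2) in'[OF sI] by auto
      ultimately have "\<gamma> s = \<beta> s"
        using inv[OF 1(3) icurveD(1)[OF \<gamma> 1(1,2)]] inv[OF 1(4) icurveD(1)[OF \<beta> 1(1,2)]] by metis
      then show ?thesis using 1 by simp
    qed
    then show "\<exists>e>0. \<forall>s. dist s t < e \<longrightarrow> s \<in> ?S" using d1(1) d2(1) by (intro exI[of _ ?d]) auto
  qed
  have D: "open ?D" unfolding open_dist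
  proof
    fix t assume t: "t \<in> ?D"
    then have ab: "a < t" "t < b" and ne: "\<gamma> t \<noteq> \<beta> t" by auto
    obtain U V where UV: "open U" "open V" "\<gamma> t \<in> U" "\<beta> t \<in> V" "U \<inter> V = {}" using hausdorff[OF ne] by blast
    obtain d1 where d1: "d1 > 0" "\<forall>s. \<bar>s - t\<bar> < d1 \<longrightarrow> a < s \<and> s < b \<and> \<gamma> s \<in> U"
      using icurve_stays[OF \<gamma> ab UV(1,3)] .
    obtain d2 where d2: "d2 > 0" "\<forall>s. \<bar>s - t\<bar> < d2 \<longrightarrow> a < s \<and> s < b \<and> \<beta> s \<in> V"
      using icurve_stays[OF \<beta> ab UV(2,4)] .
    have "s \<in> ?D" if s: "dist s t < min d1 d2" for s
    proof -
      have "a < s" "s < b" "\<gamma> s \<in> U" "\<beta> s \<in> V" using d1(2) d2(2) s by (auto simp: dist_real_def)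
      then show ?thesis using UV(5) by auto
    qed
    then show "\<exists>e>0. \<forall>s. dist s t < e \<longrightarrow> s \<in> ?D" using d1(1) d2(1) by (intro exI[of _ "min d1 d2"]) auto
  qed
  have "?S \<inter> ?I = {} \<or> ?D \<inter> ?I = {}"
    by (rule connectedD[OF _ S D]) auto
  then show ?thesis using t0 t by auto
qed

lemma icurve_glue:
  assumes \<gamma>: "icurve a b \<gamma>" and \<beta>: "icurve c d \<beta>" and o: "a \<le> c" "c < s" "s < b" "b \<le> d" and e: "\<gamma> s = \<beta> s"
  obtains \<eta> where "icurve a d \<eta>" "\<forall>t. a < t \<and> t < b \<longrightarrow> \<eta> t = \<gamma> t" "\<forall>t. c < t \<and> t < d \<longrightarrow> \<eta> t = \<beta> t"
proof -
  let ?\<eta> = "\<lambda>t. if t < b then \<gamma> t else \<beta> t"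
  have eq: "\<gamma> t = \<beta> t" if "c < t" "t < b" for t
    by (rule icurve_unique[OF icurve_subset[OF \<gamma> o(1) order_refl] icurve_subset[OF \<beta> order_refl o(4)] o(2,3) e that])
  have 1: "\<forall>t. c < t \<and> t < d \<longrightarrow> ?\<eta> t = \<beta> t" using eq by auto
  have "icurve a d ?\<eta>"
  proof (rule icurve_local)
    fix t assume t: "a < t" "t < d"
    show "\<exists>c d \<beta>. c < t \<and> t < d \<and> icurve c d \<beta> \<and> (\<forall>s. c < s \<and> s < d \<longrightarrow> ?\<eta> s = \<beta> s)"
    proof (cases "t < b")
      case True
      then show ?thesis using t \<gamma> by (intro exI[of _ a] exI[of _ b] exI[of _ \<gamma>]) auto
    next
      case False
      then show ?thesis using t \<beta> 1 o by (intro exI[of _ c] exI[of _ d] exI[of _ \<beta>]) auto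
    qed
  qed
  then show ?thesis using that[of ?\<eta>] 1 by auto
qed

text \<open>Finitely many flow boxes cover \<open>L\<close>, so one time serves all points.\<close>

lemma uniform_time:
  obtains \<epsilon> where "\<epsilon> > 0" "\<forall>q\<in>L. \<exists>\<gamma>. icurve (-\<epsilon>) \<epsilon> \<gamma> \<and> \<gamma> 0 = q"
proof -
  obtain N N' \<delta> \<tau> \<sigma> where B: "\<And>p. p \<in> L \<Longrightarrow> flow_box X L (N p) (N' p) (\<delta> p) (\<tau> p) (\<sigma> p) \<and> p \<in> N' p"
    using boxes by metis
  obtain C where C: "C \<subseteq> L" "finite C" "L \<subseteq> (\<Union>p\<in>C. N' p)"
  proof (rule compactE_image[OF compact_L, of L N'])
    show "open (N' p)" if "p \<in> L" for p using B[OF that] unfolding flow_box_def by blast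
    show "L \<subseteq> (\<Union>p\<in>L. N' p)" using B by blast
  qed
  define \<epsilon> where "\<epsilon> = Min (insert 1 ((\<lambda>p. \<delta> p / 2) ` C))"
  have \<delta>0: "\<delta> p > 0" if "p \<in> C" for p using B[of p] that C(1) unfolding flow_box_def by blast
  have \<epsilon>: "\<epsilon> > 0" unfolding \<epsilon>_def using C(2) \<delta>0 by (subst Min_gr_iff) auto
  have \<epsilon>le: "\<epsilon> \<le> \<delta> p / 2" if "p \<in> C" for p unfolding \<epsilon>_def using C(2) that by (intro Min_le) auto
  have "\<exists>\<gamma>. icurve (-\<epsilon>) \<epsilon> \<gamma> \<and> \<gamma> 0 = q" if q: "q \<in> L" for q
  proof -
    obtain p where p: "p \<in> C" "q \<in> N' p" using C(3) q by blast
    have fb: "flow_box X L (N p) (N' p) (\<delta> p) (\<tau> p) (\<sigma> p)" using B p(1) C(1) by blast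
    have \<tau>: "\<bar>\<tau> p q\<bar> < \<delta> p / 2" "\<sigma> p (\<tau> p q) = q" using fb p(2) q unfolding flow_box_def by blast+
    have "icurve (- \<delta> p) (\<delta> p) (\<sigma> p)" using fb unfolding flow_box_def icurve_def by (auto simp: abs_less_iff)
    from icurve_shift[OF this, of "- \<tau> p q"]
    have "icurve (- \<delta> p - \<tau> p q) (\<delta> p - \<tau> p q) (\<lambda>t. \<sigma> p (t + \<tau> p q))" by simp
    then have "icurve (-\<epsilon>) \<epsilon> (\<lambda>t. \<sigma> p (t + \<tau> p q))"
      by (rule icurve_subset) (use \<tau>(1) \<epsilon>le[OF p(1)] in \<open>auto simp: abs_less_iff\<close>)
    then show ?thesis using \<tau>(2) by (intro exI[of _ "\<lambda>t. \<sigma> p (t + \<tau> p q)"]) simp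
  qed
  then show ?thesis using that \<epsilon> by blast
qed

text \<open>
  A solution on a symmetric interval is continued at both ends in steps of half the uniform
  time.
\<close>

lemma global_curve:
  assumes q: "q \<in> L"
  obtains \<gamma> where "\<And>a b. icurve a b \<gamma>" "\<gamma> 0 = q"
proof -
  obtain \<epsilon> where \<epsilon>: "\<epsilon> > 0" "\<forall>q\<in>L. \<exists>\<gamma>. icurve (-\<epsilon>) \<epsilon> \<gamma> \<and> \<gamma> 0 = q" using uniform_time .
  define h where "h = \<epsilon> / 2"
  have h: "h > 0" "\<epsilon> = 2 * h" using \<epsilon> by (auto simp: h_def)
  have step: "\<exists>\<gamma>'. icurve (- (a + h)) (a + h) \<gamma>' \<and> \<gamma>' 0 = q"
    if a: "a \<ge> \<epsilon>" and \<gamma>: "icurve (-a) a \<gamma>" "\<gamma> 0 = q" for a \<gamma>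
  proof -
    have ap: "-a < a - h" "a - h < a" "-a < h - a" "h - a < a" using a h by auto
    obtain \<beta>1 where \<beta>1: "icurve (-\<epsilon>) \<epsilon> \<beta>1" "\<beta>1 0 = \<gamma> (a - h)" using \<epsilon>(2) icurveD(1)[OF \<gamma>(1) ap(1,2)] by blast
    obtain \<beta>2 where \<beta>2: "icurve (-\<epsilon>) \<epsilon> \<beta>2" "\<beta>2 0 = \<gamma> (h - a)" using \<epsilon>(2) icurveD(1)[OF \<gamma>(1) ap(3,4)] by blast
    have s1: "icurve (a - 3 * h) (a + h) (\<lambda>t. \<beta>1 (t - (a - h)))"
      using icurve_shift[OF \<beta>1(1), of "a - h"] h by (simp add: algebra_simps)
    have s2: "icurve (- (a + h)) (3 * h - a) (\<lambda>t. \<beta>2 (t - (h - a)))"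
      using icurve_shift[OF \<beta>2(1), of "h - a"] h by (simp add: algebra_simps)
    obtain \<gamma>1 where \<gamma>1: "icurve (-a) (a + h) \<gamma>1" "\<forall>t. - a < t \<and> t < a \<longrightarrow> \<gamma>1 t = \<gamma> t"
      by (rule icurve_glue[OF \<gamma>(1) s1, of "a - h"]) (use a h \<beta>1(2) in auto)
    obtain \<gamma>2 where \<gamma>2: "icurve (- (a + h)) (a + h) \<gamma>2" "\<forall>t. - a < t \<and> t < a + h \<longrightarrow> \<gamma>2 t = \<gamma>1 t"
      by (rule icurve_glue[OF s2 \<gamma>1(1), of "h - a"]) (use a h \<beta>2(2) \<gamma>1(2) ap in auto)
    have "\<gamma>2 0 = q" using \<gamma>2(2) \<gamma>1(2) \<gamma>(2) a h by simp
    then show ?thesis using \<gamma>2(1) by blast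
  qed
  have "\<exists>\<gamma>. icurve (- (\<epsilon> + real n * h)) (\<epsilon> + real n * h) \<gamma> \<and> \<gamma> 0 = q" for n
  proof (induction n)
    case 0 then show ?case using \<epsilon>(2) q by simp
  next
    case (Suc n)
    then obtain \<gamma> where "icurve (- (\<epsilon> + real n * h)) (\<epsilon> + real n * h) \<gamma>" "\<gamma> 0 = q" by blast
    from step[OF _ this] show ?case using h by (simp add: algebra_simps)
  qed
  then obtain \<gamma> where \<gamma>: "\<And>n. icurve (- (\<epsilon> + real n * h)) (\<epsilon> + real n * h) (\<gamma> n)" "\<And>n. \<gamma> n 0 = q" by metis
  define R where "R = (\<lambda>n. \<epsilon> + real n * h)"
  have R: "\<And>n. R n > 0" "\<And>k n. k \<le> n \<Longrightarrow> R k \<le> R n" using \<epsilon>(1) h by (auto simp: R_def add_pos_nonneg)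
  have agree1: "\<gamma> k t = \<gamma> n t" if "\<bar>t\<bar> < R k" "k \<le> n" for k n t
  proof (rule icurve_unique[of "- R k" "R k" _ _ 0])
    show "icurve (- R k) (R k) (\<gamma> k)" using \<gamma>(1)[of k] by (simp add: R_def)
    have "icurve (- R n) (R n) (\<gamma> n)" using \<gamma>(1)[of n] by (simp add: R_def)
    then show "icurve (- R k) (R k) (\<gamma> n)" by (rule icurve_subset) (use R(2)[OF that(2)] in auto)
  qed (use that(1) R(1)[of k] \<gamma>(2) in \<open>auto simp: abs_less_iff\<close>)
  have agree: "\<gamma> k t = \<gamma> n t" if "\<bar>t\<bar> < R k" "\<bar>t\<bar> < R n" for k n t
  proof (cases "k \<le> n")
    case True then show ?thesis by (rule agree1[OF that(1)])
  next
    case False then show ?thesis using agree1[OF that(2), of k] by simp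
  qed
  define N where "N = (\<lambda>t::real. nat \<lceil>\<bar>t\<bar> / h\<rceil>)"
  have N: "\<bar>t\<bar> < R (N t)" for t
  proof -
    have "\<bar>t\<bar> / h \<le> real (N t)" unfolding N_def by linarith
    then have "\<bar>t\<bar> \<le> real (N t) * h" using h by (simp add: field_simps)
    then show ?thesis using \<epsilon>(1) by (simp add: R_def)
  qed
  let ?\<gamma> = "\<lambda>t. \<gamma> (N t) t"
  have "icurve a b ?\<gamma>" for a b
  proof (rule icurve_local)
    fix t
    have "\<forall>s. - R (N t) < s \<and> s < R (N t) \<longrightarrow> ?\<gamma> s = \<gamma> (N t) s" using agree N by (auto simp: abs_less_iff)
    then show "\<exists>c d \<beta>. c < t \<and> t < d \<and> icurve c d \<beta> \<and> (\<forall>s. c < s \<and> s < d \<longrightarrow> ?\<gamma> s = \<beta> s)"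
      using N[of t] \<gamma>(1)[of "N t"] by (intro exI[of _ "- R (N t)"] exI[of _ "R (N t)"] exI[of _ "\<gamma> (N t)"]) (auto simp: R_def abs_less_iff)
  qed
  then show ?thesis using that[of ?\<gamma>] \<gamma>(2) by simp
qed

text \<open>
  The times \<open>n D\<close> lead infinitely often into finitely many flow boxes, hence twice into the
  same one. There \<open>L\<close> is a single flow segment, so the later point is also reached from the
  earlier one within this box. As \<open>D\<close> exceeds the length of every box, the two passages are
  different and the line closes up.
\<close>

lemma periodic_curve:
  assumes q: "q \<in> L"
  obtains \<gamma> P where "integral_curve A X \<gamma>" "range \<gamma> \<subseteq> L" "\<gamma> 0 = q" "P > 0" "\<forall>t. \<gamma> (t + P) = \<gamma> t"
proof -
  obtain \<gamma> where \<gamma>: "\<And>a b. icurve a b \<gamma>" "\<gamma> 0 = q" using global_curve[OF q] by blast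
  have inL: "\<gamma> t \<in> L" for t using icurveD(1)[OF \<gamma>(1)[of "t - 1" "t + 1"]] by simp
  obtain N N' \<delta> \<tau> \<sigma> where B: "\<And>p. p \<in> L \<Longrightarrow> flow_box X L (N p) (N' p) (\<delta> p) (\<tau> p) (\<sigma> p) \<and> p \<in> N' p"
    using boxes by metis
  obtain C where C: "C \<subseteq> L" "finite C" "L \<subseteq> (\<Union>p\<in>C. N' p)"
  proof (rule compactE_image[OF compact_L, of L N'])
    show "open (N' p)" if "p \<in> L" for p using B[OF that] unfolding flow_box_def by blast
    show "L \<subseteq> (\<Union>p\<in>L. N' p)" using B by blast
  qed
  have \<delta>0: "\<delta> p > 0" if "p \<in> C" for p using B[of p] that C(1) unfolding flow_box_def by blast
  \<comment> \<open>The times \<open>n * D\<close> are spaced further apart than any flow box lasts.\<close>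
  define D where "D = 2 * (\<Sum>p\<in>C. \<delta> p) + 1"
  have D: "2 * \<delta> p < D" if "p \<in> C" for p
    using member_le_sum[OF that, of \<delta>] C(2) \<delta>0 by (force simp: D_def less_imp_le)
  have D0: "D > 0" using sum_nonneg[of C \<delta>] \<delta>0 by (force simp: D_def less_imp_le)
  have "\<forall>n::nat. \<exists>p. p \<in> C \<and> \<gamma> (real n * D) \<in> N' p" using C(3) inL by blast
  then obtain c where c: "\<And>n::nat. c n \<in> C" "\<And>n::nat. \<gamma> (real n * D) \<in> N' (c n)" by metis
  have "\<not> inj c" using C(2) c(1) finite_subset[of "range c" C] finite_imageD[of c UNIV] by auto
  then obtain i j where "c i = c j" "i \<noteq> j" by (auto simp: inj_def)
  then obtain k n where kn: "c k = c n" "k < n" by (metis nat_neq_iff)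
  define p where "p = c k"
  have p: "p \<in> C" "\<gamma> (real k * D) \<in> N' p" "\<gamma> (real n * D) \<in> N' p" using c kn(1) p_def by metis+
  have fb: "flow_box X L (N p) (N' p) (\<delta> p) (\<tau> p) (\<sigma> p)" using B p(1) C(1) by blast
  define t1 t2 where "t1 = \<tau> p (\<gamma> (real k * D))" and "t2 = \<tau> p (\<gamma> (real n * D))"
  have t: "\<bar>t1\<bar> < \<delta> p / 2" "\<bar>t2\<bar> < \<delta> p / 2" "\<sigma> p t1 = \<gamma> (real k * D)" "\<sigma> p t2 = \<gamma> (real n * D)"
    using fb p(2,3) inL unfolding flow_box_def t1_def t2_def by blast+
  have ic: "icurve (- \<delta> p) (\<delta> p) (\<sigma> p)" using fb unfolding flow_box_def icurve_def by (auto simp: abs_less_iff)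
  have sh: "icurve a b (\<lambda>s. \<gamma> (s - k))" for a b k
    using icurve_shift[OF \<gamma>(1)[of "a - k" "b - k"], of k] by simp
  have "\<gamma> (t2 - (t1 - real k * D)) = \<sigma> p t2"
    by (rule icurve_unique[OF sh ic, of t1]) (use t in \<open>auto simp: abs_less_iff\<close>)
  then have close: "\<gamma> (t2 - t1 + real k * D) = \<gamma> (real n * D)" using t(4) by (simp add: algebra_simps)
  \<comment> \<open>The way round takes \<open>(n - k) * D\<close>, up to the time difference inside the box.\<close>
  define P where "P = real n * D - (t2 - t1 + real k * D)"
  have "D \<le> (real n - real k) * D" using kn(2) D0 by simp
  then have P: "P > 0" using t(1,2) D[OF p(1)] \<delta>0[OF p(1)] unfolding P_def by (auto simp: algebra_simps abs_less_iff)
  have per: "\<gamma> (s + P) = \<gamma> s" for s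
  proof -
    let ?s0 = "t2 - t1 + real k * D"
    have "(\<lambda>s. \<gamma> (s - (-P))) s = \<gamma> s"
      by (rule icurve_unique[OF sh[of "min s ?s0 - 1" "max s ?s0 + 1"] \<gamma>(1), of ?s0])
         (use close in \<open>auto simp: P_def\<close>)
    then show ?thesis by simp
  qed
  have "integral_curve A X \<gamma>" unfolding integral_curve_def
  proof (intro ballI allI)
    fix f t assume "f \<in> SF"
    then show "((\<lambda>s. f (\<gamma> s)) has_real_derivative X f (\<gamma> t)) (at t)"
      using icurveD(2)[OF \<gamma>(1)[of "t - 1" "t + 1"], of t f] by simp
  qed
  then show ?thesis using that \<gamma>(2) inL P per by blast
qed

end

section \<open>Regular levels consist of periodic Reeb orbits\<close>

context bm_contact_closed begin

text \<open>The critical points of the restriction of \<open>u\<close> to \<open>Z\<close>. Only derivatives along \<open>Z\<close> count.\<close>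

definition Crit :: "'a set" where
  "Crit = {p \<in> Z. \<forall>T\<in>VF. T z p = 0 \<longrightarrow> T u p = 0}"

lemma Crit_iff:
  assumes a: "adapted W x1 x2 T1 T2 Y0" and q: "q \<in> W" "z q = 0"
  shows "q \<in> Crit \<longleftrightarrow> T1 u q = 0 \<and> T2 u q = 0"
proof -
  note ad = adaptedD[OF a]
  have "T u q = 0" if "T1 u q = 0" "T2 u q = 0" "T \<in> VF" "T z q = 0" for T
    using ad(17)[OF that(3) u_SF q(1)] that by simp
  then show ?thesis using q ad(4,5,7,8) unfolding Crit_def Z_iff[symmetric] by blast
qed

text \<open>
  On \<open>Z\<close>, a function \<open>g\<close> with nonzero differential along \<open>Z\<close> and one of $x_1, x_2$ have
  independent differentials. With \<open>z\<close> they can serve as coordinates, in which the level of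
  \<open>g\<close> on \<open>Z\<close> is a coordinate line.
\<close>

lemma curve_chart:
  assumes a: "adapted W x1 x2 T1 T2 Y0" and q: "p \<in> W" "z p = 0" and g: "g \<in> SF"
    and l: "(l = x1 \<and> T2 g p \<noteq> 0) \<or> (l = x2 \<and> T1 g p \<noteq> 0)"
  shows "\<forall>V\<in>VF. V z p = 0 \<longrightarrow> V g p = 0 \<longrightarrow> V l p = 0 \<longrightarrow> (\<forall>h\<in>SF. V h p = 0)"
proof (intro ballI impI)
  fix V h assume V: "V \<in> VF" "V z p = 0" "V g p = 0" "V l p = 0" and h: "h \<in> SF"
  note ad = adaptedD[OF a]
  have "V x1 p * T1 g p + V x2 p * T2 g p = 0" using ad(17)[OF V(1) g q(1)] V(2,3) by simp
  then have "V x1 p = 0 \<and> V x2 p = 0" using l V(4) by auto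
  then show "V h p = 0" using ad(17)[OF V(1) h q(1)] V(2) by simp
qed

text \<open>
  In the coordinates \<open>z\<close>, \<open>u\<close>, \<open>l\<close>, where \<open>l\<close> is $x_1$ or $x_2$ up to sign, the level is the
  coordinate line \<open>\<kappa>\<close> with parameter \<open>l\<close>. The Reeb field kills \<open>z\<close> and \<open>u\<close> there, so its
  flow on the line is an autonomous equation in one variable, which \<open>autonomous_flow_1d\<close>
  solves.
\<close>

lemma regular_flow_box:
  assumes p: "p \<in> Z" "p \<notin> Crit"
  shows "\<exists>N N' \<delta> \<tau> \<sigma>. flow_box Reeb {q \<in> Z. u q = u p} N N' \<delta> \<tau> \<sigma> \<and> p \<in> N'"
proof -
  let ?L = "{q \<in> Z. u q = u p}"
  have zp: "z p = 0" using p(1) Z_iff by blast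
  obtain W x1 x2 T1 T2 Y0 where a: "adapted W x1 x2 T1 T2 Y0" "p \<in> W" using adapted_exists[OF zp] .
  note ad = adaptedD[OF a(1)]
  let ?w = "u p * \<omega> T1 T2 p + \<alpha> T1 p * T2 u p - \<alpha> T2 p * T1 u p"
  have w: "?w \<noteq> 0" "Reeb x1 p * ?w = T2 u p" "Reeb x2 p * ?w = - T1 u p"
    using Reeb_on_Z(1)[OF a zp] Reeb_on_Z(2)[OF a zp ad(2)] Reeb_on_Z(2)[OF a zp ad(3)] ad(11-14)[OF a(2)] by simp_all
  have nc: "T1 u p \<noteq> 0 \<or> T2 u p \<noteq> 0" using Crit_iff[OF a zp] p(2) by blast
  define l0 where "l0 = (if T2 u p \<noteq> 0 then x1 else x2)"
  have l0: "l0 \<in> SF" "Reeb l0 p \<noteq> 0" using nc w ad(2,3) unfolding l0_def by auto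
  have ind0: "\<forall>V\<in>VF. V z p = 0 \<longrightarrow> V u p = 0 \<longrightarrow> V l0 p = 0 \<longrightarrow> (\<forall>h\<in>SF. V h p = 0)"
    by (rule curve_chart[OF a zp u_SF]) (use nc in \<open>auto simp: l0_def\<close>)
  \<comment> \<open>The sign makes \<open>l\<close> increase along the flow.\<close>
  define l where "l = (\<lambda>q. sgn (Reeb l0 p) * l0 q)"
  have l: "l \<in> SF" unfolding l_def by (rule SF_mult[OF SF_const l0(1)])
  have Vl: "V l q = sgn (Reeb l0 p) * V l0 q" if "V \<in> VF" for V q unfolding l_def VF_cmult[OF that l0(1)] ..
  have lp: "Reeb l p > 0" using Vl[OF Reeb_VF] l0(2) by (simp add: sgn_if)
  have ind: "\<forall>V\<in>VF. V z p = 0 \<longrightarrow> V u p = 0 \<longrightarrow> V l p = 0 \<longrightarrow> (\<forall>h\<in>SF. V h p = 0)"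
  proof -
    have "V l0 p = 0" if "V \<in> VF" "V l p = 0" for V
      using Vl[OF that(1), of p] that(2) l0(2) by (simp add: sgn_zero_iff)
    then show ?thesis using ind0 by blast
  qed
  have RlS: "Reeb l \<in> SF" by (rule VF_SF[OF Reeb_VF l])
  have W0: "open {q. Reeb l q > 0}" "p \<in> {q. Reeb l q > 0}" using SF_open_pos[OF RlS] lp by auto
  obtain W1 G \<epsilon> where cube: "cube_chart z u l p W1 \<epsilon> G" "W1 \<subseteq> {q. Reeb l q > 0}"
    using coordinate_box[OF z_SF u_SF l W0 ind] .
  note W1 = cube_chartD(1,2)[OF cube(1)] cube(2) cube_chartD(3)[OF cube(1)]
    and G1 = cube_chartD(4)[OF cube(1)] and G2 = cube_chartD(5)[OF cube(1)]
  define \<kappa> where "\<kappa> = (\<lambda>r. G (0, u p, r))"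
  have \<kappa>: "\<kappa> r \<in> W1" "z (\<kappa> r) = 0" "u (\<kappa> r) = u p" "l (\<kappa> r) = r" if "\<bar>r - l p\<bar> < \<epsilon>" for r
    using G2[rule_format, of 0 "u p" r] that zp W1(4) unfolding \<kappa>_def by simp_all
  have \<kappa>pos: "Reeb l (\<kappa> r) > 0" if "\<bar>r - l p\<bar> < \<epsilon>" for r using \<kappa>(1)[OF that] W1(3) by blast
  have \<kappa>der: "((\<lambda>r. h (\<kappa> r)) has_real_derivative Reeb h (\<kappa> r) / Reeb l (\<kappa> r)) (at r)"
    if r: "\<bar>r - l p\<bar> < \<epsilon>" and h: "h \<in> SF" for r h
  proof -
    obtain D1 D2 D3 where D: "((\<lambda>y. h (G y)) has_derivative (\<lambda>(x, y, w). D1 * x + D2 * y + D3 * w)) (at (0, u p, r))"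
      "\<forall>V\<in>VF. V h (\<kappa> r) = D1 * V z (\<kappa> r) + D2 * V u (\<kappa> r) + D3 * V l (\<kappa> r)"
      using G2[rule_format, of 0 "u p" r] r zp W1(4) h unfolding \<kappa>_def by auto
    have "((\<lambda>r. (0::real, u p, r)) has_derivative (\<lambda>t. (0, 0, t))) (at r)"
      by (auto intro!: derivative_eq_intros)
    from has_derivative_compose[OF this D(1)]
    have "((\<lambda>r. h (\<kappa> r)) has_real_derivative D3) (at r)"
      unfolding \<kappa>_def has_field_derivative_def by simp
    moreover have "Reeb h (\<kappa> r) = D3 * Reeb l (\<kappa> r)"
      using bspec[OF D(2) Reeb_VF] Reeb_tangent[OF \<kappa>(2)[OF r]] Reeb_u[OF \<kappa>(2)[OF r]] by simp
    ultimately show ?thesis using \<kappa>pos[OF r] by simp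
  qed
  have vpos: "\<forall>r. \<bar>r - l p\<bar> < \<epsilon> \<longrightarrow> isCont (\<lambda>r. Reeb l (\<kappa> r)) r \<and> Reeb l (\<kappa> r) > 0"
    using DERIV_isCont[OF \<kappa>der[OF _ RlS]] \<kappa>pos by blast
  obtain \<delta> \<theta> s e' where \<delta>: "\<delta> > 0" "0 < e'" "e' \<le> \<epsilon>" "\<theta> (l p) = 0"
    and \<theta>: "\<forall>r. \<bar>r - l p\<bar> < e' \<longrightarrow> (\<theta> has_real_derivative inverse (Reeb l (\<kappa> r))) (at r) \<and> s (\<theta> r) = r"
    and s: "\<forall>t. \<bar>t\<bar> < \<delta> \<longrightarrow> \<bar>s t - l p\<bar> < e' \<and> (s has_real_derivative Reeb l (\<kappa> (s t))) (at t)"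
    using autonomous_flow_1d[OF W1(4) vpos] .
  let ?I = "{l p - e'<..<l p + e'}"
  have \<theta>c: "continuous_on ?I \<theta>"
    using \<theta> DERIV_isCont by (intro continuous_at_imp_continuous_on ballI) (force simp: abs_less_iff)
  \<comment> \<open>A condition on the coordinate \<open>l\<close> only; on the level it selects the points that are
    reached from \<open>p\<close> within time \<open>d\<close>.\<close>
  define N where "N = (\<lambda>d. W1 \<inter> l -` (?I \<inter> \<theta> -` {-d<..<d}))"
  have No: "open (N d)" for d
  proof -
    have "open (?I \<inter> \<theta> -` {-d<..<d})" by (rule continuous_open_preimage[OF \<theta>c]) auto
    from open_vimage[OF this SF_continuous[OF l]]
    have "open (l -` (?I \<inter> \<theta> -` {-d<..<d}))" .
    then show ?thesis unfolding N_def using W1(1) by blast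
  qed
  have N: "q \<in> W1" "\<bar>l q - l p\<bar> < e'" "\<bar>\<theta> (l q)\<bar> < d" if "q \<in> N d" for q d
    using that by (auto simp: N_def abs_less_iff)
  have \<kappa>l: "\<kappa> (l q) = q" if "q \<in> N d" "q \<in> ?L" for q d
    using G1 N(1)[OF that(1)] that(2) Z_iff unfolding \<kappa>_def by fastforce
  have "flow_box Reeb ?L (N \<delta>) (N (\<delta>/2)) \<delta> (\<lambda>q. \<theta> (l q)) (\<lambda>t. \<kappa> (s t))"
    unfolding flow_box_def
  proof (intro conjI ballI allI impI)
    show "open (N \<delta>)" "open (N (\<delta>/2))" by (rule No)+
    show "N (\<delta>/2) \<subseteq> N \<delta>" using \<delta>(1) by (auto simp: N_def)
    show "0 < \<delta>" by (rule \<delta>(1))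
    show "\<bar>\<theta> (l q)\<bar> < \<delta>" "\<kappa> (s (\<theta> (l q))) = q" if "q \<in> N \<delta> \<inter> ?L" for q
      using that N[of q \<delta>] \<kappa>l[of q \<delta>] \<theta> by auto
    show "\<bar>\<theta> (l q)\<bar> < \<delta> / 2" if "q \<in> N (\<delta>/2) \<inter> ?L" for q using that N by blast
  next
    fix t assume t: "\<bar>t\<bar> < \<delta>"
    have st: "\<bar>s t - l p\<bar> < \<epsilon>" using s t \<delta>(3) by fastforce
    show "\<kappa> (s t) \<in> ?L" using \<kappa>(2,3)[OF st] Z_iff by simp
    fix h assume h: "h \<in> SF"
    have "((\<lambda>t. h (\<kappa> (s t))) has_real_derivative Reeb h (\<kappa> (s t)) / Reeb l (\<kappa> (s t)) * Reeb l (\<kappa> (s t))) (at t)"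
      by (rule DERIV_chain2[where f="\<lambda>r. h (\<kappa> r)" and g=s and x=t, OF \<kappa>der[OF st h]]) (use s t in blast)
    then show "((\<lambda>t. h (\<kappa> (s t))) has_real_derivative Reeb h (\<kappa> (s t))) (at t)" using \<kappa>pos[OF st] by simp
  next
    fix \<gamma> t assume t: "\<gamma> t \<in> N \<delta> \<inter> ?L" and d: "\<forall>h\<in>SF. ((\<lambda>s. h (\<gamma> s)) has_real_derivative Reeb h (\<gamma> t)) (at t)"
    have b: "\<kappa> (l (\<gamma> t)) = \<gamma> t" "\<bar>l (\<gamma> t) - l p\<bar> < e'" using t \<kappa>l N by blast+
    have "(\<theta> has_real_derivative inverse (Reeb l (\<gamma> t))) (at (l (\<gamma> t)))" using \<theta> b by metis
    from DERIV_chain2[where f=\<theta> and g="\<lambda>s. l (\<gamma> s)" and x=t, OF this d[rule_format, OF l]]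
    have "((\<lambda>s. \<theta> (l (\<gamma> s))) has_real_derivative inverse (Reeb l (\<gamma> t)) * Reeb l (\<gamma> t)) (at t)" .
    moreover have "Reeb l (\<gamma> t) > 0" using t N W1(3) by blast
    ultimately show "((\<lambda>s. \<theta> (l (\<gamma> s))) has_real_derivative 1) (at t)" by simp
  qed
  moreover have "p \<in> N (\<delta>/2)" using W1(2) \<delta> by (simp add: N_def)
  ultimately show ?thesis by blast
qed

lemma regular_level_orbit:
  assumes c: "p \<in> Z" "\<forall>q\<in>Z. u q = u p \<longrightarrow> q \<notin> Crit"
  obtains C where "C \<in> periodic_orbits A Reeb" "C \<subseteq> Z" "u ` C = {u p}"
proof -
  let ?L = "{q \<in> Z. u q = u p}"
  have "closed {q. u q = u p}" by (rule closed_Collect_eq[OF SF_continuous[OF u_SF] continuous_on_const])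
  then have "compact (Z \<inter> {q. u q = u p})" by (rule compact_Int_closed[OF compact_Z])
  then have cL: "compact ?L" by (simp add: Int_def)
  have "\<forall>q\<in>?L. \<exists>N N' \<delta> \<tau> \<sigma>. flow_box Reeb ?L N N' \<delta> \<tau> \<sigma> \<and> q \<in> N'"
  proof
    fix q assume q: "q \<in> ?L"
    then show "\<exists>N N' \<delta> \<tau> \<sigma>. flow_box Reeb ?L N N' \<delta> \<tau> \<sigma> \<and> q \<in> N'" using regular_flow_box[of q] c by simp
  qed
  then interpret flow_lines A Reeb ?L by unfold_locales (rule cL)
  obtain \<gamma> P where \<gamma>: "integral_curve A Reeb \<gamma>" "range \<gamma> \<subseteq> ?L" "\<gamma> 0 = p" "P > 0" "\<forall>t. \<gamma> (t + P) = \<gamma> t"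
    using periodic_curve[of p] c(1) by blast
  have zp: "z p = 0" using c(1) Z_iff by blast
  obtain W x1 x2 T1 T2 Y0 where a: "adapted W x1 x2 T1 T2 Y0" "p \<in> W" using adapted_exists[OF zp] .
  note ad = adaptedD[OF a(1)]
  have nc: "T1 u p \<noteq> 0 \<or> T2 u p \<noteq> 0" using Crit_iff[OF a zp] c by blast
  have "Reeb x1 p \<noteq> 0 \<or> Reeb x2 p \<noteq> 0"
    using Reeb_on_Z(2)[OF a zp ad(2)] Reeb_on_Z(2)[OF a zp ad(3)] ad(11-14)[OF a(2)] nc by auto
  then have "\<exists>h\<in>SF. Reeb h p \<noteq> 0" using ad(2,3) by blast
  then obtain h where h: "h \<in> SF" "Reeb h p \<noteq> 0" by blast
  have "\<exists>s t. \<gamma> s \<noteq> \<gamma> t"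
  proof (rule ccontr)
    assume "\<nexists>s t. \<gamma> s \<noteq> \<gamma> t"
    then have "(\<lambda>s. h (\<gamma> s)) = (\<lambda>s. h p)" using \<gamma>(3) by (metis (full_types))
    then have "((\<lambda>s. h p) has_real_derivative Reeb h p) (at 0)"
      using \<gamma>(1,3) h(1) unfolding integral_curve_def by metis
    then show False using h(2) DERIV_unique[OF _ DERIV_const] by blast
  qed
  then have "range \<gamma> \<in> periodic_orbits A Reeb" unfolding periodic_orbits_def using \<gamma>(1,4,5) by blast
  moreover have "u (\<gamma> t) = u p" for t using \<gamma>(2) by blast
  then have "u ` range \<gamma> = {u p}" by (simp add: image_image)
  ultimately show ?thesis using that \<gamma>(2) by blast
qed

end

section \<open>Sard's theorem on the critical surface\<close>

text \<open>
  The one-dimensional case of Sard's theorem, obtained from the theorem for maps of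
  $\mathbb{R}^n$ into itself by identifying the reals with \<open>real^1\<close>.
\<close>

lemma negligible_zero_derivative_image:
  fixes f :: "real \<Rightarrow> real"
  assumes "\<And>x. x \<in> S \<Longrightarrow> (f has_real_derivative 0) (at x)"
  shows "negligible (f ` S)"
proof -
  let ?S = "(\<lambda>x::real^1. x $ 1) -` S" and ?F = "\<lambda>x::real^1. (\<chi> i. f (x $ 1)) :: real^1"
  have "negligible (?F ` ?S)"
  proof (rule baby_Sard[where f' = "\<lambda>x v. 0"])
    fix x assume x: "x \<in> ?S"
    have "((\<lambda>x::real^1. x $ 1) has_derivative (\<lambda>v. v $ 1)) (at x)"
      by (rule bounded_linear.has_derivative[OF bounded_linear_vec_nth has_derivative_ident])
    moreover have "(f has_derivative (\<lambda>v. 0)) (at (x $ 1))"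
      using assms[of "x $ 1"] x by (auto simp: has_field_derivative_def elim!: has_derivative_eq_rhs)
    ultimately have "((\<lambda>x::real^1. f (x $ 1)) has_derivative (\<lambda>v. 0)) (at x)"
      by (rule has_derivative_compose)
    then have "(?F has_derivative (\<lambda>v. 0)) (at x)"
      by (auto simp: has_derivative_componentwise_within[of ?F] Basis_vec_def inner_axis)
    then show "(?F has_derivative (\<lambda>v. 0)) (at x within ?S)" by (rule has_derivative_at_withinI)
    have "matrix (\<lambda>v::real^1. 0::real^1) = 0" by (simp add: matrix_def vec_eq_iff)
    then show "rank (matrix (\<lambda>v::real^1. 0::real^1)) < CARD(1)" by simp
  qed simp
  then have "negligible ((\<lambda>x::real^1. x $ 1) ` (?F ` ?S))"
    by (rule negligible_differentiable_image_negligible[rotated])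
       (auto intro!: bounded_linear_imp_differentiable_on bounded_linear_vec_nth)
  moreover have "f ` S \<subseteq> (\<lambda>x::real^1. x $ 1) ` (?F ` ?S)"
  proof
    fix y assume "y \<in> f ` S"
    then obtain x where x: "x \<in> S" "y = f x" by blast
    have "(\<chi> i. x) \<in> ?S" using x by simp
    then have "?F (\<chi> i. x) \<in> ?F ` ?S" by (rule imageI)
    then have "?F (\<chi> i. x) $ 1 \<in> (\<lambda>x::real^1. x $ 1) ` (?F ` ?S)" by (rule imageI)
    then show "y \<in> (\<lambda>x::real^1. x $ 1) ` (?F ` ?S)" using x(2) by simp
  qed
  ultimately show ?thesis by (rule negligible_subset)
qed

text \<open>
  The square is divided into cells of side $l/N$. There are $O(N^2)$ of them, and the points
  of \<open>E\<close> in one cell are mapped into an interval of length $O(N^{-3})$, so the image has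
  measure $O(1/N)$.
\<close>

lemma negligible_cubic_image:
  fixes F :: "real \<times> real \<Rightarrow> real"
  assumes l: "l > 0" and E: "\<And>x. x \<in> E \<Longrightarrow> \<bar>fst x - a\<bar> \<le> l \<and> \<bar>snd x - b\<bar> \<le> l"
    and C: "C \<ge> 0" "\<And>x y. x \<in> E \<Longrightarrow> y \<in> E \<Longrightarrow> \<bar>F y - F x\<bar> \<le> C * dist x y ^ 3"
  shows "negligible (F ` E)"
  unfolding negligible_outer_le
proof (intro allI impI)
  fix e :: real assume e: "e > 0"
  \<comment> \<open>The image is covered by at most $(3N)^2$ intervals of length $2 C (2l/N)^3$.\<close>
  obtain n :: nat where n: "real n > 9 * 16 * C * l ^ 3 / e" using reals_Archimedean2 by blast
  define N where "N = Suc n"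
  have N: "real N > 0" "9 * 16 * C * l ^ 3 / real N \<le> e"
  proof -
    have "9 * 16 * C * l ^ 3 / e \<le> real N" using n by (simp add: N_def)
    then show "9 * 16 * C * l ^ 3 / real N \<le> e" using e by (simp add: N_def field_simps)
  qed (simp add: N_def)
  define cell where "cell = (\<lambda>x. (\<lfloor>real N * (fst x - a) / l\<rfloor>, \<lfloor>real N * (snd x - b) / l\<rfloor>))"
  define I where "I = {- int N..int N} \<times> {- int N..int N}"
  define r where "r = C * (2 * l / real N) ^ 3"
  have r0: "r \<ge> 0" using C(1) l by (simp add: r_def)
  have cellI: "cell x \<in> I" if "x \<in> E" for x
  proof -
    have "\<lfloor>real N * t / l\<rfloor> \<in> {- int N..int N}" if "\<bar>t\<bar> \<le> l" for t
    proof -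
      define x where "x = real N * t / l"
      have "\<bar>t / l\<bar> \<le> 1" using that l by simp
      then have "real N * \<bar>t / l\<bar> \<le> real N" by (rule mult_left_le) simp
      moreover have "x = real N * (t / l)" by (simp add: x_def)
      ultimately have "\<bar>x\<bar> \<le> real N" by (simp only: abs_mult abs_of_nat)
      then have "- real N \<le> x" "x \<le> real N" by linarith+
      then show ?thesis unfolding x_def[symmetric] by (simp add: le_floor_iff floor_le_iff)
    qed
    then show ?thesis using E[OF that] by (simp add: cell_def I_def)
  qed
  have close: "\<bar>F y - F x\<bar> \<le> r" if "x \<in> E" "y \<in> E" "cell x = cell y" for x y
  proof -
    have d: "\<bar>s - t\<bar> \<le> l / real N" if "\<lfloor>real N * (s - k) / l\<rfloor> = \<lfloor>real N * (t - k) / l\<rfloor>" for s t k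
    proof -
      have "\<bar>real N * (s - k) / l - real N * (t - k) / l\<bar> \<le> 1" using that by linarith
      moreover have "real N * (s - k) / l - real N * (t - k) / l = (s - t) * (real N / l)"
      proof -
        have "real N * (s - k) - real N * (t - k) = (s - t) * real N" by (simp add: algebra_simps)
        then show ?thesis by (simp add: diff_divide_distrib[symmetric])
      qed
      ultimately have "\<bar>s - t\<bar> * (real N / l) \<le> 1" using l N by (simp add: abs_mult)
      then show ?thesis using l N by (simp add: field_simps)
    qed
    have "dist x y \<le> \<bar>fst x - fst y\<bar> + \<bar>snd x - snd y\<bar>"
      unfolding dist_prod_def dist_real_def using sqrt_sum_squares_le_sum_abs by simp
    also have "\<dots> \<le> 2 * l / real N"
    proof -
      have "\<bar>fst x - fst y\<bar> \<le> l / real N" "\<bar>snd x - snd y\<bar> \<le> l / real N"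
        using that(3) unfolding cell_def prod.inject by (blast intro: d)+
      then show ?thesis by linarith
    qed
    finally have "dist x y ^ 3 \<le> (2 * l / real N) ^ 3" by (rule power_mono) simp
    then have "C * dist x y ^ 3 \<le> r" unfolding r_def by (rule mult_left_mono[OF _ C(1)])
    then show ?thesis using C(2)[OF that(1,2)] by linarith
  qed
  define rep where "rep = (\<lambda>i. SOME x. x \<in> E \<and> cell x = i)"
  have rep: "rep (cell x) \<in> E \<and> cell (rep (cell x)) = cell x" if "x \<in> E" for x
    unfolding rep_def by (rule someI[of _ x]) (use that in simp)
  let ?T = "\<Union>i\<in>I. cball (F (rep i)) r"
  have fI: "finite I" by (simp add: I_def)
  have sub: "F ` E \<subseteq> ?T"
  proof
    fix y assume "y \<in> F ` E"
    then obtain x where x: "x \<in> E" "y = F x" by blast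
    have "y \<in> cball (F (rep (cell x))) r"
      using close[of "rep (cell x)" x] rep[OF x(1)] x by (simp add: dist_real_def abs_minus_commute)
    then show "y \<in> ?T" using cellI[OF x(1)] by blast
  qed
  have T: "?T \<in> lmeasurable" by (intro fmeasurable.finite_UN fI) simp
  have "measure lebesgue ?T \<le> (\<Sum>i\<in>I. measure lebesgue (cball (F (rep i)) r))"
    by (rule measure_UNION_le[OF fI]) simp
  also have "\<dots> = real (card I) * (2 * r)" using r0 by (simp add: cball_eq_atLeastAtMost)
  also have "real (card I) = (2 * real N + 1)\<^sup>2"
    by (simp add: I_def card_cartesian_product power2_eq_square)
  also have "(2 * real N + 1)\<^sup>2 * (2 * r) \<le> (3 * real N)\<^sup>2 * (2 * r)"
    by (intro mult_right_mono power_mono) (use N r0 in \<open>auto simp: N_def\<close>)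
  also have "\<dots> = 9 * 16 * C * l ^ 3 / real N"
    using N(1) by (simp add: r_def field_simps power2_eq_square power3_eq_cube)
  also have "\<dots> \<le> e" by (rule N(2))
  finally show "\<exists>T. F ` E \<subseteq> T \<and> T \<in> lmeasurable \<and> measure lebesgue T \<le> e" using sub T by blast
qed

text \<open>Countably many of the neighbourhoods suffice, the topology being second countable.\<close>

lemma negligible_image_local:
  fixes S :: "'a::second_countable_topology set" and f :: "'a \<Rightarrow> 'b::euclidean_space"
  assumes "\<And>p. p \<in> S \<Longrightarrow> \<exists>W. open W \<and> p \<in> W \<and> negligible (f ` (S \<inter> W))"
  shows "negligible (f ` S)"
proof -
  let ?F = "{W. open W \<and> negligible (f ` (S \<inter> W))}"
  obtain F' where F': "F' \<subseteq> ?F" "countable F'" "\<Union>F' = \<Union>?F" using Lindelof[of ?F] by blast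
  have "f ` S \<subseteq> (\<Union>W\<in>F'. f ` (S \<inter> W))"
  proof
    fix y assume "y \<in> f ` S"
    then obtain p where p: "p \<in> S" "y = f p" by blast
    then have "p \<in> \<Union>?F" using assms by blast
    then obtain W where "W \<in> F'" "p \<in> W" using F'(3) by blast
    then show "y \<in> (\<Union>W\<in>F'. f ` (S \<inter> W))" using p by blast
  qed
  moreover have "negligible (\<Union>((\<lambda>W. f ` (S \<inter> W)) ` F'))"
    by (rule negligible_countable_Union) (use F' in auto)
  ultimately show ?thesis by (rule negligible_subset[rotated])
qed

context bm_contact_closed begin

text \<open>
  A parametrisation \<open>c\<close> of a piece of \<open>Z\<close> by a square in the coordinates $x_1, x_2$, with
  \<open>T1\<close> and \<open>T2\<close> as its coordinate fields.
\<close>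

definition surface_patch where
  "surface_patch x1 x2 T1 T2 p W \<epsilon> c \<longleftrightarrow> open W \<and> p \<in> W \<and> 0 < \<epsilon> \<and>
    (\<forall>q\<in>W \<inter> Z. \<bar>x1 q - x1 p\<bar> < \<epsilon> \<and> \<bar>x2 q - x2 p\<bar> < \<epsilon> \<and> c (x1 q, x2 q) = q) \<and>
    (\<forall>s t. \<bar>s - x1 p\<bar> < \<epsilon> \<longrightarrow> \<bar>t - x2 p\<bar> < \<epsilon> \<longrightarrow> c (s, t) \<in> W \<inter> Z \<and> x1 (c (s, t)) = s \<and> x2 (c (s, t)) = t \<and>
       (\<forall>h\<in>SF. ((\<lambda>y. h (c y)) has_derivative (\<lambda>(v, w). v * T1 h (c (s, t)) + w * T2 h (c (s, t)))) (at (s, t))))"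

lemmas surface_patchD =
  surface_patch_def[THEN iffD1, THEN conjunct1]
  surface_patch_def[THEN iffD1, THEN conjunct2, THEN conjunct1]
  surface_patch_def[THEN iffD1, THEN conjunct2, THEN conjunct2, THEN conjunct1]
  surface_patch_def[THEN iffD1, THEN conjunct2, THEN conjunct2, THEN conjunct2, THEN conjunct1]
  surface_patch_def[THEN iffD1, THEN conjunct2, THEN conjunct2, THEN conjunct2, THEN conjunct2]

text \<open>The plane \<open>z = 0\<close> in the cube given by the coordinates $z, x_1, x_2$.\<close>

lemma surface_chart:
  assumes a: "adapted W x1 x2 T1 T2 Y0" and p: "p \<in> W" "z p = 0"
  obtains W1 c \<epsilon> where "surface_patch x1 x2 T1 T2 p W1 \<epsilon> c" "W1 \<subseteq> W"
proof -
  note ad = adaptedD[OF a]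
  have ind: "\<forall>V\<in>VF. V z p = 0 \<longrightarrow> V x1 p = 0 \<longrightarrow> V x2 p = 0 \<longrightarrow> (\<forall>h\<in>SF. V h p = 0)"
  proof (intro ballI impI)
    fix V h assume "V \<in> VF" "V z p = 0" "V x1 p = 0" "V x2 p = 0" "h \<in> SF"
    then show "V h p = 0" using ad(17)[of V h p] p(1) by simp
  qed
  obtain W1 G \<epsilon> where cube: "cube_chart z x1 x2 p W1 \<epsilon> G" "W1 \<subseteq> W"
    using coordinate_box[OF z_SF ad(2,3,1) p(1) ind] .
  note W1 = cube_chartD(1,2)[OF cube(1)] cube(2) cube_chartD(3)[OF cube(1)]
    and G1 = cube_chartD(4)[OF cube(1)] and G2 = cube_chartD(5)[OF cube(1)]
  define c where "c = (\<lambda>y::real\<times>real. G (0, y))"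
  have "surface_patch x1 x2 T1 T2 p W1 \<epsilon> c"
    unfolding surface_patch_def
  proof (intro conjI W1(1,2,4))
    show "\<forall>q\<in>W1 \<inter> Z. \<bar>x1 q - x1 p\<bar> < \<epsilon> \<and> \<bar>x2 q - x2 p\<bar> < \<epsilon> \<and> c (x1 q, x2 q) = q"
    proof
      fix q assume q: "q \<in> W1 \<inter> Z"
      then have "z q = 0" using Z_iff by blast
      then show "\<bar>x1 q - x1 p\<bar> < \<epsilon> \<and> \<bar>x2 q - x2 p\<bar> < \<epsilon> \<and> c (x1 q, x2 q) = q"
        using bspec[OF G1, of q] q by (simp add: c_def)
    qed
    show "\<forall>s t. \<bar>s - x1 p\<bar> < \<epsilon> \<longrightarrow> \<bar>t - x2 p\<bar> < \<epsilon> \<longrightarrow> c (s, t) \<in> W1 \<inter> Z \<and> x1 (c (s, t)) = s \<and> x2 (c (s, t)) = t \<and>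
       (\<forall>h\<in>SF. ((\<lambda>y. h (c y)) has_derivative (\<lambda>(v, w). v * T1 h (c (s, t)) + w * T2 h (c (s, t)))) (at (s, t)))"
    proof (intro allI impI)
      fix s t assume st: "\<bar>s - x1 p\<bar> < \<epsilon>" "\<bar>t - x2 p\<bar> < \<epsilon>"
      let ?q = "G (0, s, t)"
      have q: "?q \<in> W1" "z ?q = 0" "x1 ?q = s" "x2 ?q = t"
        and D: "\<forall>h\<in>SF. \<exists>D1 D2 D3. ((\<lambda>y. h (G y)) has_derivative (\<lambda>(x, y, w). D1 * x + D2 * y + D3 * w)) (at (0, s, t)) \<and>
          (\<forall>V\<in>VF. V h ?q = D1 * V z ?q + D2 * V x1 ?q + D3 * V x2 ?q)"
        using G2[rule_format, of 0 s t] st p(2) W1(4) by simp_all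
      have qW: "?q \<in> W" using q(1) W1(3) by blast
      have "((\<lambda>y. h (c y)) has_derivative (\<lambda>(v, w). v * T1 h ?q + w * T2 h ?q)) (at (s, t))" if h: "h \<in> SF" for h
      proof -
        obtain D1 D2 D3 where d: "((\<lambda>y. h (G y)) has_derivative (\<lambda>(x, y, w). D1 * x + D2 * y + D3 * w)) (at (0, s, t))"
          "\<forall>V\<in>VF. V h ?q = D1 * V z ?q + D2 * V x1 ?q + D3 * V x2 ?q"
          using D h by blast
        have "T1 h ?q = D2" "T2 h ?q = D3"
          using bspec[OF d(2) ad(4)] bspec[OF d(2) ad(5)] ad(7,8) ad(11-14)[OF qW] by simp_all
        moreover have "((\<lambda>y. (0::real, y)) has_derivative (\<lambda>y. (0, y))) (at (s, t))"
          by (auto intro!: derivative_eq_intros)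
        from has_derivative_compose[OF this d(1)]
        have "((\<lambda>y. h (c y)) has_derivative (\<lambda>y. case (0, y) of (x, y, w) \<Rightarrow> D1 * x + D2 * y + D3 * w)) (at (s, t))"
          unfolding c_def .
        ultimately show ?thesis by (simp add: case_prod_unfold mult.commute)
      qed
      then show "c (s, t) \<in> W1 \<inter> Z \<and> x1 (c (s, t)) = s \<and> x2 (c (s, t)) = t \<and>
       (\<forall>h\<in>SF. ((\<lambda>y. h (c y)) has_derivative (\<lambda>(v, w). v * T1 h (c (s, t)) + w * T2 h (c (s, t)))) (at (s, t)))"
        using q Z_iff by (simp add: c_def)
    qed
  qed
  then show ?thesis using W1(3) by (rule that)
qed

text \<open>
  If a second derivative of \<open>u\<close> along \<open>Z\<close> is nonzero at \<open>p\<close>, the critical points near \<open>p\<close>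
  lie on the curve in \<open>Z\<close> where the first derivative \<open>T u\<close> is zero. Along this curve \<open>u\<close> has
  derivative zero at the critical points, and the one-dimensional case applies.
\<close>

lemma Crit_image_nonflat:
  assumes a: "adapted W x1 x2 T1 T2 Y0" and p: "p \<in> W" "p \<in> Crit"
    and T: "T \<in> {T1, T2}" and nf: "T1 (T u) p \<noteq> 0 \<or> T2 (T u) p \<noteq> 0"
  shows "\<exists>W. open W \<and> p \<in> W \<and> negligible (u ` (Crit \<inter> W))"
proof -
  note ad = adaptedD[OF a]
  have zp: "z p = 0" using p(2) Z_iff unfolding Crit_def by blast
  have TV: "T \<in> VF" using T ad by blast
  define g where "g = T u"
  have g: "g \<in> SF" unfolding g_def by (rule VF_SF[OF TV u_SF])
  have gC: "g q = 0" if "q \<in> W" "q \<in> Crit" for q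
  proof -
    have "z q = 0" using that(2) Z_iff unfolding Crit_def by blast
    then show ?thesis using Crit_iff[OF a that(1)] that(2) T unfolding g_def by blast
  qed
  obtain S S' l where S: "S \<in> VF" "S' \<in> VF" "\<And>q. S z q = 0" "\<And>q. S' z q = 0" "l \<in> SF" "S g p \<noteq> 0"
      "\<And>q. q \<in> W \<Longrightarrow> S l q = 0" "\<And>q. q \<in> W \<Longrightarrow> S' l q = 1"
      "(l = x1 \<and> T2 g p \<noteq> 0) \<or> (l = x2 \<and> T1 g p \<noteq> 0)"
  proof (cases "T2 g p = 0")
    case True
    then show ?thesis using that[of T1 T2 x2] nf ad unfolding g_def[symmetric] by blast
  next
    case False
    then show ?thesis using that[of T2 T1 x1] ad by blast
  qed
  have SgS: "S g \<in> SF" by (rule VF_SF[OF S(1) g])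
  have W0: "open (W \<inter> {q. S g q \<noteq> 0})" "p \<in> W \<inter> {q. S g q \<noteq> 0}"
    using ad(1) SF_open_nonzero[OF SgS] p(1) S(6) by auto
  have gp: "g p = 0" by (rule gC[OF p])
  obtain W1 G \<epsilon> where cube: "cube_chart z g l p W1 \<epsilon> G" "W1 \<subseteq> W \<inter> {q. S g q \<noteq> 0}"
    using coordinate_box[OF z_SF g S(5) W0 curve_chart[OF a p(1) zp g S(9)]] .
  note W1 = cube_chartD(1,2)[OF cube(1)] cube(2) cube_chartD(3)[OF cube(1)]
    and G1 = cube_chartD(4)[OF cube(1)] and G2 = cube_chartD(5)[OF cube(1)]
  define \<kappa> where "\<kappa> = (\<lambda>r. G (0, 0, r))"
  let ?R = "l ` (Crit \<inter> W1)"
  have eq: "\<kappa> (l q) = q" "\<bar>l q - l p\<bar> < \<epsilon>" if "q \<in> Crit \<inter> W1" for q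
  proof -
    have "z q = 0" using that Z_iff unfolding Crit_def by blast
    moreover have "g q = 0" using gC that W1(3) by blast
    ultimately show "\<kappa> (l q) = q" "\<bar>l q - l p\<bar> < \<epsilon>" using bspec[OF G1, of q] that unfolding \<kappa>_def by auto
  qed
  have "((\<lambda>r. u (\<kappa> r)) has_real_derivative 0) (at r)" if r: "r \<in> ?R" for r
  proof -
    obtain q where q: "q \<in> Crit \<inter> W1" "r = l q" using r by blast
    have kq: "G (0, 0, r) = q" using eq(1)[OF q(1)] q(2) unfolding \<kappa>_def by simp
    obtain D1 D2 D3 where d: "((\<lambda>y. u (G y)) has_derivative (\<lambda>(x, y, w). D1 * x + D2 * y + D3 * w)) (at (0, 0, r))"
      "\<forall>V\<in>VF. V u q = D1 * V z q + D2 * V g q + D3 * V l q"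
      using G2[rule_format, of 0 0 r] eq(2)[OF q(1)] q(2) zp gp W1(4) u_SF kq by auto
    have qW: "q \<in> W" "S g q \<noteq> 0" using q(1) W1(3) by auto
    have Vu: "S u q = 0" "S' u q = 0" using q(1) S(1-4) unfolding Crit_def by auto
    have "D2 = 0" using bspec[OF d(2) S(1)] Vu(1) S(3) S(7)[OF qW(1)] qW(2) by simp
    then have "D3 = 0" using bspec[OF d(2) S(2)] Vu(2) S(4) S(8)[OF qW(1)] by simp
    moreover have "((\<lambda>r. (0::real, 0::real, r)) has_derivative (\<lambda>t. (0, 0, t))) (at r)"
      by (auto intro!: derivative_eq_intros)
    from has_derivative_compose[OF this d(1)]
    have "((\<lambda>r. u (\<kappa> r)) has_real_derivative D3) (at r)"
      unfolding \<kappa>_def has_field_derivative_def by simp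
    ultimately show ?thesis by simp
  qed
  then have "negligible ((\<lambda>r. u (\<kappa> r)) ` ?R)" by (rule negligible_zero_derivative_image)
  moreover have "u ` (Crit \<inter> W1) \<subseteq> (\<lambda>r. u (\<kappa> r)) ` ?R"
  proof
    fix y assume "y \<in> u ` (Crit \<inter> W1)"
    then obtain q where q: "q \<in> Crit \<inter> W1" "y = u q" by blast
    then have "y = u (\<kappa> (l q))" using eq(1) by simp
    then show "y \<in> (\<lambda>r. u (\<kappa> r)) ` ?R" using q(1) by blast
  qed
  ultimately have "negligible (u ` (Crit \<inter> W1))" by (rule negligible_subset)
  then show ?thesis using W1(1,2) by blast
qed

text \<open>
  Where the first and second derivatives of \<open>u\<close> along \<open>Z\<close> vanish, \<open>u\<close> varies at most like
  the cube of the distance. The bound on the third derivatives is integrated three times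
  along segments (\<open>step\<close>).
\<close>

lemma Crit_image_flat:
  assumes a: "adapted W x1 x2 T1 T2 Y0" and p: "p \<in> W" "z p = 0"
  shows "\<exists>W'. open W' \<and> p \<in> W' \<and> W' \<subseteq> W \<and>
    negligible (u ` {q \<in> Crit \<inter> W'. \<forall>S\<in>{T1, T2}. \<forall>T\<in>{T1, T2}. S (T u) q = 0})"
proof -
  note ad = adaptedD[OF a]
  obtain W1 c \<epsilon> where patch: "surface_patch x1 x2 T1 T2 p W1 \<epsilon> c" "W1 \<subseteq> W"
    using surface_chart[OF a p] .
  note W1 = surface_patchD(1,2)[OF patch(1)] patch(2) surface_patchD(3)[OF patch(1)]
    and c1 = surface_patchD(4)[OF patch(1)] and c2 = surface_patchD(5)[OF patch(1)]
  define l where "l = \<epsilon> / 2"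
  have l: "l > 0" "l < \<epsilon>" using W1(4) by (auto simp: l_def)
  define Q where "Q = cbox (x1 p - l) (x1 p + l) \<times> cbox (x2 p - l) (x2 p + l)"
  have Qin: "\<bar>fst y - x1 p\<bar> \<le> l \<and> \<bar>snd y - x2 p\<bar> \<le> l" if "y \<in> Q" for y
    using that by (auto simp: Q_def abs_le_iff)
  have Qc: "compact Q" "convex Q" unfolding Q_def by (auto intro!: compact_Times convex_Times)
  have der: "((\<lambda>y. h (c y)) has_derivative (\<lambda>v. fst v * T1 h (c y) + snd v * T2 h (c y))) (at y)"
    if "y \<in> Q" "h \<in> SF" for y h
    using c2[rule_format, of "fst y" "snd y"] Qin[OF that(1)] l that(2) by (simp add: case_prod_unfold)
  have T: "T1 h \<in> SF" "T2 h \<in> SF" if "h \<in> SF" for h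
    by (rule VF_SF[OF ad(4) that], rule VF_SF[OF ad(5) that])
  have bounded: "\<exists>M\<ge>0. \<forall>y\<in>Q. \<bar>h (c y)\<bar> \<le> M" if h: "h \<in> SF" for h
  proof -
    have "continuous_on Q (\<lambda>y. h (c y))"
      using has_derivative_continuous[OF der[OF _ h]] by (intro continuous_at_imp_continuous_on ballI)
    then have "bounded ((\<lambda>y. h (c y)) ` Q)" by (rule compact_imp_bounded[OF compact_continuous_image[OF _ Qc(1)]])
    then obtain M where "\<forall>x\<in>(\<lambda>y. h (c y)) ` Q. norm x \<le> M" unfolding bounded_iff by blast
    then show ?thesis by (intro exI[of _ "max M 0"]) force
  qed
  have step: "\<bar>h (c y) - h (c x)\<bar> \<le> 2 * K * dist x y ^ Suc n"
    if h: "h \<in> SF" and K: "K \<ge> 0" and x: "x \<in> Q" "y \<in> Q"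
      and b: "\<And>y. y \<in> Q \<Longrightarrow> \<bar>T1 h (c y)\<bar> \<le> K * dist x y ^ n \<and> \<bar>T2 h (c y)\<bar> \<le> K * dist x y ^ n" for h K n x y
  proof -
    let ?S = "closed_segment x y" and ?B = "2 * (K * dist x y ^ n)"
    have SQ: "?S \<subseteq> Q" by (rule closed_segment_subset[OF x Qc(2)])
    have "norm (h (c y) - h (c x)) \<le> ?B * norm (y - x)"
    proof (rule differentiable_bound[where S="?S" and f="\<lambda>y. h (c y)" and f'="\<lambda>y v. fst v * T1 h (c y) + snd v * T2 h (c y)"])
      fix w assume w: "w \<in> ?S"
      then have wQ: "w \<in> Q" using SQ by blast
      show "((\<lambda>y. h (c y)) has_derivative (\<lambda>v. fst v * T1 h (c w) + snd v * T2 h (c w))) (at w within ?S)"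
        by (rule has_derivative_at_withinI[OF der[OF wQ h]])
      have "dist x w \<le> dist x y" using w segment_bound1[of w x y] by (simp add: dist_norm norm_minus_commute)
      then have "K * dist x w ^ n \<le> K * dist x y ^ n" by (intro mult_left_mono power_mono K) simp_all
      then have T1T2: "\<bar>T1 h (c w)\<bar> \<le> K * dist x y ^ n" "\<bar>T2 h (c w)\<bar> \<le> K * dist x y ^ n" using b[OF wQ] by auto
      show "onorm (\<lambda>v. fst v * T1 h (c w) + snd v * T2 h (c w)) \<le> ?B"
      proof (rule onorm_le)
        fix v :: "real \<times> real"
        have "\<bar>fst v\<bar> \<le> norm v" "\<bar>snd v\<bar> \<le> norm v" using norm_fst_le[of "fst v" "snd v"] norm_snd_le[of "snd v" "fst v"] by simp_all
        then have "\<bar>fst v * T1 h (c w)\<bar> \<le> norm v * (K * dist x y ^ n)" "\<bar>snd v * T2 h (c w)\<bar> \<le> norm v * (K * dist x y ^ n)"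
          unfolding abs_mult using T1T2 by (intro mult_mono; simp)+
        then show "norm (fst v * T1 h (c w) + snd v * T2 h (c w)) \<le> ?B * norm v" by (simp add: algebra_simps)
      qed
    qed (simp_all)
    also have "?B * norm (y - x) = 2 * K * dist x y ^ Suc n" by (simp add: dist_norm norm_minus_commute mult.commute)
    finally show ?thesis by simp
  qed
  have "\<exists>M\<ge>0. \<forall>y\<in>Q. \<forall>S\<in>{T1, T2}. \<forall>T\<in>{T1, T2}. \<forall>T'\<in>{T1, T2}. \<bar>S (T (T' u)) (c y)\<bar> \<le> M"
  proof -
    have b: "\<exists>M\<ge>0. \<forall>y\<in>Q. \<bar>S (T (T' u)) (c y)\<bar> \<le> M" if "S \<in> {T1, T2}" "T \<in> {T1, T2}" "T' \<in> {T1, T2}" for S T T'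
    proof -
      have "S \<in> VF" "T \<in> VF" "T' \<in> VF" using that ad(4,5) by auto
      from bounded[OF VF_SF[OF this(1) VF_SF[OF this(2) VF_SF[OF this(3) u_SF]]]] show ?thesis .
    qed
    then obtain M where M: "\<And>S T T'. S \<in> {T1, T2} \<Longrightarrow> T \<in> {T1, T2} \<Longrightarrow> T' \<in> {T1, T2} \<Longrightarrow>
        M S T T' \<ge> 0 \<and> (\<forall>y\<in>Q. \<bar>S (T (T' u)) (c y)\<bar> \<le> M S T T')" by metis
    let ?I = "{T1, T2} \<times> {T1, T2} \<times> {T1, T2}"
    let ?M = "\<Sum>(S, T, T')\<in>?I. M S T T'"
    have le: "M S T T' \<le> ?M" if "S \<in> {T1, T2}" "T \<in> {T1, T2}" "T' \<in> {T1, T2}" for S T T'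
      using member_le_sum[of "(S, T, T')" ?I "\<lambda>(S, T, T'). M S T T'"] that M by auto
    have "?M \<ge> 0" using le[of T1 T1 T1] M[of T1 T1 T1] by auto
    moreover have "\<bar>S (T (T' u)) (c y)\<bar> \<le> ?M" if "y \<in> Q" "S \<in> {T1, T2}" "T \<in> {T1, T2}" "T' \<in> {T1, T2}" for y S T T'
      using le[OF that(2-4)] M[OF that(2-4)] that(1) by force
    ultimately show ?thesis by blast
  qed
  then obtain M where M: "M \<ge> 0" "\<And>y S T T'. y \<in> Q \<Longrightarrow> S \<in> {T1, T2} \<Longrightarrow> T \<in> {T1, T2} \<Longrightarrow> T' \<in> {T1, T2} \<Longrightarrow>
      \<bar>S (T (T' u)) (c y)\<bar> \<le> M" by blast
  define W' where "W' = W1 \<inter> {q. \<bar>x1 q - x1 p\<bar> < l} \<inter> {q. \<bar>x2 q - x2 p\<bar> < l}"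
  have op: "open {q. \<bar>g q - g p\<bar> < l}" if "g \<in> SF" for g
    by (intro open_Collect_less continuous_intros SF_continuous[OF that])
  have W': "open W'" "p \<in> W'" "W' \<subseteq> W" unfolding W'_def using W1 op ad(2,3) l by auto
  let ?flat = "{q \<in> Crit \<inter> W'. \<forall>S\<in>{T1, T2}. \<forall>T\<in>{T1, T2}. S (T u) q = 0}"
  let ?E = "{y \<in> Q. c y \<in> ?flat}"
  have "negligible ((\<lambda>y. u (c y)) ` ?E)"
  proof (rule negligible_cubic_image[OF l(1), where a="x1 p" and b="x2 p" and C="8 * M"])
    show "\<bar>fst y - x1 p\<bar> \<le> l \<and> \<bar>snd y - x2 p\<bar> \<le> l" if "y \<in> ?E" for y using Qin that by blast
    show "0 \<le> 8 * M" using M(1) by simp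
    fix x y assume x: "x \<in> ?E" and y: "y \<in> ?E"
    then have xQ: "x \<in> Q" and yQ: "y \<in> Q" by auto
    have f2: "S (T u) (c x) = 0" if "S \<in> {T1, T2}" "T \<in> {T1, T2}" for S T using x that by blast
    have cx: "c x \<in> W" "c x \<in> Crit" using x W'(3) by auto
    have "z (c x) = 0" using cx(2) Z_iff unfolding Crit_def by blast
    then have f1: "T u (c x) = 0" if "T \<in> {T1, T2}" for T using Crit_iff[OF a cx(1)] cx(2) that by blast
    have TS: "T u \<in> SF" "S (T u) \<in> SF" if "S \<in> {T1, T2}" "T \<in> {T1, T2}" for S T
      using T[OF u_SF] T[OF T(1)[OF u_SF]] T[OF T(2)[OF u_SF]] that by auto
    have b2: "\<bar>S (T u) (c y)\<bar> \<le> 2 * M * dist x y ^ 1" if "S \<in> {T1, T2}" "T \<in> {T1, T2}" "y \<in> Q" for S T y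
    proof -
      have "\<bar>S (T u) (c y) - S (T u) (c x)\<bar> \<le> 2 * M * dist x y ^ Suc 0"
        by (rule step[OF TS(2)[OF that(1,2)] M(1) xQ that(3)]) (use M(2) that(1,2) in auto)
      then show ?thesis using f2[OF that(1,2)] by simp
    qed
    have b1: "\<bar>T u (c y)\<bar> \<le> 4 * M * dist x y ^ 2" if "T \<in> {T1, T2}" "y \<in> Q" for T y
    proof -
      have "\<bar>T u (c y) - T u (c x)\<bar> \<le> 2 * (2 * M) * dist x y ^ Suc 1"
        by (rule step[OF TS(1)[OF that(1,1)] _ xQ that(2)]) (use M(1) b2 that(1) in auto)
      then show ?thesis using f1[OF that(1)] by (simp add: numeral_2_eq_2)
    qed
    have "\<bar>u (c y) - u (c x)\<bar> \<le> 2 * (4 * M) * dist x y ^ Suc 2"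
      by (rule step[OF u_SF _ xQ yQ]) (use M(1) b1 in auto)
    then show "\<bar>u (c y) - u (c x)\<bar> \<le> 8 * M * dist x y ^ 3" by (simp add: numeral_3_eq_3 numeral_2_eq_2)
  qed
  moreover have "u ` ?flat \<subseteq> (\<lambda>y. u (c y)) ` ?E"
  proof
    fix v assume "v \<in> u ` ?flat"
    then obtain q where q: "q \<in> ?flat" "v = u q" by blast
    have "q \<in> W1 \<inter> Z" using q(1) unfolding W'_def Crit_def by blast
    then have cq: "c (x1 q, x2 q) = q" using c1 by blast
    have "(x1 q, x2 q) \<in> Q" using q(1) unfolding W'_def Q_def by (auto simp: abs_less_iff)
    then have "(x1 q, x2 q) \<in> ?E" using q(1) cq by simp
    moreover have "v = u (c (x1 q, x2 q))" using q(2) cq by simp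
    ultimately show "v \<in> (\<lambda>y. u (c y)) ` ?E" by (rule image_eqI[rotated])
  qed
  ultimately have "negligible (u ` ?flat)" by (rule negligible_subset)
  then show ?thesis using W' by blast
qed

text \<open>
  Near \<open>p\<close> the critical points with vanishing second derivatives are treated together; each
  of the others has a neighbourhood in which the critical values form a null set.
\<close>

theorem sard: "negligible (u ` Crit)"
proof (rule negligible_image_local)
  fix p assume p: "p \<in> Crit"
  have zp: "z p = 0" using p Z_iff unfolding Crit_def by blast
  obtain W x1 x2 T1 T2 Y0 where a: "adapted W x1 x2 T1 T2 Y0" "p \<in> W" using adapted_exists[OF zp] .
  let ?fl = "\<lambda>q. \<forall>S\<in>{T1, T2}. \<forall>T\<in>{T1, T2}. S (T u) q = 0"
  obtain W' where W': "open W'" "p \<in> W'" "W' \<subseteq> W" "negligible (u ` {q \<in> Crit \<inter> W'. ?fl q})"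
    using Crit_image_flat[OF a zp] by blast
  have "negligible (u ` {q \<in> Crit \<inter> W'. \<not> ?fl q})"
  proof (rule negligible_image_local)
    fix q assume q: "q \<in> {q \<in> Crit \<inter> W'. \<not> ?fl q}"
    then obtain T where T: "T \<in> {T1, T2}" "T1 (T u) q \<noteq> 0 \<or> T2 (T u) q \<noteq> 0" by blast
    have "q \<in> W" "q \<in> Crit" using q W'(3) by auto
    then obtain V where V: "open V" "q \<in> V" "negligible (u ` (Crit \<inter> V))"
      using Crit_image_nonflat[OF a(1) _ _ T] by blast
    have "negligible (u ` ({q \<in> Crit \<inter> W'. \<not> ?fl q} \<inter> V))"
      by (rule negligible_subset[OF V(3)]) blast
    then show "\<exists>V. open V \<and> q \<in> V \<and> negligible (u ` ({q \<in> Crit \<inter> W'. \<not> ?fl q} \<inter> V))"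
      using V(1,2) by blast
  qed
  then have "negligible (u ` {q \<in> Crit \<inter> W'. ?fl q} \<union> u ` {q \<in> Crit \<inter> W'. \<not> ?fl q})"
    by (rule negligible_Un[OF W'(4)])
  then have "negligible (u ` (Crit \<inter> W'))" by (rule negligible_subset) blast
  then show "\<exists>W. open W \<and> p \<in> W \<and> negligible (u ` (Crit \<inter> W))" using W'(1,2) by blast
qed

text \<open>
  Along the \<open>u\<close>-axis of a coordinate cube \<open>z\<close>, \<open>u\<close>, \<open>l\<close> at \<open>p\<close>, the function \<open>u\<close> takes all
  values of an interval on \<open>Z\<close>. By Sard's theorem infinitely many of them are regular, and
  each of these carries an orbit.
\<close>

lemma infinitely_many_orbits:
  assumes p: "p \<in> Z" "p \<notin> Crit"
  shows "infinite {C \<in> periodic_orbits A Reeb. C \<subseteq> Z}"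
proof -
  have zp: "z p = 0" using p(1) Z_iff by blast
  obtain W x1 x2 T1 T2 Y0 where a: "adapted W x1 x2 T1 T2 Y0" "p \<in> W" using adapted_exists[OF zp] .
  note ad = adaptedD[OF a(1)]
  have nc: "T1 u p \<noteq> 0 \<or> T2 u p \<noteq> 0" using Crit_iff[OF a zp] p(2) by blast
  define l where "l = (if T2 u p \<noteq> 0 then x1 else x2)"
  have l: "l \<in> SF" using ad(2,3) unfolding l_def by auto
  have ind: "\<forall>V\<in>VF. V z p = 0 \<longrightarrow> V u p = 0 \<longrightarrow> V l p = 0 \<longrightarrow> (\<forall>h\<in>SF. V h p = 0)"
    by (rule curve_chart[OF a zp u_SF]) (use nc in \<open>auto simp: l_def\<close>)
  obtain W1 G \<epsilon> where cube: "cube_chart z u l p W1 \<epsilon> G" "W1 \<subseteq> W"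
    using coordinate_box[OF z_SF u_SF l ad(1) a(2) ind] .
  note W1 = cube_chartD(1,2)[OF cube(1)] cube(2) cube_chartD(3)[OF cube(1)]
    and G1 = cube_chartD(4)[OF cube(1)] and G2 = cube_chartD(5)[OF cube(1)]
  define V where "V = {u p - \<epsilon><..<u p + \<epsilon>} - u ` Crit"
  have "\<exists>C. C \<in> periodic_orbits A Reeb \<and> C \<subseteq> Z \<and> u ` C = {c}" if c: "c \<in> V" for c
  proof -
    let ?q = "G (0, c, l p)"
    have "\<bar>c - u p\<bar> < \<epsilon>" using c by (auto simp: V_def abs_less_iff)
    then have q: "z ?q = 0" "u ?q = c" using G2[rule_format, of 0 c "l p"] zp W1(4) by simp_all
    have "?q \<in> Z" using q(1) Z_iff by blast
    moreover have "\<forall>q\<in>Z. u q = u ?q \<longrightarrow> q \<notin> Crit" using c q(2) unfolding V_def by auto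
    ultimately show ?thesis using regular_level_orbit[of ?q] q(2) by metis
  qed
  then obtain orb where orb: "\<And>c. c \<in> V \<Longrightarrow> orb c \<in> periodic_orbits A Reeb \<and> orb c \<subseteq> Z \<and> u ` orb c = {c}"
    by metis
  have inj: "inj_on orb V"
  proof (rule inj_onI)
    fix c d assume cd: "c \<in> V" "d \<in> V" "orb c = orb d"
    have "{c} = u ` orb c" using orb[OF cd(1)] by (elim conjE) (rule sym)
    also have "\<dots> = u ` orb d" unfolding cd(3) ..
    also have "\<dots> = {d}" using orb[OF cd(2)] by (elim conjE)
    finally show "c = d" by (rule singleton_inject)
  qed
  have "infinite V"
  proof
    assume "finite V"
    then have "negligible (V \<union> u ` Crit)" by (intro negligible_Un negligible_finite sard)
    then have "negligible {u p - \<epsilon><..<u p + \<epsilon>}" by (rule negligible_subset) (auto simp: V_def)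
    moreover have "u p \<in> {u p - \<epsilon><..<u p + \<epsilon>}" using W1(4) by simp
    ultimately show False using open_not_negligible[OF open_greaterThanLessThan, of "u p - \<epsilon>" "u p + \<epsilon>"] by blast
  qed
  then have "infinite (orb ` V)" using finite_imageD[OF _ inj] by blast
  moreover have "orb ` V \<subseteq> {C \<in> periodic_orbits A Reeb. C \<subseteq> Z}" using orb by blast
  ultimately show ?thesis using infinite_super by blast
qed

end

section \<open>Integration over the critical surface\<close>

lemma continuous_compact_support_integrable:
  fixes F :: "'b::euclidean_space \<Rightarrow> real"
  assumes "continuous_on UNIV F" "compact C" "\<And>y. y \<notin> C \<Longrightarrow> F y = 0"
  shows "F absolutely_integrable_on UNIV"
proof -
  obtain a where a: "C \<subseteq> cbox (-a) a" using bounded_subset_cbox_symmetric compact_imp_bounded[OF assms(2)] by blast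
  have "F absolutely_integrable_on cbox (-a) a"
    by (rule absolutely_integrable_continuous[OF continuous_on_subset[OF assms(1)]]) simp
  moreover have "(\<lambda>x. if x \<in> cbox (-a) a then F x else 0) = F" using a assms(3) by (auto simp: fun_eq_iff)
  ultimately show ?thesis using absolutely_integrable_restrict_UNIV[of "cbox (-a) a" F] by simp
qed

lemma continuous_compact_support_integral_pos:
  fixes F :: "'b::euclidean_space \<Rightarrow> real"
  assumes "continuous_on UNIV F" "compact C" "\<And>y. y \<notin> C \<Longrightarrow> F y = 0" "\<And>y. 0 \<le> F y" "F y0 > 0"
  shows "integral UNIV F > 0"
proof (rule ccontr)
  have "bounded (insert y0 C)" using compact_imp_bounded[OF assms(2)] by simp
  then obtain a where a: "insert y0 C \<subseteq> box (-a) a" using bounded_subset_box_symmetric by blast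
  have "C \<subseteq> cbox (-a) a" using a box_subset_cbox by blast
  then have "(\<lambda>x. if x \<in> cbox (-a) a then F x else 0) = F" using assms(3) by (auto simp: fun_eq_iff)
  then have e: "integral UNIV F = integral (cbox (-a) a) F" using Henstock_Kurzweil_Integration.integral_restrict_UNIV[of "cbox (-a) a" F] by simp
  have c: "continuous_on (cbox (-a) a) F" by (rule continuous_on_subset[OF assms(1)]) simp
  assume "\<not> integral UNIV F > 0"
  moreover have "integral (cbox (-a) a) F \<ge> 0" by (rule integral_nonneg[OF integrable_continuous[OF c]]) (rule assms(4))
  ultimately have "integral (cbox (-a) a) F = 0" using e by linarith
  then have "(F has_integral 0) (cbox (-a) a)" using integrable_integral[OF integrable_continuous[OF c]] by simp
  then have "F y0 = 0"
    by (rule has_integral_0_cbox_imp_0[OF c assms(4)]) (use a box_subset_cbox in auto)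
  then show False using assms(5) by simp
qed

text \<open>
  The case \<open>n = 1\<close> of the transformation formula for functions with values in
  $\mathbb{R}^n$.
\<close>

lemma change_of_variables_real_valued:
  fixes f :: "real^2 \<Rightarrow> real" and g :: "real^2 \<Rightarrow> real^2"
  assumes "open S" "\<And>x. x \<in> S \<Longrightarrow> (g has_derivative g' x) (at x)" "inj_on g S" "f absolutely_integrable_on (g ` S)"
  shows "integral S (\<lambda>x. \<bar>det (matrix (g' x))\<bar> * f (g x)) = integral (g ` S) f"
proof -
  let ?f = "\<lambda>x. vec (f x) :: real^1"
  have "?f absolutely_integrable_on (g ` S)"
    using assms(4) by (simp add: absolutely_integrable_on_1_iff)
  then have "integral S (\<lambda>x. \<bar>det (matrix (g' x))\<bar> *\<^sub>R ?f (g x)) = integral (g ` S) ?f"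
    using has_absolute_integral_change_of_variables[of S g g' ?f "integral (g ` S) ?f"] assms(1-3)
    by (auto intro: has_derivative_at_withinI)
  then have "integral S (\<lambda>x. \<bar>det (matrix (g' x))\<bar> *\<^sub>R ?f (g x)) $ 1 = integral (g ` S) ?f $ 1" by simp
  then show ?thesis by (simp add: integral_on_1_eq)
qed

lemma integral_translate:
  fixes F :: "real^2 \<Rightarrow> real"
  assumes "F absolutely_integrable_on UNIV"
  shows "integral UNIV (\<lambda>y. F (y + e)) = integral UNIV F"
proof -
  have r: "range (\<lambda>y. y + e) = UNIV" by (metis diff_add_cancel surjI surj_def)
  have m: "matrix (\<lambda>v::real^2. v) = mat 1" by (simp add: matrix_def mat_def axis_def vec_eq_iff)
  have "integral UNIV (\<lambda>y. \<bar>det (matrix (\<lambda>v::real^2. v))\<bar> * F (y + e)) = integral (range (\<lambda>y. y + e)) F"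
    by (rule change_of_variables_real_valued)
       (use assms r in \<open>auto intro!: derivative_eq_intros simp: inj_on_def\<close>)
  then show ?thesis unfolding r m by simp
qed

text \<open>
  The difference quotients have integral zero by translation invariance, and they converge
  to the directional derivative under a common bound with compact support.
\<close>

lemma integral_derivative_zero:
  fixes F :: "real^2 \<Rightarrow> real"
  assumes d: "\<And>y. (F has_derivative D y) (at y)" and c: "continuous_on UNIV (\<lambda>y. D y e)"
    and C: "compact C" "\<And>y. y \<notin> C \<Longrightarrow> F y = 0" "\<And>y. y \<notin> C \<Longrightarrow> D y e = 0"
  shows "integral UNIV (\<lambda>y. D y e) = 0"
proof -
  have Fc: "continuous_on UNIV F" using has_derivative_continuous[OF d] by (simp add: continuous_at_imp_continuous_on)
  have "bounded ((\<lambda>y. D y e) ` C)"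
    by (rule compact_imp_bounded[OF compact_continuous_image[OF continuous_on_subset[OF c] C(1)]]) simp
  then obtain M0 where M0: "\<forall>x\<in>(\<lambda>y. D y e) ` C. norm x \<le> M0" unfolding bounded_iff by blast
  define M where "M = max M0 0"
  have M: "\<bar>D y e\<bar> \<le> M" "M \<ge> 0" for y
    using M0 C(3)[of y] by (cases "y \<in> C"; force simp: M_def)+
  define t where "t = (\<lambda>n. inverse (real (Suc n)))"
  have t: "0 < t n" "t n \<le> 1" for n by (simp_all add: t_def field_simps)
  define q where "q = (\<lambda>n y. (F (y + t n *\<^sub>R e) - F y) / t n)"
  have line: "((\<lambda>s. F (y + s *\<^sub>R e)) has_real_derivative D (y + s *\<^sub>R e) e) (at s)" for y s
  proof -
    have "((\<lambda>s. F (y + s *\<^sub>R e)) has_derivative (\<lambda>r. D (y + s *\<^sub>R e) (r *\<^sub>R e))) (at s)"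
      by (rule has_derivative_compose[of "\<lambda>s. y + s *\<^sub>R e" _ _ _ F, OF _ d]) (auto intro!: derivative_eq_intros)
    moreover have "D (y + s *\<^sub>R e) (r *\<^sub>R e) = D (y + s *\<^sub>R e) e * r" for r
      using linear_scale[OF has_derivative_linear[OF d]] by simp
    ultimately show ?thesis by (simp add: has_field_derivative_def)
  qed
  have qb: "\<bar>q n y\<bar> \<le> M" for n y
  proof -
    obtain s where "F (y + t n *\<^sub>R e) - F (y + 0 *\<^sub>R e) = (t n - 0) * D (y + s *\<^sub>R e) e"
      using MVT2[OF t(1)[of n] line[of y]] by blast
    then have "q n y = D (y + s *\<^sub>R e) e" using t(1)[of n] by (simp add: q_def)
    then show ?thesis using M by simp
  qed
  have lim: "(\<lambda>n. q n y) \<longlonglongrightarrow> D y e" for y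
  proof -
    have "(\<lambda>s. (F (y + s *\<^sub>R e) - F (y + 0 *\<^sub>R e)) / (s - 0)) \<midarrow>0\<rightarrow> D (y + 0 *\<^sub>R e) e"
      using line[of y 0] unfolding has_field_derivative_iff .
    moreover have "filterlim t (at 0) sequentially"
      unfolding filterlim_at using t(1) LIMSEQ_inverse_real_of_nat by (auto simp: t_def)
    ultimately have "(\<lambda>n. (F (y + t n *\<^sub>R e) - F (y + 0 *\<^sub>R e)) / (t n - 0)) \<longlonglongrightarrow> D (y + 0 *\<^sub>R e) e"
      by (rule filterlim_compose)
    then show ?thesis by (simp add: q_def)
  qed
  obtain a where a: "\<forall>y\<in>C. norm y \<le> a" using compact_imp_bounded[OF C(1)] unfolding bounded_iff by blast
  define B where "B = cball (0::real^2) (a + norm e)"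
  have q0: "q n y = 0" if "y \<notin> B" for n y
  proof -
    have n: "norm y > a + norm e" using that by (simp add: B_def)
    have "norm (t n *\<^sub>R e) \<le> norm e" using t[of n] mult_right_mono[of "t n" 1 "norm e"] by simp
    then have "norm (y + t n *\<^sub>R e) > a" using n norm_diff_ineq[of y "t n *\<^sub>R e"] by linarith
    then have "y + t n *\<^sub>R e \<notin> C" using a by fastforce
    moreover have "\<not> norm y \<le> a" using n norm_ge_zero[of e] by linarith
    then have "y \<notin> C" using a by blast
    ultimately show ?thesis using C(2) by (simp add: q_def)
  qed
  have Fi: "F absolutely_integrable_on UNIV" by (rule continuous_compact_support_integrable[OF Fc C(1,2)])
  then have Fint: "F integrable_on UNIV" by (simp add: absolutely_integrable_on_def)
  have qc: "continuous_on UNIV (q n)" for n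
    unfolding q_def using t(1)[of n]
    by (intro continuous_intros continuous_on_compose2[OF Fc]) auto
  have qi: "q n integrable_on UNIV" for n
    using continuous_compact_support_integrable[OF qc compact_cball, of 0 "a + norm e" n] q0
    unfolding B_def absolutely_integrable_on_def by blast
  have shift: "(\<lambda>y. F (y + t n *\<^sub>R e)) integrable_on UNIV" for n
  proof -
    have "(\<lambda>y. F (y + t n *\<^sub>R e)) = (\<lambda>y. t n * q n y + F y)" using t(1)[of n] by (auto simp: q_def fun_eq_iff)
    then show ?thesis using integrable_add[OF integrable_on_cmult_left[OF qi] Fint] by simp
  qed
  have q_int: "integral UNIV (q n) = 0" for n
  proof -
    have "integral UNIV (q n) = integral UNIV (\<lambda>y. (F (y + t n *\<^sub>R e) - F y) * inverse (t n))"
      by (simp add: q_def divide_inverse)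
    also have "\<dots> = (integral UNIV (\<lambda>y. F (y + t n *\<^sub>R e)) - integral UNIV F) * inverse (t n)"
      by (simp add: integral_diff[OF shift Fint])
    finally show ?thesis using integral_translate[OF Fi] by simp
  qed
  let ?h = "\<lambda>y. if y \<in> B then M else 0"
  have "?h integrable_on UNIV"
    unfolding B_def integrable_restrict_UNIV by (rule integrable_on_const) simp
  then have "(\<lambda>n. integral UNIV (q n)) \<longlonglongrightarrow> integral UNIV (\<lambda>y. D y e)"
    by (rule dominated_convergence(2)[OF qi]) (use qb q0 lim in auto)
  then show ?thesis using q_int by (simp add: LIMSEQ_const_iff)
qed

context bm_contact_closed begin

text \<open>
  A patch of the surface, parametrised over an open set \<open>D\<close> of \<open>real^2\<close>, in which $d\alpha$
  is positive on the coordinate frame. This positivity orients the patches consistently. The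
  clause on \<open>\<omega> T1 T2\<close> holds because the coordinate fields commute; of the adapted
  coordinates only what is used below is kept.
\<close>

definition ochart where
  "ochart W x1 x2 T1 T2 c D \<longleftrightarrow> open W \<and> open D \<and> x1 \<in> SF \<and> x2 \<in> SF \<and> T1 \<in> BV \<and> T2 \<in> BV \<and>
     (\<forall>q. T1 z q = 0 \<and> T2 z q = 0) \<and>
     (\<forall>q\<in>W \<inter> Z. vector [x1 q, x2 q] \<in> D \<and> c (vector [x1 q, x2 q]) = q \<and> \<omega> T1 T2 q > 0 \<and>
        \<omega> T1 T2 q = T1 (\<alpha> T2) q - T2 (\<alpha> T1) q \<and>
        (\<forall>V\<in>VF. \<forall>h\<in>SF. V z q = 0 \<longrightarrow> V h q = V x1 q * T1 h q + V x2 q * T2 h q)) \<and>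
     (\<forall>y\<in>D. c y \<in> W \<inter> Z \<and> x1 (c y) = y $ 1 \<and> x2 (c y) = y $ 2 \<and>
        (\<forall>h\<in>SF. ((\<lambda>y. h (c y)) has_derivative (\<lambda>v::real^2. v $ 1 * T1 h (c y) + v $ 2 * T2 h (c y))) (at y)))"

definition ext :: "(real^2 \<Rightarrow> 'a) \<Rightarrow> (real^2) set \<Rightarrow> ('a \<Rightarrow> real) \<Rightarrow> real^2 \<Rightarrow> real" where
  "ext c D f y = (if y \<in> D then f (c y) else 0)"

lemma adapted_swap:
  assumes "adapted W x1 x2 T1 T2 Y0" shows "adapted W x2 x1 T2 T1 Y0"
  using assms unfolding adapted_def by (simp add: add.commute)

lemma adapted_subset:
  assumes "adapted W x1 x2 T1 T2 Y0" "open W'" "W' \<subseteq> W" shows "adapted W' x1 x2 T1 T2 Y0"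
  using assms unfolding adapted_def by (simp add: subset_iff)

text \<open>
  At a critical point the area density of \<open>Reeb_on_Z\<close> reduces to \<open>u q * \<omega> T1 T2 q\<close>, so
  \<open>\<omega> T1 T2\<close> is nonzero on a patch. Exchanging the coordinates makes it positive.
\<close>

lemma ochart_exists:
  assumes p: "p \<in> Z" "Z \<subseteq> Crit"
  shows "\<exists>W x1 x2 T1 T2 c D. ochart W x1 x2 T1 T2 c D \<and> p \<in> W"
proof -
  have zp: "z p = 0" using p(1) Z_iff by blast
  obtain W x1 x2 T1 T2 Y0 where a: "adapted W x1 x2 T1 T2 Y0" "p \<in> W" "\<omega> T1 T2 p > 0"
  proof -
    obtain W x1 x2 T1 T2 Y0 where a: "adapted W x1 x2 T1 T2 Y0" "p \<in> W" using adapted_exists[OF zp] .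
    note ad = adaptedD[OF a(1)]
    have "T1 u p = 0" "T2 u p = 0" using Crit_iff[OF a zp] p by blast+
    then have "\<omega> T1 T2 p \<noteq> 0" using Reeb_on_Z(1)[OF a zp] by auto
    then consider "\<omega> T1 T2 p > 0" | "\<omega> T2 T1 p > 0"
      using \<omega>_antisym[OF BV_tangent[OF ad(4,7)] BV_tangent[OF ad(5,8)], of p] by linarith
    then show ?thesis using that a adapted_swap[OF a(1)] by cases blast+
  qed
  note ad = adaptedD[OF a(1)]
  have B: "T1 \<in> BV" "T2 \<in> BV" using BV_tangent[OF ad(4,7)] BV_tangent[OF ad(5,8)] by auto
  let ?W = "W \<inter> {q. \<omega> T1 T2 q > 0}"
  have o: "open ?W" using ad(1) SF_open_pos[OF \<omega>_SF[OF B]] by blast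
  have a': "adapted ?W x1 x2 T1 T2 Y0" by (rule adapted_subset[OF a(1) o]) blast
  have pW: "p \<in> ?W" using a by blast
  obtain W1 c \<epsilon> where patch: "surface_patch x1 x2 T1 T2 p W1 \<epsilon> c" "W1 \<subseteq> ?W"
    using surface_chart[OF a' pW zp] .
  note W1 = surface_patchD(1,2)[OF patch(1)] patch(2) surface_patchD(3)[OF patch(1)]
    and c1 = surface_patchD(4)[OF patch(1)] and c2 = surface_patchD(5)[OF patch(1)]
  define D where "D = {y::real^2. \<bar>y $ 1 - x1 p\<bar> < \<epsilon> \<and> \<bar>y $ 2 - x2 p\<bar> < \<epsilon>}"
  define c' where "c' = (\<lambda>y::real^2. c (y $ 1, y $ 2))"
  have oD: "open D" unfolding D_def by (intro open_Collect_conj open_Collect_less continuous_intros)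
  have "ochart W1 x1 x2 T1 T2 c' D" unfolding ochart_def
  proof (intro conjI allI ballI impI)
    fix q assume q: "q \<in> W1 \<inter> Z"
    have qW: "q \<in> W" "\<omega> T1 T2 q > 0" using q W1(3) by auto
    show "vector [x1 q, x2 q] \<in> D" "c' (vector [x1 q, x2 q]) = q" using c1 q by (auto simp: D_def c'_def)
    show "\<omega> T1 T2 q > 0" by (rule qW(2))
    show "\<omega> T1 T2 q = T1 (\<alpha> T2) q - T2 (\<alpha> T1) q" by (rule \<omega>_tangent[OF a(1) qW(1)])
    show "V h q = V x1 q * T1 h q + V x2 q * T2 h q" if "V \<in> VF" "h \<in> SF" "V z q = 0" for V h
      using ad(17)[OF that(1,2) qW(1)] that(3) by simp
  next
    fix y assume y: "y \<in> D"
    then have c2y: "c' y \<in> W1 \<inter> Z \<and> x1 (c' y) = y $ 1 \<and> x2 (c' y) = y $ 2 \<and>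
      (\<forall>h\<in>SF. ((\<lambda>y. h (c y)) has_derivative (\<lambda>(v, w). v * T1 h (c' y) + w * T2 h (c' y))) (at (y $ 1, y $ 2)))"
      using c2[rule_format, of "y $ 1" "y $ 2"] unfolding D_def c'_def by blast
    then show "c' y \<in> W1 \<inter> Z" "x1 (c' y) = y $ 1" "x2 (c' y) = y $ 2" by blast+
    fix h assume h: "h \<in> SF"
    have 1: "((\<lambda>y::real^2. (y $ 1, y $ 2)) has_derivative (\<lambda>v. (v $ 1, v $ 2))) (at y)"
      by (intro has_derivative_Pair bounded_linear.has_derivative[OF bounded_linear_vec_nth] has_derivative_ident)
    have 2: "((\<lambda>y. h (c y)) has_derivative (\<lambda>(v, w). v * T1 h (c' y) + w * T2 h (c' y))) (at (y $ 1, y $ 2))"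
      using c2y h by blast
    from has_derivative_compose[OF 1 2]
    show "((\<lambda>y. h (c' y)) has_derivative (\<lambda>v. v $ 1 * T1 h (c' y) + v $ 2 * T2 h (c' y))) (at y)"
      unfolding c'_def by simp
  qed (use W1(1) oD ad B in auto)
  then show ?thesis using W1(2) by blast
qed

lemma ochartD:
  assumes "ochart W x1 x2 T1 T2 c D"
  shows "open W" "open D" "x1 \<in> SF" "x2 \<in> SF" "T1 \<in> BV" "T2 \<in> BV" "\<And>q. T1 z q = 0" "\<And>q. T2 z q = 0"
    "\<And>q. q \<in> W \<Longrightarrow> q \<in> Z \<Longrightarrow> vector [x1 q, x2 q] \<in> D" "\<And>q. q \<in> W \<Longrightarrow> q \<in> Z \<Longrightarrow> c (vector [x1 q, x2 q]) = q"
    "\<And>q. q \<in> W \<Longrightarrow> q \<in> Z \<Longrightarrow> \<omega> T1 T2 q > 0" "\<And>q. q \<in> W \<Longrightarrow> q \<in> Z \<Longrightarrow> \<omega> T1 T2 q = T1 (\<alpha> T2) q - T2 (\<alpha> T1) q"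
    "\<And>q V h. q \<in> W \<Longrightarrow> q \<in> Z \<Longrightarrow> V \<in> VF \<Longrightarrow> h \<in> SF \<Longrightarrow> V z q = 0 \<Longrightarrow> V h q = V x1 q * T1 h q + V x2 q * T2 h q"
    "\<And>y. y \<in> D \<Longrightarrow> c y \<in> W" "\<And>y. y \<in> D \<Longrightarrow> c y \<in> Z" "\<And>y. y \<in> D \<Longrightarrow> x1 (c y) = y $ 1" "\<And>y. y \<in> D \<Longrightarrow> x2 (c y) = y $ 2"
    "\<And>y h. y \<in> D \<Longrightarrow> h \<in> SF \<Longrightarrow> ((\<lambda>y. h (c y)) has_derivative (\<lambda>v. v $ 1 * T1 h (c y) + v $ 2 * T2 h (c y))) (at y)"
  using assms unfolding ochart_def by blast+

lemma vec2_eq: "(y::real^2) = vector [y $ 1, y $ 2]"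
  by (simp add: vec_eq_iff forall_2)

text \<open>The set \<open>K \<inter> Z\<close> is compact, and so is its image in the parameters.\<close>

lemma ext_support:
  assumes oc: "ochart W x1 x2 T1 T2 c D" and K: "compact K" "K \<subseteq> W"
  obtains C where "compact C" "C \<subseteq> D"
    "\<And>f y. (\<And>q. q \<notin> K \<Longrightarrow> f q = 0) \<Longrightarrow> y \<notin> C \<Longrightarrow> ext c D f y = 0"
proof -
  note o = ochartD[OF oc]
  let ?C = "(\<lambda>q. vector [x1 q, x2 q] :: real^2) ` (K \<inter> Z)"
  have "continuous_on UNIV (\<lambda>q. vector [x1 q, x2 q] :: real^2)"
  proof -
    have e: "(vector [x1 q, x2 q] :: real^2) = (\<chi> i. if i = 1 then x1 q else x2 q)" for q
      by (simp add: vec_eq_iff forall_2)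
    have "continuous_on UNIV (\<lambda>q. if i = 1 then x1 q else x2 q)" for i :: 2
      using SF_continuous[OF o(3)] SF_continuous[OF o(4)] by (cases "i = 1") auto
    then show ?thesis unfolding e by (rule continuous_on_vec_lambda)
  qed
  moreover have "compact (K \<inter> Z)" using compact_Int[OF K(1) compact_Z] .
  ultimately have "compact ?C" using compact_continuous_image continuous_on_subset by blast
  moreover have "?C \<subseteq> D" using o(9) K(2) by blast
  moreover have "ext c D f y = 0" if f: "\<And>q. q \<notin> K \<Longrightarrow> f q = 0" and y: "y \<notin> ?C" for f y
  proof (cases "y \<in> D")
    case True
    have "vector [x1 (c y), x2 (c y)] = y" using o(16,17)[OF True] vec2_eq[of y] by simp
    have "c y \<notin> K"
    proof
      assume "c y \<in> K"
      then have "vector [x1 (c y), x2 (c y)] \<in> ?C" using o(15)[OF True] by blast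
      then show False using y \<open>vector [x1 (c y), x2 (c y)] = y\<close> by simp
    qed
    then show ?thesis using f by (simp add: ext_def)
  qed (simp add: ext_def)
  ultimately show ?thesis using that by blast
qed

lemma ext_derivative:
  assumes oc: "ochart W x1 x2 T1 T2 c D" and K: "compact K" "K \<subseteq> W"
    and h: "h \<in> SF" "\<And>q. q \<notin> K \<Longrightarrow> h q = 0"
  shows "(ext c D h has_derivative (\<lambda>v. v $ 1 * ext c D (T1 h) y + v $ 2 * ext c D (T2 h) y)) (at y)"
proof (cases "y \<in> D")
  case True
  note o = ochartD[OF oc]
  have "(ext c D h has_derivative (\<lambda>v. v $ 1 * T1 h (c y) + v $ 2 * T2 h (c y))) (at y)"
    by (rule has_derivative_transform_within_open[OF o(18)[OF True h(1)] o(2) True]) (simp add: ext_def)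
  then show ?thesis using True by (simp add: ext_def)
next
  case False
  obtain C where C: "compact C" "C \<subseteq> D" "\<And>f y. (\<And>q. q \<notin> K \<Longrightarrow> f q = 0) \<Longrightarrow> y \<notin> C \<Longrightarrow> ext c D f y = 0"
    using ext_support[OF oc K] by blast
  have "open (- C)" "y \<in> - C" using compact_imp_closed[OF C(1)] C(2) False by auto
  moreover have "0 = ext c D h y'" if "y' \<in> - C" for y' using C(3)[of h y'] h(2) that by simp
  ultimately have "(ext c D h has_derivative (\<lambda>v. 0)) (at y)"
    by (intro has_derivative_transform_within_open[OF has_derivative_const, of "-C" y]) auto
  then show ?thesis using False by (simp add: ext_def)
qed

lemma derivation_support:
  assumes "T \<in> VF" "compact K" "h \<in> SF" "\<And>q. q \<notin> K \<Longrightarrow> h q = 0" "q \<notin> K"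
  shows "T h q = 0"
  by (rule VF_locally_const[OF assms(1,3), of "- K"]) (use assms(2,4,5) compact_imp_closed in auto)

lemma ext_continuous:
  assumes oc: "ochart W x1 x2 T1 T2 c D" and K: "compact K" "K \<subseteq> W"
    and h: "h \<in> SF" "\<And>q. q \<notin> K \<Longrightarrow> h q = 0"
  shows "continuous_on UNIV (ext c D h)" "ext c D h absolutely_integrable_on UNIV"
proof -
  show c: "continuous_on UNIV (ext c D h)"
    using has_derivative_continuous[OF ext_derivative[OF assms]] by (simp add: continuous_at_imp_continuous_on)
  obtain C where C: "compact C" "C \<subseteq> D" "\<And>f y. (\<And>q. q \<notin> K \<Longrightarrow> f q = 0) \<Longrightarrow> y \<notin> C \<Longrightarrow> ext c D f y = 0"
    using ext_support[OF oc K] by blast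
  show "ext c D h absolutely_integrable_on UNIV"
    by (rule continuous_compact_support_integrable[OF c C(1)]) (rule C(3)[OF h(2)])
qed

text \<open>The integral over the patch of the two-form with value \<open>f\<close> on the coordinate frame.\<close>

definition J where "J c D f = integral UNIV (ext c D f)"

lemma J_add:
  assumes oc: "ochart W x1 x2 T1 T2 c D" and K: "compact K" "K \<subseteq> W"
    and "f \<in> SF" "\<And>q. q \<notin> K \<Longrightarrow> f q = 0" "g \<in> SF" "\<And>q. q \<notin> K \<Longrightarrow> g q = 0"
  shows "J c D (\<lambda>q. f q + g q) = J c D f + J c D g"
proof -
  have "ext c D f integrable_on UNIV" "ext c D g integrable_on UNIV"
    using ext_continuous(2)[OF oc K assms(4,5)] ext_continuous(2)[OF oc K assms(6,7)]
    by (simp_all add: absolutely_integrable_on_def)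
  from integral_add[OF this] show ?thesis unfolding J_def ext_def[abs_def]
    by (simp add: if_distrib[of "\<lambda>x. x + _"] cong: if_cong)
qed

lemma J_sum:
  assumes oc: "ochart W x1 x2 T1 T2 c D" and K: "compact K" "K \<subseteq> W" and I: "finite I"
    and f: "\<And>i. i \<in> I \<Longrightarrow> f i \<in> SF" "\<And>i q. i \<in> I \<Longrightarrow> q \<notin> K \<Longrightarrow> f i q = 0"
  shows "J c D (\<lambda>q. \<Sum>i\<in>I. f i q) = (\<Sum>i\<in>I. J c D (f i))"
  using I f
proof (induction I rule: finite_induct)
  case empty then show ?case by (simp add: J_def ext_def[abs_def])
next
  case (insert i I)
  have "J c D (\<lambda>q. f i q + (\<Sum>i\<in>I. f i q)) = J c D (f i) + J c D (\<lambda>q. \<Sum>i\<in>I. f i q)"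
    by (rule J_add[OF oc K]) (use insert in \<open>auto intro!: SF_sum sum.neutral\<close>)
  then show ?case using insert by simp
qed

lemma J_cong:
  assumes oc: "ochart W x1 x2 T1 T2 c D" and "\<And>q. q \<in> W \<Longrightarrow> q \<in> Z \<Longrightarrow> f q = g q"
  shows "J c D f = J c D g"
proof -
  have "ext c D f = ext c D g" using assms(2) ochartD(14,15)[OF oc] by (auto simp: ext_def fun_eq_iff)
  then show ?thesis by (simp add: J_def)
qed

text \<open>The value of $dh \wedge \alpha$ on the coordinate frame.\<close>

definition mdf where "mdf T1 T2 h = (\<lambda>q. T1 h q * \<alpha> T2 q - T2 h q * \<alpha> T1 q)"

text \<open>
  The value of $d(h \alpha) = h\, d\alpha + dh \wedge \alpha$ on the coordinate frame is a
  sum of two coordinate derivatives of functions with compact support.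
\<close>

lemma local_stokes:
  assumes oc: "ochart W x1 x2 T1 T2 c D" and K: "compact K" "K \<subseteq> W"
    and h: "h \<in> SF" "\<And>q. q \<notin> K \<Longrightarrow> h q = 0"
  shows "J c D (\<lambda>q. h q * \<omega> T1 T2 q) + J c D (mdf T1 T2 h) = 0"
proof -
  note o = ochartD[OF oc]
  have V: "T1 \<in> VF" "T2 \<in> VF" using o(5,6) BV_VF by auto
  have aS: "\<alpha> T1 \<in> SF" "\<alpha> T2 \<in> SF" using \<alpha>_SF o(5,6) by auto
  have hT: "T1 h \<in> SF" "T2 h \<in> SF" by (rule VF_SF[OF V(1) h(1)], rule VF_SF[OF V(2) h(1)])
  obtain C where C: "compact C" "C \<subseteq> D" "\<And>f y. (\<And>q. q \<notin> K \<Longrightarrow> f q = 0) \<Longrightarrow> y \<notin> C \<Longrightarrow> ext c D f y = 0"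
    using ext_support[OF oc K] by blast
  have zero: "J c D (T1 f) = 0" "J c D (T2 f) = 0" if f: "f \<in> SF" "\<And>q. q \<notin> K \<Longrightarrow> f q = 0" for f
  proof -
    note d = ext_derivative[OF oc K f]
    have s: "T1 f q = 0" "T2 f q = 0" if "q \<notin> K" for q
      using derivation_support[OF V(1) K(1) f that] derivation_support[OF V(2) K(1) f that] by blast+
    have c: "continuous_on UNIV (ext c D (T1 f))" "continuous_on UNIV (ext c D (T2 f))"
      using ext_continuous(1)[OF oc K VF_SF[OF V(1) f(1)] s(1)] ext_continuous(1)[OF oc K VF_SF[OF V(2) f(1)] s(2)] by blast+
    show "J c D (T1 f) = 0" unfolding J_def
      using integral_derivative_zero[OF d, of "axis 1 1" C] c(1) C(1) C(3)[of f] C(3)[of "T1 f"] f(2) s(1)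
      by (simp add: axis_def)
    show "J c D (T2 f) = 0" unfolding J_def
      using integral_derivative_zero[OF d, of "axis 2 1" C] c(2) C(1) C(3)[of f] C(3)[of "T2 f"] f(2) s(2)
      by (simp add: axis_def)
  qed
  let ?f = "\<lambda>q. h q * \<alpha> T2 q" and ?g = "\<lambda>q. - (h q * \<alpha> T1 q)"
  have f: "?f \<in> SF" and g: "?g \<in> SF" by (rule SF_mult[OF h(1) aS(2)], rule SF_uminus[OF SF_mult[OF h(1) aS(1)]])
  have f0: "?f q = 0" "?g q = 0" if "q \<notin> K" for q using h(2)[OF that] by auto
  have Tf: "T1 ?f \<in> SF" "T2 ?g \<in> SF" by (rule VF_SF[OF V(1) f], rule VF_SF[OF V(2) g])
  have Tf0: "T1 ?f q = 0" "T2 ?g q = 0" if "q \<notin> K" for q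
    using derivation_support[OF V(1) K(1) f f0(1) that] derivation_support[OF V(2) K(1) g f0(2) that] by blast+
  have mS: "mdf T1 T2 h \<in> SF" unfolding mdf_def
    by (rule SF_diff[OF SF_mult[OF hT(1) aS(2)] SF_mult[OF hT(2) aS(1)]])
  have m0: "mdf T1 T2 h q = 0" if "q \<notin> K" for q
    using derivation_support[OF V(1) K(1) h that] derivation_support[OF V(2) K(1) h that] by (simp add: mdf_def)
  have "J c D (\<lambda>q. h q * \<omega> T1 T2 q) + J c D (mdf T1 T2 h) = J c D (\<lambda>q. h q * \<omega> T1 T2 q + mdf T1 T2 h q)"
    by (rule J_add[OF oc K SF_mult[OF h(1) \<omega>_SF[OF o(5,6)]] _ mS m0, symmetric]) (use h(2) in auto)
  also have "\<dots> = J c D (\<lambda>q. T1 ?f q + T2 ?g q)"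
  proof (rule J_cong[OF oc])
    fix q assume q: "q \<in> W" "q \<in> Z"
    show "h q * \<omega> T1 T2 q + mdf T1 T2 h q = T1 ?f q + T2 ?g q"
      unfolding o(12)[OF q] mdf_def VF_mult[OF V(1) h(1) aS(2)] VF_uminus[OF V(2) SF_mult[OF h(1) aS(1)]]
        VF_mult[OF V(2) h(1) aS(1)] by (simp add: algebra_simps)
  qed
  also have "\<dots> = J c D (T1 ?f) + J c D (T2 ?g)" by (rule J_add[OF oc K Tf(1) Tf0(1) Tf(2) Tf0(2)])
  also have "\<dots> = 0" using zero(1)[OF f f0(1)] zero(2)[OF g f0(2)] by simp
  finally show ?thesis .
qed

text \<open>
  The change of variables formula: the hypothesis \<open>eq\<close> says that \<open>f\<close> and \<open>g\<close> are the values
  on the two coordinate frames of the same two-form, provided that the determinant of the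
  change of frame is positive.
\<close>

lemma J_transfer:
  assumes oc: "ochart W x1 x2 T1 T2 c D" and oc': "ochart W' x1' x2' T1' T2' c' D'"
    and K: "compact K" "K \<subseteq> W" "K \<subseteq> W'"
    and f: "f \<in> SF" "\<And>q. q \<notin> K \<Longrightarrow> f q = 0" and g: "g \<in> SF" "\<And>q. q \<notin> K \<Longrightarrow> g q = 0"
    and eq: "\<And>q. q \<in> W \<Longrightarrow> q \<in> W' \<Longrightarrow> q \<in> Z \<Longrightarrow>
      f q = \<bar>T1 x1' q * T2 x2' q - T1 x2' q * T2 x1' q\<bar> * g q"
  shows "J c D f = J c' D' g"
proof -
  note o = ochartD[OF oc] and o' = ochartD[OF oc']
  define S where "S = {y \<in> D. c y \<in> W'}"
  define S' where "S' = {y \<in> D'. c' y \<in> W}"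
  have open_S: "open {y \<in> D. c y \<in> W'}" if oc: "ochart W x1 x2 T1 T2 c D" and W': "open W'" for W x1 x2 T1 T2 c D W'
  proof (subst open_subopen, rule ballI)
    note o = ochartD[OF oc]
    fix y assume y: "y \<in> {y \<in> D. c y \<in> W'}"
    obtain \<rho> V K where \<rho>: "\<rho> \<in> SF" "\<And>q. 0 \<le> \<rho> q" "open V" "c y \<in> V" "\<And>q. q \<in> V \<Longrightarrow> \<rho> q = 1"
      "compact K" "K \<subseteq> W'" "\<And>q. q \<notin> K \<Longrightarrow> \<rho> q = 0"
      using SF_bump[OF W', of "c y"] y by blast
    have "continuous_on D (\<lambda>y. \<rho> (c y))"
      using has_derivative_continuous[OF o(18)[OF _ \<rho>(1)]] by (simp add: continuous_at_imp_continuous_on)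
    then have "open (D \<inter> (\<lambda>y. \<rho> (c y)) -` {0<..})" by (rule continuous_open_preimage[OF _ o(2)]) simp
    moreover have "D \<inter> (\<lambda>y. \<rho> (c y)) -` {0<..} \<subseteq> {y \<in> D. c y \<in> W'}" using \<rho>(7,8) by force
    moreover have "y \<in> D \<inter> (\<lambda>y. \<rho> (c y)) -` {0<..}" using y \<rho>(5)[OF \<rho>(4)] by simp
    ultimately show "\<exists>T. open T \<and> y \<in> T \<and> T \<subseteq> {y \<in> D. c y \<in> W'}" by blast
  qed
  have oS: "open S" unfolding S_def by (rule open_S[OF oc o'(1)])
  define \<phi> where "\<phi> = (\<lambda>y. vector [x1' (c y), x2' (c y)] :: real^2)"
  define \<phi>' where "\<phi>' = (\<lambda>(y::real^2) (v::real^2). vector [v $ 1 * T1 x1' (c y) + v $ 2 * T2 x1' (c y), v $ 1 * T1 x2' (c y) + v $ 2 * T2 x2' (c y)] :: real^2)"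
  have der: "(\<phi> has_derivative \<phi>' y) (at y)" if "y \<in> S" for y
  proof -
    have yD: "y \<in> D" using that by (simp add: S_def)
    have "((\<lambda>y. \<phi> y $ i) has_derivative (\<lambda>v. \<phi>' y v $ i)) (at y)" for i :: 2
      using o(18)[OF yD o'(3)] o(18)[OF yD o'(4)] exhaust_2[of i] by (auto simp: \<phi>_def \<phi>'_def)
    then show ?thesis
      by (auto simp: has_derivative_componentwise_within[of \<phi>] Basis_vec_def inner_axis)
  qed
  have det: "det (matrix (\<phi>' y)) = T1 x1' (c y) * T2 x2' (c y) - T1 x2' (c y) * T2 x1' (c y)" for y
    by (simp add: det_2 matrix_def \<phi>'_def axis_def)
  have inv: "c' (\<phi> y) = c y" "\<phi> y \<in> D'" if "y \<in> S" for y
    using that o(15) o'(9,10) unfolding S_def \<phi>_def by auto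
  have inj: "inj_on \<phi> S"
  proof (rule inj_onI)
    fix y y' assume y: "y \<in> S" "y' \<in> S" "\<phi> y = \<phi> y'"
    then have "c y = c y'" using inv(1) by metis
    moreover have "y \<in> D" "y' \<in> D" using y by (auto simp: S_def)
    ultimately show "y = y'" using o(16,17) vec2_eq[of y] vec2_eq[of y'] by metis
  qed
  have img: "\<phi> ` S = S'"
  proof
    show "\<phi> ` S \<subseteq> S'" using inv o(14) unfolding S'_def S_def by force
    show "S' \<subseteq> \<phi> ` S"
    proof
      fix y assume "y \<in> S'"
      then have y: "y \<in> D'" "c' y \<in> W" by (auto simp: S'_def)
      let ?y = "vector [x1 (c' y), x2 (c' y)] :: real^2"
      have cy: "?y \<in> D" "c ?y = c' y" using o(9,10)[OF y(2) o'(15)[OF y(1)]] by auto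
      then have "?y \<in> S" using o'(14)[OF y(1)] by (simp add: S_def)
      moreover have "\<phi> ?y = y" unfolding \<phi>_def cy(2) o'(16)[OF y(1)] o'(17)[OF y(1)] using vec2_eq[of y] by simp
      ultimately show "y \<in> \<phi> ` S" by (metis imageI)
    qed
  qed
  have fS: "ext c D f = (\<lambda>y. if y \<in> S then f (c y) else 0)"
    using f(2) K(3) by (auto simp: ext_def S_def fun_eq_iff)
  have gS: "ext c' D' g = (\<lambda>y. if y \<in> S' then g (c' y) else 0)"
    using g(2) K(2) by (auto simp: ext_def S'_def fun_eq_iff)
  have "(\<lambda>y. g (c' y)) absolutely_integrable_on S'"
    using ext_continuous(2)[OF oc' K(1,3) g] unfolding gS absolutely_integrable_restrict_UNIV .
  then have "integral S (\<lambda>y. \<bar>det (matrix (\<phi>' y))\<bar> * g (c' (\<phi> y))) = integral (\<phi> ` S) (\<lambda>y. g (c' y))"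
    by (intro change_of_variables_real_valued[OF oS der inj]) (simp_all add: img)
  also have "integral S (\<lambda>y. \<bar>det (matrix (\<phi>' y))\<bar> * g (c' (\<phi> y))) = integral S (\<lambda>y. f (c y))"
  proof (rule integral_cong)
    fix y assume y: "y \<in> S"
    then have "c y \<in> W" "c y \<in> W'" "c y \<in> Z" using o(14,15) by (auto simp: S_def)
    from eq[OF this] show "\<bar>det (matrix (\<phi>' y))\<bar> * g (c' (\<phi> y)) = f (c y)" unfolding inv(1)[OF y] det by simp
  qed
  finally show ?thesis
    unfolding J_def fS gS Henstock_Kurzweil_Integration.integral_restrict_UNIV img by simp
qed

text \<open>
  Both $d\alpha$ and $dh \wedge \alpha$ are multiplied by the determinant of the change of
  frame. As $d\alpha$ is positive on both frames, the determinant is positive and may be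
  replaced by its absolute value.
\<close>

lemma mdf_transform:
  assumes oc: "ochart W x1 x2 T1 T2 c D" and oc': "ochart W' x1' x2' T1' T2' c' D'"
    and q: "q \<in> W" "q \<in> W'" "q \<in> Z" and h: "h \<in> SF"
  shows "mdf T1 T2 h q = \<bar>T1 x1' q * T2 x2' q - T1 x2' q * T2 x1' q\<bar> * mdf T1' T2' h q"
proof -
  note o = ochartD[OF oc] and o' = ochartD[OF oc']
  let ?d = "T1 x1' q * T2 x2' q - T1 x2' q * T2 x1' q"
  have V: "T1 \<in> VF" "T2 \<in> VF" "T1' \<in> VF" "T2' \<in> VF" using o(5,6) o'(5,6) BV_VF by auto
  have e: "T1 h q = T1 x1' q * T1' h q + T1 x2' q * T2' h q" "T2 h q = T2 x1' q * T1' h q + T2 x2' q * T2' h q"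
    if "h \<in> SF" for h
    using o'(13)[OF q(2,3) V(1) that o(7)] o'(13)[OF q(2,3) V(2) that o(8)] by auto
  obtain W0 y1 y2 S1 S2 Y0 where a: "adapted W0 y1 y2 S1 S2 Y0" "q \<in> W0"
    using adapted_exists[of q] q(3) Z_iff by blast
  note ad = adaptedD[OF a(1)]
  have BS: "S1 \<in> BV" "S2 \<in> BV" "normal Y0 \<in> BV"
    using BV_tangent[OF ad(4,7)] BV_tangent[OF ad(5,8)] normal(1)[OF ad(6)] by auto
  have exp: "L T = T y1 q * L S1 + T y2 q * L S2" if L: "tens q L" and T: "T \<in> BV" "\<And>q. T z q = 0" for L T
  proof -
    note TV = BV_VF[OF T(1)]
    have "L T = T y1 q * L S1 + T y2 q * L S2 + 0 * L (normal Y0)"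
    proof (rule tens_combination[OF L T(1) BS VF_SF[OF TV ad(2)] VF_SF[OF TV ad(3)] SF_const[of 0] ad(1) a(2)], intro ballI)
      fix f q assume "f \<in> SF" "q \<in> W0"
      then show "T f q = T y1 q * S1 f q + T y2 q * S2 f q + 0 * normal Y0 f q" using ad(17)[OF TV] T(2) by simp
    qed
    then show ?thesis by simp
  qed
  have y: "y1 \<in> SF" "y2 \<in> SF" by (rule ad)+
  have lin: "L T1 = T1 x1' q * L T1' + T1 x2' q * L T2'" "L T2 = T2 x1' q * L T1' + T2 x2' q * L T2'" if L: "tens q L" for L
    unfolding exp[OF L o(5,7)] exp[OF L o(6,8)] exp[OF L o'(5,7)] exp[OF L o'(6,8)] e[OF y(1)] e[OF y(2)]
    by (simp_all add: algebra_simps)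
  have self: "\<omega> F F q = 0" if "F \<in> BV" for F using \<omega>_antisym[OF that that, of q] by simp
  have "\<omega> T1 T2 q = ?d * \<omega> T1' T2' q"
    unfolding lin(1)[OF tens_\<omega>[OF o(6)]] lin(2)[OF tens_\<omega>'[OF o'(5)]] lin(2)[OF tens_\<omega>'[OF o'(6)]]
      self[OF o'(5)] self[OF o'(6)] \<omega>_antisym[OF o'(5,6), of q] by (simp add: algebra_simps)
  then have "?d > 0" using o(11)[OF q(1,3)] o'(11)[OF q(2,3)] by (metis zero_less_mult_pos2)
  moreover have "mdf T1 T2 h q = ?d * mdf T1' T2' h q"
    unfolding mdf_def e[OF h] lin[OF tens_\<alpha>] by (simp add: algebra_simps)
  ultimately show ?thesis by simp
qed

text \<open>
  Let $\rho_i$ be nonnegative functions supported in patches with $\sum_i \rho_i = 1$ on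
  \<open>Z\<close>. The local Stokes theorem for $\rho_i \alpha$, summed over \<open>i\<close>, gives $\sum_i \int
  \rho_i\, d\alpha + \sum_i \int d\rho_i \wedge \alpha = 0$. The first sum is positive. In
  the second, each integral is split with $\sum_j \rho_j = 1$ and its part with index \<open>j\<close> is
  transferred to the patch \<open>j\<close>. There the sum over \<open>i\<close> is the integral of $\rho_j\, d(\sum_i
  \rho_i) \wedge \alpha = 0$.
\<close>

theorem noncritical_point_exists:
  assumes ne: "Z \<noteq> {}"
  shows "\<exists>p\<in>Z. p \<notin> Crit"
proof (rule ccontr)
  assume "\<not> (\<exists>p\<in>Z. p \<notin> Crit)"
  then have sub: "Z \<subseteq> Crit" by blast
  have "\<forall>p\<in>Z. \<exists>W x1 x2 T1 T2 c D. ochart W x1 x2 T1 T2 c D \<and> p \<in> W" using ochart_exists[OF _ sub] by blast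
  then obtain W x1 x2 T1 T2 c D where oc: "\<And>p. p \<in> Z \<Longrightarrow> ochart (W p) (x1 p) (x2 p) (T1 p) (T2 p) (c p) (D p)"
    and pW: "\<And>p. p \<in> Z \<Longrightarrow> p \<in> W p" by metis
  have "\<forall>p\<in>Z. \<exists>\<rho> W' K. \<rho> \<in> SF \<and> (\<forall>q. 0 \<le> \<rho> q) \<and> open W' \<and> p \<in> W' \<and> (\<forall>q\<in>W'. \<rho> q = 1) \<and> compact K \<and> K \<subseteq> W p \<and>
      (\<forall>q. q \<notin> K \<longrightarrow> \<rho> q = 0)"
  proof
    fix p assume p: "p \<in> Z"
    obtain \<rho> W' K where "\<rho> \<in> SF" "\<And>q. 0 \<le> \<rho> q" "open W'" "p \<in> W'" "\<And>q. q \<in> W' \<Longrightarrow> \<rho> q = 1"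
      "compact K" "K \<subseteq> W p" "\<And>q. q \<notin> K \<Longrightarrow> \<rho> q = 0"
      using SF_bump[OF ochartD(1)[OF oc[OF p]] pW[OF p]] by blast
    then show "\<exists>\<rho> W' K. \<rho> \<in> SF \<and> (\<forall>q. 0 \<le> \<rho> q) \<and> open W' \<and> p \<in> W' \<and> (\<forall>q\<in>W'. \<rho> q = 1) \<and> compact K \<and> K \<subseteq> W p \<and>
      (\<forall>q. q \<notin> K \<longrightarrow> \<rho> q = 0)" by blast
  qed
  then obtain \<eta> W' K where \<eta>: "\<And>p. p \<in> Z \<Longrightarrow> \<eta> p \<in> SF \<and> (\<forall>q. 0 \<le> \<eta> p q) \<and> open (W' p) \<and> p \<in> W' p \<and>
      (\<forall>q\<in>W' p. \<eta> p q = 1) \<and> compact (K p) \<and> K p \<subseteq> W p \<and> (\<forall>q. q \<notin> K p \<longrightarrow> \<eta> p q = 0)" by metis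
  obtain C where C: "C \<subseteq> Z" "finite C" "Z \<subseteq> (\<Union>p\<in>C. W' p)"
    using compactE_image[OF compact_Z, of Z W'] \<eta> by blast
  have CZ: "p \<in> Z" if "p \<in> C" for p using that C(1) by blast
  define s where "s = (\<lambda>q. \<Sum>p\<in>C. \<eta> p q)"
  have sS: "s \<in> SF" unfolding s_def by (rule SF_sum[OF C(2)]) (use \<eta> CZ in blast)
  have s0: "0 \<le> s q" for q unfolding s_def by (rule sum_nonneg) (use \<eta> CZ in blast)
  have sZ: "0 < s q" if q: "q \<in> Z" for q
  proof -
    obtain p where p: "p \<in> C" "q \<in> W' p" using C(3) q by blast
    have "\<eta> p q \<le> s q" unfolding s_def by (rule member_le_sum[OF p(1) _ C(2)]) (use \<eta> CZ in blast)
    then show ?thesis using \<eta>[OF CZ[OF p(1)]] p(2) by fastforce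
  qed
  have pos: "s q + (z q)\<^sup>2 \<noteq> 0" for q
  proof (cases "q \<in> Z")
    case True then show ?thesis using sZ[OF True] by (smt (verit) zero_le_power2)
  next
    case False
    then have "0 < (z q)\<^sup>2" by (simp add: Z_iff)
    then show ?thesis using s0[of q] by linarith
  qed
  \<comment> \<open>The square of \<open>z\<close> makes the denominator positive everywhere and disappears on \<open>Z\<close>.\<close>
  define k where "k = (\<lambda>q. inverse (s q + (z q)\<^sup>2))"
  have kS: "k \<in> SF" unfolding k_def by (rule SF_inverse[OF SF_add[OF sS SF_power[OF z_SF]] pos])
  have k0: "k q > 0" for q
  proof -
    have "s q + (z q)\<^sup>2 > 0" using pos[of q] s0[of q] by (smt (verit) zero_le_power2)
    then show ?thesis by (simp add: k_def)
  qed
  define \<rho> where "\<rho> = (\<lambda>p q. \<eta> p q * k q)"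
  have \<rho>S: "\<rho> p \<in> SF" if "p \<in> C" for p unfolding \<rho>_def by (rule SF_mult[OF _ kS]) (use \<eta>[OF CZ[OF that]] in blast)
  have \<rho>0: "0 \<le> \<rho> p q" if "p \<in> C" for p q
    unfolding \<rho>_def by (rule mult_nonneg_nonneg) (use \<eta>[OF CZ[OF that]] k0[of q] in \<open>auto simp: less_imp_le\<close>)
  have K: "compact (K p)" "K p \<subseteq> W p" if "p \<in> C" for p using \<eta>[OF CZ[OF that]] by auto
  have \<rho>K: "\<rho> p q = 0" if "p \<in> C" "q \<notin> K p" for p q using \<eta>[OF CZ[OF that(1)]] that(2) by (simp add: \<rho>_def)
  have sum1: "(\<Sum>p\<in>C. \<rho> p q) = 1" if "q \<in> Z" for q
  proof -
    have "(\<Sum>p\<in>C. \<rho> p q) = s q * k q" by (simp add: \<rho>_def s_def sum_distrib_right)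
    then show ?thesis using that sZ[OF that] by (simp add: k_def Z_iff)
  qed
  let ?J = "\<lambda>p. J (c p) (D p)" and ?\<omega> = "\<lambda>p. \<omega> (T1 p) (T2 p)" and ?m = "\<lambda>p. mdf (T1 p) (T2 p)"
  have TB: "T1 p \<in> BV" "T2 p \<in> BV" if "p \<in> C" for p using ochartD(5,6)[OF oc[OF CZ[OF that]]] by auto
  have TV: "T1 p \<in> VF" "T2 p \<in> VF" if "p \<in> C" for p using TB[OF that] BV_VF by auto
  have mS: "?m p h \<in> SF" if "p \<in> C" "h \<in> SF" for p h
    unfolding mdf_def
    by (rule SF_diff[OF SF_mult[OF VF_SF[OF TV(1)[OF that(1)] that(2)] \<alpha>_SF[OF TB(2)[OF that(1)]]]
          SF_mult[OF VF_SF[OF TV(2)[OF that(1)] that(2)] \<alpha>_SF[OF TB(1)[OF that(1)]]]])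
  have mK: "?m p (\<rho> i) q = 0" if "p \<in> C" "i \<in> C" "q \<notin> K i" for p i q
    using derivation_support[OF TV(1)[OF that(1)] K(1)[OF that(2)] \<rho>S[OF that(2)] \<rho>K[OF that(2)] that(3)]
      derivation_support[OF TV(2)[OF that(1)] K(1)[OF that(2)] \<rho>S[OF that(2)] \<rho>K[OF that(2)] that(3)]
    by (simp add: mdf_def)
  have stokes: "?J i (\<lambda>q. \<rho> i q * ?\<omega> i q) + ?J i (?m i (\<rho> i)) = 0" if "i \<in> C" for i
    by (rule local_stokes[OF oc[OF CZ[OF that]] K[OF that] \<rho>S[OF that] \<rho>K[OF that]])
  have prodS: "(\<lambda>q. \<rho> j q * ?m p (\<rho> i) q) \<in> SF" if "p \<in> C" "i \<in> C" "j \<in> C" for p i j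
    by (rule SF_mult[OF \<rho>S[OF that(3)] mS[OF that(1) \<rho>S[OF that(2)]]])
  have split: "?J i (?m i (\<rho> i)) = (\<Sum>j\<in>C. ?J i (\<lambda>q. \<rho> j q * ?m i (\<rho> i) q))" if i: "i \<in> C" for i
  proof -
    have "?J i (?m i (\<rho> i)) = ?J i (\<lambda>q. \<Sum>j\<in>C. \<rho> j q * ?m i (\<rho> i) q)"
      by (rule J_cong[OF oc[OF CZ[OF i]]]) (simp add: sum_distrib_right[symmetric] sum1)
    also have "\<dots> = (\<Sum>j\<in>C. ?J i (\<lambda>q. \<rho> j q * ?m i (\<rho> i) q))"
      by (rule J_sum[OF oc[OF CZ[OF i]] K[OF i] C(2)]) (use prodS[OF i i] mK[OF i i] in auto)
    finally show ?thesis .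
  qed
  have swap: "?J i (\<lambda>q. \<rho> j q * ?m i (\<rho> i) q) = ?J j (\<lambda>q. \<rho> j q * ?m j (\<rho> i) q)" if i: "i \<in> C" and j: "j \<in> C" for i j
  proof (rule J_transfer[OF oc[OF CZ[OF i]] oc[OF CZ[OF j]], of "K i \<inter> K j"])
    show "compact (K i \<inter> K j)" by (rule compact_Int[OF K(1)[OF i] K(1)[OF j]])
    show "K i \<inter> K j \<subseteq> W i" "K i \<inter> K j \<subseteq> W j" using K(2) i j by blast+
    show "\<rho> j q * ?m i (\<rho> i) q = 0" "\<rho> j q * ?m j (\<rho> i) q = 0" if "q \<notin> K i \<inter> K j" for q
      using that mK[OF i i, of q] mK[OF j i, of q] \<rho>K[OF j, of q] by auto
    fix q assume q: "q \<in> W i" "q \<in> W j" "q \<in> Z"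
    show "\<rho> j q * ?m i (\<rho> i) q = \<bar>T1 i (x1 j) q * T2 i (x2 j) q - T1 i (x2 j) q * T2 i (x1 j) q\<bar> * (\<rho> j q * ?m j (\<rho> i) q)"
      using mdf_transform[OF oc[OF CZ[OF i]] oc[OF CZ[OF j]] q \<rho>S[OF i]] by simp
  qed (use prodS i j in auto)
  have "(\<Sum>i\<in>C. ?J j (\<lambda>q. \<rho> j q * ?m j (\<rho> i) q)) = 0" if j: "j \<in> C" for j
  proof -
    note oj = oc[OF CZ[OF j]]
    let ?r = "\<lambda>q. \<Sum>i\<in>C. \<rho> i q"
    have rS: "?r \<in> SF" by (rule SF_sum[OF C(2) \<rho>S])
    have tangent0: "T1 j ?r q = 0 \<and> T2 j ?r q = 0" if q: "q \<in> W j" "q \<in> Z" for q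
    proof -
      note o = ochartD[OF oj]
      let ?y = "vector [x1 j q, x2 j q] :: real^2"
      have y: "?y \<in> D j" "c j ?y = q" by (rule o(9)[OF q], rule o(10)[OF q])
      have d: "((\<lambda>y. ?r (c j y)) has_derivative (\<lambda>v. v $ 1 * T1 j ?r q + v $ 2 * T2 j ?r q)) (at ?y)"
        using o(18)[OF y(1) rS] y(2) by simp
      have "((\<lambda>y. ?r (c j y)) has_derivative (\<lambda>v. 0)) (at ?y)"
        by (rule has_derivative_transform_within_open[OF has_derivative_const[of 1] o(2) y(1)])
           (use sum1 o(15) in simp)
      from has_derivative_unique[OF d this]
      have "(\<lambda>v::real^2. v $ 1 * T1 j ?r q + v $ 2 * T2 j ?r q) = (\<lambda>v. 0)" .
      from fun_cong[OF this, of "axis 1 1"] fun_cong[OF this, of "axis 2 1"] show ?thesis by (simp add: axis_def)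
    qed
    have "(\<Sum>i\<in>C. ?J j (\<lambda>q. \<rho> j q * ?m j (\<rho> i) q)) = ?J j (\<lambda>q. \<Sum>i\<in>C. \<rho> j q * ?m j (\<rho> i) q)"
      by (rule J_sum[OF oj K[OF j] C(2), symmetric]) (use prodS[OF j _ j] \<rho>K[OF j] in auto)
    also have "\<dots> = ?J j (\<lambda>q. 0)"
    proof (rule J_cong[OF oj])
      fix q assume q: "q \<in> W j" "q \<in> Z"
      have "(\<Sum>i\<in>C. ?m j (\<rho> i) q) = ?m j ?r q"
        unfolding mdf_def using VF_sum[of "T1 j" C \<rho>, OF TV(1)[OF j] C(2) \<rho>S] VF_sum[of "T2 j" C \<rho>, OF TV(2)[OF j] C(2) \<rho>S]
        by (simp add: sum_subtractf sum_distrib_right)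
      also have "\<dots> = 0" using tangent0[OF q] by (simp add: mdf_def)
      finally show "(\<Sum>i\<in>C. \<rho> j q * ?m j (\<rho> i) q) = 0" by (simp add: sum_distrib_left[symmetric])
    qed
    also have "\<dots> = 0" by (simp add: J_def ext_def[abs_def])
    finally show ?thesis .
  qed
  then have "(\<Sum>j\<in>C. \<Sum>i\<in>C. ?J j (\<lambda>q. \<rho> j q * ?m j (\<rho> i) q)) = 0" by simp
  then have "(\<Sum>i\<in>C. \<Sum>j\<in>C. ?J i (\<lambda>q. \<rho> j q * ?m i (\<rho> i) q)) = 0"
    by (subst sum.swap) (simp add: swap cong: sum.cong)
  then have m0: "(\<Sum>i\<in>C. ?J i (?m i (\<rho> i))) = 0" by (simp add: split cong: sum.cong)
  have area: "?J i (\<lambda>q. \<rho> i q * ?\<omega> i q) > 0" if i: "i \<in> C" for i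
  proof -
    note oi = oc[OF CZ[OF i]]
    note o = ochartD[OF oi]
    let ?f = "\<lambda>q. \<rho> i q * ?\<omega> i q"
    have f: "?f \<in> SF" by (rule SF_mult[OF \<rho>S[OF i] \<omega>_SF[OF TB[OF i]]])
    have f0: "?f q = 0" if "q \<notin> K i" for q using \<rho>K[OF i that] by simp
    obtain C' where C': "compact C'" "C' \<subseteq> D i" "\<And>f y. (\<And>q. q \<notin> K i \<Longrightarrow> f q = 0) \<Longrightarrow> y \<notin> C' \<Longrightarrow> ext (c i) (D i) f y = 0"
      using ext_support[OF oi K[OF i]] by blast
    have iW: "i \<in> W i" "i \<in> Z" using pW CZ i by auto
    have "\<eta> i i = 1" using \<eta>[OF iW(2)] by blast
    then have "?f i > 0" using k0[of i] o(11)[OF iW] by (simp add: \<rho>_def)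
    then have posy: "ext (c i) (D i) ?f (vector [x1 i i, x2 i i]) > 0"
      using o(9,10)[OF iW] by (simp add: ext_def)
    show ?thesis unfolding J_def
    proof (rule continuous_compact_support_integral_pos[OF ext_continuous(1)[OF oi K[OF i] f f0] C'(1) _ _ posy])
      show "ext (c i) (D i) ?f y = 0" if "y \<notin> C'" for y by (rule C'(3)[OF f0 that])
      show "0 \<le> ext (c i) (D i) ?f y" for y
      proof (cases "y \<in> D i")
        case True
        then show ?thesis using \<rho>0[OF i, of "c i y"] o(11)[OF o(14)[OF True] o(15)[OF True]] by (simp add: ext_def)
      qed (simp add: ext_def)
    qed
  qed
  have "C \<noteq> {}" using ne C(3) by blast
  then have "(\<Sum>i\<in>C. ?J i (\<lambda>q. \<rho> i q * ?\<omega> i q)) > 0" using area C(2) by (intro sum_pos) auto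
  moreover have "(\<Sum>i\<in>C. ?J i (\<lambda>q. \<rho> i q * ?\<omega> i q)) + (\<Sum>i\<in>C. ?J i (?m i (\<rho> i))) = 0"
    using stokes by (simp add: sum.distrib[symmetric])
  ultimately show False using m0 by linarith
qed

end

theorem proposition6p1:
  fixes A :: "('a::{t2_space,second_countable_topology} set \<times> ('a \<Rightarrow> real^3)) set"
    and z :: "'a \<Rightarrow> real" and m :: nat and \<alpha> :: "'a bm_form1"
  assumes "smooth_atlas A"
    and "defining_function A z"
    and "m \<ge> 1"
    and "bm_contact_form A z m \<alpha>"
    and "compact (critical_set z)"
    and "critical_set z \<noteq> {}"
  shows "infinite {C \<in> periodic_orbits A (reeb_field A z m \<alpha>). C \<subseteq> critical_set z}"
proof -
  interpret bm_contact_closed A z m \<alpha>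
    by unfold_locales (use assms in auto)
  obtain p where "p \<in> critical_set z" "p \<notin> Crit" using noncritical_point_exists[OF assms(6)] by blast
  then show ?thesis unfolding reeb_field_eq by (rule infinitely_many_orbits)
qed

end
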